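(* \textsf{eFrege}$+\forall$-Red simulates \textsf{IRM-calc}: there is a polynomial $P$ such that for every closed PCNF QBF $\Pi\phi$ and every \textsf{IRM-calc} refutation $\pi$ of $\Pi\phi$ there is an \textsf{eFrege}$+\forall$-Red refutation of $\Pi\phi$ of size at most $P(|\pi|)$.
   Context: A closed PCNF QBF is $\Pi\phi$ with $\Pi$ a linear quantifier prefix over all variables of the CNF $\phi$; $\mathrm{lev}(v)$ is the position of $v$ in $\Pi$. \textsf{eFrege}$+\forall$-Red: lines are propositional formulas; it has the rules of a Frege system (a fixed finite sound and implicationally complete set of propositional axiom and rule schemata), the extension rule (introduce $v\leftrightarrow f$ for a fresh variable $v$, placed in the prefix as an existential variable right of the variables of $f$), and the reduction rule: from $F$ containing universal $u$ such that no variable of $F$ is right of $u$ in the prefix, derive $F[u/0]$ or $F[u/1]$. A refutation derives $\bot$ from the clauses of $\phi$. \textsf{IRM-calc}: an extended assignment is a partial map from universal variables to $\{0,1,*\}$. An annotated literal $l^\tau$ is an existential literal with an extended assignment $\tau$ to universal variables left of $l$; annotated clauses are sets of these. $l^{[\sigma]_l}$ denotes $l$ annotated with $\{c/u\in\sigma:\mathrm{lev}(u)<\mathrm{lev}(l)\}$. The completion $\alpha\circ\beta$ equals $\alpha(u)$ on $\mathrm{dom}(\alpha)$, $\beta(u)$ on $\mathrm{dom}(\beta)\setminus\mathrm{dom}(\alpha)$, unassigned otherwise; $\mathrm{inst}(\alpha,C)=\{l^{[\tau\circ\alpha]_l}: l^\tau\in C\}$. Rules: Axiom: for a non-tautological clause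 $C$ of $\phi$ and $\tau$ the assignment falsifying exactly the universal literals of $C$, derive $\{l^{[\tau]_l}: l\in C\text{ existential}\}$. Instantiation: from $C$ derive $\mathrm{inst}(\tau,C)$ for $\tau$ with values in $\{0,1\}$. Resolution: from $x^{\tau\cup\xi}\vee C_1$ and $\neg x^{\tau\cup\sigma}\vee C_2$, where $\mathrm{dom}(\tau),\mathrm{dom}(\xi),\mathrm{dom}(\sigma)$ are pairwise disjoint, $\tau$ has values in $\{0,1\}$ and $\sigma,\xi$ have values in $\{0,1,*\}$, derive $\mathrm{inst}(\sigma,C_1)\cup\mathrm{inst}(\xi,C_2)$. Merging: from $C\vee b^\mu\vee b^\sigma$ with $\mathrm{dom}(\mu)=\mathrm{dom}(\sigma)$ derive $C\vee b^\xi$ where $\xi=\{c/u: c/u\in\mu,c/u\in\sigma\}\cup\{*/u: c/u\in\mu,d/u\in\sigma,c\ne d\}$. A refutation derives the empty clause. *)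

theory Defs
  imports "HOL-Computational_Algebra.Polynomial"
begin

type_synonym var = nat

section \<open>Closed prenex CNF QBFs\<close>

datatype literal = Pos var | Neg var

fun lvar :: "literal \<Rightarrow> var" where
  "lvar (Pos x) = x"
| "lvar (Neg x) = x"

type_synonym clause = "literal list"
type_synonym cnf = "clause list"

datatype quantifier = Forall | Exists

text \<open>The leftmost (outermost) quantifier is the head of the list.\<close>
type_synonym prefix = "(quantifier \<times> var) list"

definition prefix_vars :: "prefix \<Rightarrow> var set" where
  "prefix_vars \<Pi> = snd ` set \<Pi>"

definition universals :: "prefix \<Rightarrow> var set" where
  "universals \<Pi> = {u. (Forall, u) \<in> set \<Pi>}"

definition existentials :: "prefix \<Rightarrow> var set" where
  "existentials \<Pi> = {x. (Exists, x) \<in> set \<Pi>}"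

definition lev :: "prefix \<Rightarrow> var \<Rightarrow> nat" where
  "lev \<Pi> v = length (takeWhile (\<lambda>p. snd p \<noteq> v) \<Pi>)"

definition closed_pcnf :: "prefix \<Rightarrow> cnf \<Rightarrow> bool" where
  "closed_pcnf \<Pi> \<phi> \<longleftrightarrow>
     distinct (map snd \<Pi>) \<and> (\<forall>C\<in>set \<phi>. lvar ` set C \<subseteq> prefix_vars \<Pi>)"

definition tautological :: "clause \<Rightarrow> bool" where
  "tautological C \<longleftrightarrow> (\<exists>x. Pos x \<in> set C \<and> Neg x \<in> set C)"


section \<open>Propositional formulas and Frege systems\<close>

datatype form =
    Var var
  | FBot
  | FTop
  | FNot form
  | FAnd form form
  | FOr form form
  | FImp form form
  | FIff form form

fun eval :: "(var \<Rightarrow> bool) \<Rightarrow> form \<Rightarrow> bool" where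
  "eval v (Var x) = v x"
| "eval v FBot = False"
| "eval v FTop = True"
| "eval v (FNot A) = (\<not> eval v A)"
| "eval v (FAnd A B) = (eval v A \<and> eval v B)"
| "eval v (FOr A B) = (eval v A \<or> eval v B)"
| "eval v (FImp A B) = (eval v A \<longrightarrow> eval v B)"
| "eval v (FIff A B) = (eval v A \<longleftrightarrow> eval v B)"

fun fvars :: "form \<Rightarrow> var set" where
  "fvars (Var x) = {x}"
| "fvars FBot = {}"
| "fvars FTop = {}"
| "fvars (FNot A) = fvars A"
| "fvars (FAnd A B) = fvars A \<union> fvars B"
| "fvars (FOr A B) = fvars A \<union> fvars B"
| "fvars (FImp A B) = fvars A \<union> fvars B"
| "fvars (FIff A B) = fvars A \<union> fvars B"

fun subst :: "(var \<Rightarrow> form) \<Rightarrow> form \<Rightarrow> form" where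
  "subst s (Var x) = s x"
| "subst s FBot = FBot"
| "subst s FTop = FTop"
| "subst s (FNot A) = FNot (subst s A)"
| "subst s (FAnd A B) = FAnd (subst s A) (subst s B)"
| "subst s (FOr A B) = FOr (subst s A) (subst s B)"
| "subst s (FImp A B) = FImp (subst s A) (subst s B)"
| "subst s (FIff A B) = FIff (subst s A) (subst s B)"

text \<open>Number of symbols; a variable counts as one symbol.\<close>
fun fsize :: "form \<Rightarrow> nat" where
  "fsize (Var x) = 1"
| "fsize FBot = 1"
| "fsize FTop = 1"
| "fsize (FNot A) = fsize A + 1"
| "fsize (FAnd A B) = fsize A + fsize B + 1"
| "fsize (FOr A B) = fsize A + fsize B + 1"
| "fsize (FImp A B) = fsize A + fsize B + 1"
| "fsize (FIff A B) = fsize A + fsize B + 1"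

text \<open>
  A rule schema is a list of premises and a conclusion, the variables of which play the role of
  metavariables for formulas. Axiom schemata are the rules without premises.
\<close>
type_synonym frege_rule = "form list \<times> form"

definition entails :: "form set \<Rightarrow> form \<Rightarrow> bool" where
  "entails \<Gamma> A \<longleftrightarrow> (\<forall>v. (\<forall>B\<in>\<Gamma>. eval v B) \<longrightarrow> eval v A)"

inductive frege_derives :: "frege_rule set \<Rightarrow> form set \<Rightarrow> form \<Rightarrow> bool"
  for \<F> :: "frege_rule set" and \<Gamma> :: "form set" where
  hyp: "A \<in> \<Gamma> \<Longrightarrow> frege_derives \<F> \<Gamma> A"
| rule: "(ps, c) \<in> \<F> \<Longrightarrow> (\<And>p. p \<in> set ps \<Longrightarrow> frege_derives \<F> \<Gamma> (subst s p))
         \<Longrightarrow> frege_derives \<F> \<Gamma> (subst s c)"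

definition frege_system :: "frege_rule set \<Rightarrow> bool" where
  "frege_system \<F> \<longleftrightarrow>
     finite \<F> \<and>
     (\<forall>(ps, c)\<in>\<F>. entails (set ps) c) \<and>
     (\<forall>\<Gamma> A. finite \<Gamma> \<longrightarrow> entails \<Gamma> A \<longrightarrow> frege_derives \<F> \<Gamma> A)"


section \<open>Extended Frege with universal reduction\<close>

fun lit_form :: "literal \<Rightarrow> form" where
  "lit_form (Pos x) = Var x"
| "lit_form (Neg x) = FNot (Var x)"

fun clause_form :: "clause \<Rightarrow> form" where
  "clause_form [] = FBot"
| "clause_form [l] = lit_form l"
| "clause_form (l # l' # ls) = FOr (lit_form l) (clause_form (l' # ls))"

definition const_form :: "bool \<Rightarrow> form" where
  "const_form b = (if b then FTop else FBot)"

text \<open>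
  \<open>efrege_derivation \<F> \<Pi> \<phi> \<Pi>' Ls\<close>: \<open>Ls\<close> is a derivation, in order, from the clauses of \<open>\<phi>\<close>,
  and \<open>\<Pi>'\<close> is the prefix obtained from \<open>\<Pi>\<close> by inserting the extension variables introduced
  in \<open>Ls\<close>. The prefix does not count towards the size. All lines range over variables of the
  current prefix, so a variable outside it is fresh.
\<close>
inductive efrege_derivation ::
    "frege_rule set \<Rightarrow> prefix \<Rightarrow> cnf \<Rightarrow> prefix \<Rightarrow> form list \<Rightarrow> bool"
  for \<F> :: "frege_rule set" and \<Pi> :: prefix and \<phi> :: cnf where
  empty: "efrege_derivation \<F> \<Pi> \<phi> \<Pi> []"
| clause: "efrege_derivation \<F> \<Pi> \<phi> \<Pi>' Ls \<Longrightarrow> C \<in> set \<phi>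
     \<Longrightarrow> efrege_derivation \<F> \<Pi> \<phi> \<Pi>' (Ls @ [clause_form C])"
| frege: "efrege_derivation \<F> \<Pi> \<phi> \<Pi>' Ls \<Longrightarrow> (ps, c) \<in> \<F>
     \<Longrightarrow> (\<And>p. p \<in> set ps \<Longrightarrow> subst s p \<in> set Ls)
     \<Longrightarrow> fvars (subst s c) \<subseteq> prefix_vars \<Pi>'
     \<Longrightarrow> efrege_derivation \<F> \<Pi> \<phi> \<Pi>' (Ls @ [subst s c])"
| extension: "efrege_derivation \<F> \<Pi> \<phi> (\<Pi>\<^sub>1 @ \<Pi>\<^sub>2) Ls
     \<Longrightarrow> v \<notin> prefix_vars (\<Pi>\<^sub>1 @ \<Pi>\<^sub>2) \<Longrightarrow> fvars f \<subseteq> prefix_vars \<Pi>\<^sub>1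
     \<Longrightarrow> efrege_derivation \<F> \<Pi> \<phi> (\<Pi>\<^sub>1 @ (Exists, v) # \<Pi>\<^sub>2) (Ls @ [FIff (Var v) f])"
| reduction: "efrege_derivation \<F> \<Pi> \<phi> \<Pi>' Ls \<Longrightarrow> A \<in> set Ls
     \<Longrightarrow> u \<in> universals \<Pi>' \<Longrightarrow> u \<in> fvars A
     \<Longrightarrow> (\<And>w. w \<in> fvars A \<Longrightarrow> \<not> lev \<Pi>' u < lev \<Pi>' w)
     \<Longrightarrow> efrege_derivation \<F> \<Pi> \<phi> \<Pi>' (Ls @ [subst (Var(u := const_form b)) A])"

definition efrege_refutation :: "frege_rule set \<Rightarrow> prefix \<Rightarrow> cnf \<Rightarrow> form list \<Rightarrow> bool" where
  "efrege_refutation \<F> \<Pi> \<phi> Ls \<longleftrightarrow>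
     (\<exists>\<Pi>'. efrege_derivation \<F> \<Pi> \<phi> \<Pi>' Ls) \<and> FBot \<in> set Ls"

definition efrege_size :: "form list \<Rightarrow> nat" where
  "efrege_size Ls = (\<Sum>A\<leftarrow>Ls. fsize A)"


section \<open>IRM-calc\<close>

datatype aval = Const bool | Star

type_synonym xassign = "var \<rightharpoonup> aval"
type_synonym alit = "literal \<times> xassign"
type_synonym aclause = "alit set"

definition restrict_ann :: "prefix \<Rightarrow> literal \<Rightarrow> xassign \<Rightarrow> xassign" where
  "restrict_ann \<Pi> l \<sigma> = \<sigma> |` {u. lev \<Pi> u < lev \<Pi> (lvar l)}"

text \<open>The left argument takes precedence, whereas it is the right one for \<open>++\<close>.\<close>
definition completion :: "xassign \<Rightarrow> xassign \<Rightarrow> xassign" where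
  "completion \<alpha> \<beta> = \<beta> ++ \<alpha>"

definition inst :: "prefix \<Rightarrow> xassign \<Rightarrow> aclause \<Rightarrow> aclause" where
  "inst \<Pi> \<alpha> C = {(l, restrict_ann \<Pi> l (completion \<tau> \<alpha>)) | l \<tau>. (l, \<tau>) \<in> C}"

definition falsifying :: "prefix \<Rightarrow> clause \<Rightarrow> xassign" where
  "falsifying \<Pi> C = (\<lambda>u.
     if u \<in> universals \<Pi> \<and> Pos u \<in> set C then Some (Const False)
     else if u \<in> universals \<Pi> \<and> Neg u \<in> set C then Some (Const True)
     else None)"

definition axiom_clause :: "prefix \<Rightarrow> clause \<Rightarrow> aclause" where
  "axiom_clause \<Pi> C =
     {(l, restrict_ann \<Pi> l (falsifying \<Pi> C)) | l. l \<in> set C \<and> lvar l \<in> existentials \<Pi>}"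

text \<open>Only used if both arguments have the same domain.\<close>
definition merge_ann :: "xassign \<Rightarrow> xassign \<Rightarrow> xassign" where
  "merge_ann \<mu> \<sigma> = (\<lambda>u. if \<mu> u = \<sigma> u then \<mu> u else Some Star)"

inductive irm_rule :: "prefix \<Rightarrow> aclause set \<Rightarrow> aclause \<Rightarrow> bool"
  for \<Pi> :: prefix and Ds :: "aclause set" where
  instantiate: "C \<in> Ds \<Longrightarrow> dom \<tau> \<subseteq> universals \<Pi> \<Longrightarrow> ran \<tau> \<subseteq> range Const
     \<Longrightarrow> irm_rule \<Pi> Ds (inst \<Pi> \<tau> C)"
| resolve: "insert (Pos x, \<tau> ++ \<xi>) C\<^sub>1 \<in> Ds \<Longrightarrow> insert (Neg x, \<tau> ++ \<sigma>) C\<^sub>2 \<in> Ds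
     \<Longrightarrow> dom \<tau> \<inter> dom \<xi> = {} \<Longrightarrow> dom \<tau> \<inter> dom \<sigma> = {} \<Longrightarrow> dom \<xi> \<inter> dom \<sigma> = {}
     \<Longrightarrow> ran \<tau> \<subseteq> range Const
     \<Longrightarrow> irm_rule \<Pi> Ds (inst \<Pi> \<sigma> C\<^sub>1 \<union> inst \<Pi> \<xi> C\<^sub>2)"
| merge: "C \<union> {(b, \<mu>), (b, \<sigma>)} \<in> Ds \<Longrightarrow> dom \<mu> = dom \<sigma>
     \<Longrightarrow> irm_rule \<Pi> Ds (insert (b, merge_ann \<mu> \<sigma>) C)"

text \<open>
  A proof line obtained by the axiom rule records the clause of the matrix it is read off from.
  This clause counts towards the size of the proof: its universal literals to the right of all
  its existential literals leave no trace in the annotated clause, although any refutation that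
  uses the clause has to write them down.
\<close>
datatype irm_line =
    Axiom_Line clause aclause
  | Rule_Line aclause

fun concl :: "irm_line \<Rightarrow> aclause" where
  "concl (Axiom_Line C D) = D"
| "concl (Rule_Line D) = D"

inductive irm_derivation :: "prefix \<Rightarrow> cnf \<Rightarrow> irm_line list \<Rightarrow> bool"
  for \<Pi> :: prefix and \<phi> :: cnf where
  empty: "irm_derivation \<Pi> \<phi> []"
| axiom: "irm_derivation \<Pi> \<phi> \<pi> \<Longrightarrow> C \<in> set \<phi> \<Longrightarrow> \<not> tautological C
     \<Longrightarrow> irm_derivation \<Pi> \<phi> (\<pi> @ [Axiom_Line C (axiom_clause \<Pi> C)])"
| rule: "irm_derivation \<Pi> \<phi> \<pi> \<Longrightarrow> irm_rule \<Pi> (concl ` set \<pi>) D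
     \<Longrightarrow> irm_derivation \<Pi> \<phi> (\<pi> @ [Rule_Line D])"

definition irm_refutation :: "prefix \<Rightarrow> cnf \<Rightarrow> irm_line list \<Rightarrow> bool" where
  "irm_refutation \<Pi> \<phi> \<pi> \<longleftrightarrow> irm_derivation \<Pi> \<phi> \<pi> \<and> {} \<in> concl ` set \<pi>"

definition aclause_size :: "aclause \<Rightarrow> nat" where
  "aclause_size D = (\<Sum>(l, \<tau>)\<in>D. 1 + card (dom \<tau>))"

fun irm_line_size :: "irm_line \<Rightarrow> nat" where
  "irm_line_size (Axiom_Line C D) = 1 + length C + aclause_size D"
| "irm_line_size (Rule_Line D) = 1 + aclause_size D"

text \<open>Clauses and annotations occurring in a derivation are finite, so the sums and
  cardinalities are the intended ones.\<close>
definition irm_size :: "irm_line list \<Rightarrow> nat" where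
  "irm_size \<pi> = (\<Sum>L\<leftarrow>\<pi>. irm_line_size L)"

end

theory Submission
  imports Defs
begin

text \<open>Every annotated clause derived in IRM-calc is witnessed by a local strategy for the universal
  variables: extension variables state whether a universal is set and to which value, and they
  only depend on variables to its left. The line of the simulation says that if the universal
  assignment follows the strategy, then some literal of the clause is true and its annotation is the
  one played by the strategy. Strategies for the conclusions of the rules are defined from those of
  the premises; for a resolution step one follows both premises until one of them deviates from the
  annotation of its pivot literal, or the value of the pivot is known, and then commits to one premise. For
  the empty clause the line says that the strategy is beaten by no universal assignment following it,
  and universal reduction refutes this from right to left.\<close>

section \<open>Frege systems simulate all small sound rules\<close>

text \<open>The obstacle is placement: what is played for a universal may depend only on variables
  to its left, or it could not be reduced. The value of a pivot can thus be consulted only right of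
  it, and to its left both premises have to be followed at once. This works since the pivot
  annotations share only \<tau>, which is constant, and are disjoint otherwise, so that the two
  strategies cannot contradict each other while both match. It also explains the crosswise
  instantiation: a commitment to the second premise finds the universals of \<xi> left of it already
  set by the first one, and plays \<xi> itself wherever the second strategy leaves a later one
  unset.

  The Frege system is arbitrary, so no derivation is written out in it. Every propositional
  inference is an instance of one of finitely many sound schemata, each of which costs a constant
  \<open>k\<close> times the bound \<open>M\<close> on the substituted formulas. As the prefix does
  not count towards the size, strategy variables are introduced only for universals occurring in the
  refutation. \<open>M\<close> is quadratic in the size of the refutation, since a clause has
  linearly many literals with annotations of linear length.\<close>

lemma subst_subst: "subst t (subst s A) = subst (\<lambda>x. subst t (s x)) A"
  by (induction A) auto

lemma fvars_subst: "fvars (subst s A) = (\<Union>x\<in>fvars A. fvars (s x))"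
  by (induction A) auto

lemma subst_id: "(\<And>x. x \<in> fvars A \<Longrightarrow> s x = Var x) \<Longrightarrow> subst s A = A"
  by (induction A) auto

lemma fsize_pos: "fsize A > 0"
  by (induction A) auto

lemma fsize_subst_le:
  assumes "\<And>x. fsize (s x) \<le> M"
  shows "fsize (subst s A) \<le> fsize A * M"
proof -
  have "1 \<le> M"
    using assms fsize_pos by (metis One_nat_def Suc_leI le_trans)
  then show ?thesis
    using assms by (induction A) (auto simp: algebra_simps intro: add_mono)
qed

lemma finite_bounded_forms: "finite {A. fsize A \<le> n \<and> fvars A \<subseteq> {..<K}}"
proof (induction n)
  case 0
  have "{A. fsize A \<le> 0 \<and> fvars A \<subseteq> {..<K}} = {}"
    using fsize_pos by force
  then show ?case by (metis finite.emptyI)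
next
  case (Suc n)
  let ?S = "{A. fsize A \<le> n \<and> fvars A \<subseteq> {..<K}}"
  have "{A. fsize A \<le> Suc n \<and> fvars A \<subseteq> {..<K}} \<subseteq>
    Var ` {..<K} \<union> {FBot, FTop} \<union> FNot ` ?S \<union> case_prod FAnd ` (?S \<times> ?S) \<union> case_prod FOr ` (?S \<times> ?S)
      \<union> case_prod FImp ` (?S \<times> ?S) \<union> case_prod FIff ` (?S \<times> ?S)"
    (is "_ \<subseteq> ?R")
  proof
    fix A assume "A \<in> {A. fsize A \<le> Suc n \<and> fvars A \<subseteq> {..<K}}"
    then show "A \<in> ?R"
      using fsize_pos by (cases A) (auto simp: image_iff Suc_le_eq)
  qed
  moreover have "finite ?R" using Suc by auto
  ultimately show ?case by (rule finite_subset)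
qed

lemma efrege_size_append [simp]: "efrege_size (xs @ ys) = efrege_size xs + efrege_size ys"
  by (simp add: efrege_size_def)

lemma efrege_size_simps [simp]:
  "efrege_size [] = 0" "efrege_size (A # xs) = fsize A + efrege_size xs"
  by (auto simp: efrege_size_def)

text \<open>Schematic variables beyond the end of the list become \<open>FTop\<close>, so that the auxiliary
  metavariables of a Frege derivation introduce neither variables nor large formulas.\<close>
definition list_subst :: "form list \<Rightarrow> var \<Rightarrow> form" where
  "list_subst As i = (if i < length As then As ! i else FTop)"

lemma list_subst_simps [simp]:
  "list_subst (A # As) 0 = A" "list_subst (A # As) (Suc i) = list_subst As i"
  "list_subst (A # As) (numeral n) = list_subst As (pred_numeral n)"
  "list_subst [] i = FTop"
  by (auto simp: list_subst_def numeral_eq_Suc)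

text \<open>A fixed Frege derivation is replayed under every substitution instance, composing
  substitutions at each rule. The number and the size of its lines depend only on the schema, so an
  instance is larger by at most the factor \<open>M\<close>, and \<open>k\<close> can be chosen
  before prefix, matrix and instance.\<close>

lemma frege_derives_simulated:
  assumes "frege_derives \<F> \<Gamma> A"
  shows "\<exists>k. \<forall>\<Pi> \<phi> \<Pi>' Ls As M. efrege_derivation \<F> \<Pi> \<phi> \<Pi>' Ls \<longrightarrow>
    (\<forall>B\<in>\<Gamma>. subst (list_subst As) B \<in> set Ls) \<longrightarrow>
    (\<forall>B\<in>set As. fvars B \<subseteq> prefix_vars \<Pi>' \<and> fsize B \<le> M) \<longrightarrow> 1 \<le> M \<longrightarrow>
    (\<exists>Ls'. efrege_derivation \<F> \<Pi> \<phi> \<Pi>' (Ls @ Ls') \<and>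
      subst (list_subst As) A \<in> set (Ls @ Ls') \<and> efrege_size Ls' \<le> k * M)"
    (is "\<exists>k. ?P k A")
  using assms
proof induction
  case (hyp A)
  show ?case
    by (rule exI[of _ 0]) (use hyp in \<open>auto intro!: exI[of _ "[]"]\<close>)
next
  case (rule ps c s)
  obtain kf where kf: "\<And>p. p \<in> set ps \<Longrightarrow> ?P (kf p) (subst s p)"
    using rule.IH by metis
  define k where "k = (\<Sum>p\<leftarrow>ps. kf p)"
  \<comment> \<open>\<open>frege_derives\<close> is a tree, whereas a proof here is a list: the
    subderivations are concatenated, each one continuing the lines of those before it.\<close>
  have all_premises: "\<exists>Ls'. efrege_derivation \<F> \<Pi> \<phi> \<Pi>' (Ls @ Ls') \<and>
      (\<forall>p\<in>set qs. subst (list_subst As) (subst s p) \<in> set (Ls @ Ls')) \<and>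
      efrege_size Ls' \<le> (\<Sum>p\<leftarrow>qs. kf p) * M"
    if "set qs \<subseteq> set ps" "efrege_derivation \<F> \<Pi> \<phi> \<Pi>' Ls"
      "\<forall>B\<in>\<Gamma>. subst (list_subst As) B \<in> set Ls"
      "\<forall>B\<in>set As. fvars B \<subseteq> prefix_vars \<Pi>' \<and> fsize B \<le> M" "1 \<le> M"
    for \<Pi> \<phi> \<Pi>' Ls As M qs
    using that(1)
  proof (induction qs)
    case Nil
    show ?case by (rule exI[of _ "[]"]) (use that in auto)
  next
    case (Cons q qs)
    then obtain L1 where L1: "efrege_derivation \<F> \<Pi> \<phi> \<Pi>' (Ls @ L1)"
      "\<forall>p\<in>set qs. subst (list_subst As) (subst s p) \<in> set (Ls @ L1)"
      "efrege_size L1 \<le> (\<Sum>p\<leftarrow>qs. kf p) * M" by auto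
    have "\<exists>L2. efrege_derivation \<F> \<Pi> \<phi> \<Pi>' ((Ls @ L1) @ L2) \<and>
      subst (list_subst As) (subst s q) \<in> set ((Ls @ L1) @ L2) \<and> efrege_size L2 \<le> kf q * M"
      by (rule kf[rule_format, OF _ L1(1)]) (use that Cons.prems in auto)
    then obtain L2 where L2: "efrege_derivation \<F> \<Pi> \<phi> \<Pi>' ((Ls @ L1) @ L2)"
      "subst (list_subst As) (subst s q) \<in> set ((Ls @ L1) @ L2)" "efrege_size L2 \<le> kf q * M"
      by blast
    show ?case
      by (rule exI[of _ "L1 @ L2"]) (use L1 L2 in \<open>auto simp: algebra_simps\<close>)
  qed
  show ?case
  proof (intro exI[of _ "k + fsize (subst s c)"] allI impI)
    fix \<Pi> \<phi> \<Pi>' Ls As M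
    assume a: "efrege_derivation \<F> \<Pi> \<phi> \<Pi>' Ls" "\<forall>B\<in>\<Gamma>. subst (list_subst As) B \<in> set Ls"
      "\<forall>B\<in>set As. fvars B \<subseteq> prefix_vars \<Pi>' \<and> fsize B \<le> M" "1 \<le> (M::nat)"
    obtain L where L: "efrege_derivation \<F> \<Pi> \<phi> \<Pi>' (Ls @ L)"
      "\<forall>p\<in>set ps. subst (list_subst As) (subst s p) \<in> set (Ls @ L)" "efrege_size L \<le> k * M"
      using all_premises[OF subset_refl a] unfolding k_def by blast
    let ?c = "subst (list_subst As) (subst s c)"
    have "fvars (list_subst As x) \<subseteq> prefix_vars \<Pi>'" for x
      using a(3) by (simp add: list_subst_def)
    then have "fvars ?c \<subseteq> prefix_vars \<Pi>'"
      by (auto simp: fvars_subst[of "list_subst As"])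
    then have "efrege_derivation \<F> \<Pi> \<phi> \<Pi>' ((Ls @ L) @ [?c])"
      using efrege_derivation.frege[OF L(1) rule.hyps(1), of "\<lambda>x. subst (list_subst As) (s x)"] L(2)
      by (simp add: subst_subst)
    moreover have "fsize ?c \<le> fsize (subst s c) * M"
      by (rule fsize_subst_le) (use a in \<open>auto simp: list_subst_def\<close>)
    ultimately show "\<exists>Ls'. efrege_derivation \<F> \<Pi> \<phi> \<Pi>' (Ls @ Ls') \<and> ?c \<in> set (Ls @ Ls') \<and>
        efrege_size Ls' \<le> (k + fsize (subst s c)) * M"
      by (intro exI[of _ "L @ [?c]"]) (use L in \<open>auto simp: algebra_simps\<close>)
  qed
qed

text \<open>The bounds are generous but fixed. The most demanding schemata are those for resolution,
  with four premises, metavariables 0 to 10 and case distinctions of size below 40.\<close>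

definition bounded_sound_rules :: "frege_rule set" where
  "bounded_sound_rules = {(ps, c). length ps \<le> 8 \<and> entails (set ps) c \<and>
     (\<forall>A\<in>insert c (set ps). fsize A \<le> 100 \<and> fvars A \<subseteq> {..<20})}"

lemma finite_bounded_sound_rules: "finite bounded_sound_rules"
proof -
  let ?S = "{A. fsize A \<le> 100 \<and> fvars A \<subseteq> {..<20}}"
  have "bounded_sound_rules \<subseteq> {ps. set ps \<subseteq> ?S \<and> length ps \<le> 8} \<times> ?S"
    by (auto simp: bounded_sound_rules_def)
  then show ?thesis
    by (rule finite_subset) (intro finite_cartesian_product finite_lists_length_le finite_bounded_forms)
qed

definition simulation_bound :: "frege_rule set \<Rightarrow> nat \<Rightarrow> bool" where
  "simulation_bound \<F> k \<longleftrightarrow> (\<forall>(ps, c)\<in>bounded_sound_rules.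
    \<forall>\<Pi> \<phi> \<Pi>' Ls As M. efrege_derivation \<F> \<Pi> \<phi> \<Pi>' Ls \<longrightarrow>
    (\<forall>B\<in>set ps. subst (list_subst As) B \<in> set Ls) \<longrightarrow>
    (\<forall>B\<in>set As. fvars B \<subseteq> prefix_vars \<Pi>' \<and> fsize B \<le> M) \<longrightarrow> 1 \<le> M \<longrightarrow>
    (\<exists>Ls'. efrege_derivation \<F> \<Pi> \<phi> \<Pi>' (Ls @ Ls') \<and>
      subst (list_subst As) c \<in> set (Ls @ Ls') \<and> efrege_size Ls' \<le> k * M))"

text \<open>Completeness promises a derivation for each schema, but no bound uniform in the schema.
  Since the set of schemata is finite, a maximum supplies one.\<close>

lemma simulation_bound_exists:
  assumes "frege_system \<F>"
  shows "\<exists>k. simulation_bound \<F> k"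
proof -
  let ?P = "\<lambda>ps c k. \<forall>\<Pi> \<phi> \<Pi>' Ls As M. efrege_derivation \<F> \<Pi> \<phi> \<Pi>' Ls \<longrightarrow>
    (\<forall>B\<in>set ps. subst (list_subst As) B \<in> set Ls) \<longrightarrow>
    (\<forall>B\<in>set As. fvars B \<subseteq> prefix_vars \<Pi>' \<and> fsize B \<le> M) \<longrightarrow> 1 \<le> M \<longrightarrow>
    (\<exists>Ls'. efrege_derivation \<F> \<Pi> \<phi> \<Pi>' (Ls @ Ls') \<and>
      subst (list_subst As) c \<in> set (Ls @ Ls') \<and> efrege_size Ls' \<le> k * M)"
  have "\<exists>k. ?P (fst r) (snd r) k" if "r \<in> bounded_sound_rules" for r
    by (rule frege_derives_simulated)
      (use that assms in \<open>auto simp: bounded_sound_rules_def frege_system_def\<close>)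
  then have "\<exists>f. \<forall>r\<in>bounded_sound_rules. ?P (fst r) (snd r) (f r)"
    by (intro bchoice ballI)
  then obtain f where "\<forall>r\<in>bounded_sound_rules. ?P (fst r) (snd r) (f r)" ..
  then have f: "?P ps c (f (ps, c))" if "(ps, c) \<in> bounded_sound_rules" for ps c
    using that by (metis (no_types) fst_conv snd_conv)
  define k where "k = Max (f ` bounded_sound_rules)"
  have "f r \<le> k" if "r \<in> bounded_sound_rules" for r
    unfolding k_def using that finite_bounded_sound_rules by simp
  then have k: "f r * M \<le> k * M" if "r \<in> bounded_sound_rules" for r M
    using that by simp
  show ?thesis
    unfolding simulation_bound_def
  proof (intro exI[of _ k] ballI, clarify, goal_cases)
    case (1 ps c \<Pi> \<phi> \<Pi>' Ls As M)
    then show ?case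
      using f[OF 1(1), rule_format, OF 1(2), of As M] k[OF 1(1), of M] by (meson le_trans)
  qed
qed

section \<open>Inserting extension variables into the prefix\<close>

definition left_of :: "prefix \<Rightarrow> var \<Rightarrow> var set" where
  "left_of \<Pi> u = {w \<in> prefix_vars \<Pi>. lev \<Pi> w < lev \<Pi> u}"

text \<open>Inserting a variable shifts the levels to its right, so levels themselves are not
  preserved. Their order is, and \<open>left_of\<close> depends on nothing else.\<close>

definition prefix_ext :: "prefix \<Rightarrow> prefix \<Rightarrow> bool" where
  "prefix_ext \<Pi> \<Pi>' \<longleftrightarrow> prefix_vars \<Pi> \<subseteq> prefix_vars \<Pi>' \<and> universals \<Pi>' = universals \<Pi> \<and>
     (\<forall>a\<in>prefix_vars \<Pi>. \<forall>b\<in>prefix_vars \<Pi>. lev \<Pi>' a < lev \<Pi>' b \<longleftrightarrow> lev \<Pi> a < lev \<Pi> b)"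

lemma prefix_ext_refl [simp]: "prefix_ext \<Pi> \<Pi>"
  by (simp add: prefix_ext_def)

lemma prefix_ext_trans: "prefix_ext \<Pi> \<Pi>' \<Longrightarrow> prefix_ext \<Pi>' \<Pi>'' \<Longrightarrow> prefix_ext \<Pi> \<Pi>''"
  unfolding prefix_ext_def by blast

lemma prefix_ext_vars: "prefix_ext \<Pi> \<Pi>' \<Longrightarrow> prefix_vars \<Pi> \<subseteq> prefix_vars \<Pi>'"
  by (simp add: prefix_ext_def)

lemma prefix_ext_left_of:
  "prefix_ext \<Pi> \<Pi>' \<Longrightarrow> u \<in> prefix_vars \<Pi> \<Longrightarrow> left_of \<Pi> u \<subseteq> left_of \<Pi>' u"
  unfolding prefix_ext_def left_of_def by blast

lemma left_of_subset: "left_of \<Pi> u \<subseteq> prefix_vars \<Pi>"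
  by (auto simp: left_of_def)

lemma prefix_vars_simps [simp]:
  "prefix_vars [] = {}" "prefix_vars (p # A) = insert (snd p) (prefix_vars A)"
  "prefix_vars (A @ B) = prefix_vars A \<union> prefix_vars B"
  by (auto simp: prefix_vars_def)

lemma lev_Cons [simp]: "lev (p # A) w = (if snd p = w then 0 else Suc (lev A w))"
  by (auto simp: lev_def)

lemma lev_less_length_iff: "lev A w < length A \<longleftrightarrow> w \<in> prefix_vars A"
  by (induction A) auto

lemma lev_append: "lev (A @ B) w = (if w \<in> prefix_vars A then lev A w else length A + lev B w)"
  by (induction A) auto

lemma lev_inj: "a \<in> prefix_vars A \<Longrightarrow> lev A a = lev A b \<Longrightarrow> a = b"
  by (induction A) (auto split: if_splits)

text \<open>The new variable goes immediately left of \<open>u\<close>. There it may be defined from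
  everything left of \<open>u\<close>, and being left of \<open>u\<close> itself, it does not block
  the reduction of \<open>u\<close>.\<close>

lemma extension_left_of:
  assumes "efrege_derivation \<F> \<Pi> \<phi> \<Pi>' Ls" "u \<in> prefix_vars \<Pi>'" "fvars f \<subseteq> left_of \<Pi>' u"
  obtains \<Pi>'' v where "efrege_derivation \<F> \<Pi> \<phi> \<Pi>'' (Ls @ [FIff (Var v) f])"
    "prefix_ext \<Pi>' \<Pi>''" "v \<in> left_of \<Pi>'' u"
proof -
  define A where "A = takeWhile (\<lambda>p. snd p \<noteq> u) \<Pi>'"
  define B where "B = dropWhile (\<lambda>p. snd p \<noteq> u) \<Pi>'"
  have \<Pi>': "\<Pi>' = A @ B" by (simp add: A_def B_def)
  have u: "u \<notin> prefix_vars A"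
    unfolding A_def prefix_vars_def using set_takeWhileD by fastforce
  have "finite (prefix_vars \<Pi>')" by (simp add: prefix_vars_def)
  then obtain v where v: "v \<notin> prefix_vars \<Pi>'"
    using ex_new_if_finite infinite_UNIV_nat by blast
  have lev_u: "lev \<Pi>' u = length A" by (simp add: A_def lev_def)
  have "fvars f \<subseteq> prefix_vars A"
    using assms(3) lev_u unfolding left_of_def \<Pi>' by (auto simp: lev_append split: if_splits)
  then have "efrege_derivation \<F> \<Pi> \<phi> (A @ (Exists, v) # B) (Ls @ [FIff (Var v) f])"
    using assms(1) v unfolding \<Pi>' by (intro efrege_derivation.extension) auto
  moreover have "prefix_ext \<Pi>' (A @ (Exists, v) # B)"
  proof -
    have lev_A: "lev A a < length A" if "a \<in> prefix_vars A" for a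
      using that by (simp add: lev_less_length_iff)
    have new: "lev (A @ (Exists, v) # B) a = (if a \<in> prefix_vars A then lev A a else Suc (length A + lev B a))"
      if "a \<in> prefix_vars \<Pi>'" for a
      using that v by (auto simp: lev_append)
    have "lev (A @ (Exists, v) # B) a < lev (A @ (Exists, v) # B) b \<longleftrightarrow> lev \<Pi>' a < lev \<Pi>' b"
      if "a \<in> prefix_vars \<Pi>'" "b \<in> prefix_vars \<Pi>'" for a b
      unfolding new[OF that(1)] new[OF that(2)] using lev_A[of a] lev_A[of b]
      by (auto simp: \<Pi>' lev_append)
    moreover have "universals (A @ (Exists, v) # B) = universals \<Pi>'"
      by (auto simp: universals_def \<Pi>')
    ultimately show ?thesis
      unfolding prefix_ext_def by (auto simp: \<Pi>')
  qed
  moreover have "v \<in> left_of (A @ (Exists, v) # B) u"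
    using v u assms(2) unfolding left_of_def \<Pi>' by (auto simp: lev_append)
  ultimately show thesis using that by blast
qed

section \<open>Bounded derivability\<close>

fun conjs :: "form list \<Rightarrow> form" where
  "conjs [] = FTop"
| "conjs (A # As) = FAnd A (conjs As)"

fun disjs :: "form list \<Rightarrow> form" where
  "disjs [] = FBot"
| "disjs (A # As) = FOr A (disjs As)"

lemma fvars_conjs: "fvars (conjs As) = (\<Union>A\<in>set As. fvars A)"
  by (induction As) auto

lemma fvars_disjs: "fvars (disjs As) = (\<Union>A\<in>set As. fvars A)"
  by (induction As) auto

lemma fsize_conjs_le: "(\<And>A. A \<in> set As \<Longrightarrow> fsize A \<le> m) \<Longrightarrow> fsize (conjs As) \<le> (m + 1) * length As + 1"
proof (induction As)
  case (Cons A As)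
  then have "fsize A \<le> m" "fsize (conjs As) \<le> (m + 1) * length As + 1" by auto
  then show ?case by (simp add: algebra_simps)
qed simp

lemma fsize_disjs_le: "(\<And>A. A \<in> set As \<Longrightarrow> fsize A \<le> m) \<Longrightarrow> fsize (disjs As) \<le> (m + 1) * length As + 1"
proof (induction As)
  case (Cons A As)
  then have "fsize A \<le> m" "fsize (disjs As) \<le> (m + 1) * length As + 1" by auto
  then show ?case by (simp add: algebra_simps)
qed simp

locale frege_simulation =
  fixes \<F> :: "frege_rule set" and k :: nat and \<Pi> :: prefix and \<phi> :: cnf and M :: nat
  assumes simulation_bound: "simulation_bound \<F> k" and M_pos: "1 \<le> M"
begin

text \<open>The condition on a formula to be substituted for a metavariable. Derived lines may
  exceed \<open>M\<close>: the schema around the substituted formulas contributes a constant factor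
  that is accounted for in \<open>k\<close>.\<close>

definition good :: "prefix \<Rightarrow> form \<Rightarrow> bool" where
  "good \<Pi>' A \<longleftrightarrow> fvars A \<subseteq> prefix_vars \<Pi>' \<and> fsize A \<le> M"

text \<open>\<open>n\<close> counts inferences by sound rules of bounded size, each of which costs \<open>k * M\<close>.\<close>
definition der :: "prefix \<Rightarrow> form set \<Rightarrow> nat \<Rightarrow> form set \<Rightarrow> bool" where
  "der \<Pi>' \<Gamma> n \<Delta> \<longleftrightarrow> (\<forall>Ls. efrege_derivation \<F> \<Pi> \<phi> \<Pi>' Ls \<longrightarrow> \<Gamma> \<subseteq> set Ls \<longrightarrow>
     (\<exists>Ls'. efrege_derivation \<F> \<Pi> \<phi> \<Pi>' (Ls @ Ls') \<and> \<Delta> \<subseteq> set (Ls @ Ls') \<and>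
        efrege_size Ls' \<le> n * (k * M)))"

lemma der_refl: "\<Delta> \<subseteq> \<Gamma> \<Longrightarrow> der \<Pi>' \<Gamma> n \<Delta>"
  unfolding der_def by (auto intro!: exI[of _ "[]"])

lemma der_mono:
  assumes "der \<Pi>' \<Gamma> n \<Delta>" "\<Gamma> \<subseteq> \<Gamma>'" "n \<le> n'" "\<Delta>' \<subseteq> \<Delta>"
  shows "der \<Pi>' \<Gamma>' n' \<Delta>'"
proof -
  have "n * (k * M) \<le> n' * (k * M)" using assms(3) by simp
  then show ?thesis
    using assms(1,2,4) unfolding der_def by (meson order_trans)
qed

lemma der_cut:
  assumes "der \<Pi>' \<Gamma> n \<Delta>" "der \<Pi>' (\<Gamma> \<union> \<Delta>) m \<Theta>"
  shows "der \<Pi>' \<Gamma> (n + m) (\<Delta> \<union> \<Theta>)"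
  unfolding der_def
proof (intro allI impI)
  fix Ls assume Ls: "efrege_derivation \<F> \<Pi> \<phi> \<Pi>' Ls" "\<Gamma> \<subseteq> set Ls"
  then obtain L1 where L1: "efrege_derivation \<F> \<Pi> \<phi> \<Pi>' (Ls @ L1)" "\<Delta> \<subseteq> set (Ls @ L1)"
    "efrege_size L1 \<le> n * (k * M)"
    using assms(1) unfolding der_def by blast
  moreover have "\<Gamma> \<union> \<Delta> \<subseteq> set (Ls @ L1)" using Ls L1 by auto
  ultimately obtain L2 where L2: "efrege_derivation \<F> \<Pi> \<phi> \<Pi>' ((Ls @ L1) @ L2)"
    "\<Theta> \<subseteq> set ((Ls @ L1) @ L2)" "efrege_size L2 \<le> m * (k * M)"
    using assms(2) unfolding der_def by blast
  show "\<exists>Ls'. efrege_derivation \<F> \<Pi> \<phi> \<Pi>' (Ls @ Ls') \<and> \<Delta> \<union> \<Theta> \<subseteq> set (Ls @ Ls') \<and>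
      efrege_size Ls' \<le> (n + m) * (k * M)"
    by (rule exI[of _ "L1 @ L2"]) (use L1 L2 in \<open>auto simp: algebra_simps\<close>)
qed

lemma der_UN:
  assumes "finite I" "\<And>i. i \<in> I \<Longrightarrow> der \<Pi>' \<Gamma> n (\<Delta> i)"
  shows "der \<Pi>' \<Gamma> (card I * n) (\<Union>i\<in>I. \<Delta> i)"
  using assms
proof (induction I rule: finite_induct)
  case empty
  then show ?case by (simp add: der_refl)
next
  case (insert i I)
  have "der \<Pi>' \<Gamma> (n + card I * n) (\<Delta> i \<union> (\<Union>i\<in>I. \<Delta> i))"
    by (rule der_cut) (use insert in \<open>auto intro: der_mono\<close>)
  then show ?case using insert by simp
qed

lemma der_image:
  assumes "finite I" "card I * n \<le> m" "\<And>i. i \<in> I \<Longrightarrow> der \<Pi>' \<Gamma> n {A i}"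
  shows "der \<Pi>' \<Gamma> m (A ` I)"
  using der_mono[OF der_UN[OF assms(1), of \<Pi>' \<Gamma> n "\<lambda>i. {A i}"] subset_refl assms(2) order_refl] assms(3)
  by (simp add: UNION_singleton_eq_range)

lemma der_Un: "der \<Pi>' \<Gamma> n \<Delta> \<Longrightarrow> der \<Pi>' \<Gamma> m \<Theta> \<Longrightarrow> der \<Pi>' \<Gamma> (n + m) (\<Delta> \<union> \<Theta>)"
  by (rule der_cut) (auto intro: der_mono)

lemma der_rule:
  assumes "(ps, c) \<in> bounded_sound_rules" "subst (list_subst As) ` set ps \<subseteq> \<Gamma>"
    "\<And>A. A \<in> set As \<Longrightarrow> good \<Pi>' A" "subst (list_subst As) c = B"
  shows "der \<Pi>' \<Gamma> 1 {B}"
  unfolding der_def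
proof (intro allI impI)
  fix Ls assume "efrege_derivation \<F> \<Pi> \<phi> \<Pi>' Ls" "\<Gamma> \<subseteq> set Ls"
  then show "\<exists>Ls'. efrege_derivation \<F> \<Pi> \<phi> \<Pi>' (Ls @ Ls') \<and> {B} \<subseteq> set (Ls @ Ls') \<and>
      efrege_size Ls' \<le> 1 * (k * M)"
    using simulation_bound[unfolded simulation_bound_def, THEN bspec, OF assms(1), unfolded prod.case, rule_format,
        of \<Pi> \<phi> \<Pi>' Ls As M] assms(2-4) M_pos
    unfolding good_def by auto
qed

lemma good_binary [dest]:
  "good \<Pi>' (FAnd A B) \<Longrightarrow> good \<Pi>' A \<and> good \<Pi>' B"
  "good \<Pi>' (FOr A B) \<Longrightarrow> good \<Pi>' A \<and> good \<Pi>' B"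
  by (auto simp: good_def)

lemma good_Top [simp]: "good \<Pi>' FTop" and good_Bot [simp]: "good \<Pi>' FBot"
  using M_pos by (auto simp: good_def)

lemma der_step:
  assumes "der \<Pi>' \<Gamma> n \<Delta>" "der \<Pi>' (\<Gamma> \<union> \<Delta>) m \<Theta>" "n + m \<le> p"
  shows "der \<Pi>' \<Gamma> p \<Theta>"
  using der_mono[OF der_cut[OF assms(1,2)] subset_refl assms(3)] by blast

section \<open>Long conjunctions and disjunctions\<close>

text \<open>Schemata have bounded size, so a long conjunction is treated one conjunct at a time, at
  one inference each. The side condition \<open>B\<close> will be the case distinction of a
  resolution step, and \<open>FTop\<close> for instantiation and merging.\<close>

lemma der_conjs_mono:
  assumes "good \<Pi>' B" "good \<Pi>' (conjs (map f xs))" "good \<Pi>' (conjs (map g xs))"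
    "\<And>x. x \<in> set xs \<Longrightarrow> FImp (FAnd B (f x)) (g x) \<in> \<Gamma>"
  shows "der \<Pi>' \<Gamma> (length xs + 1) {FImp (FAnd B (conjs (map f xs))) (conjs (map g xs))}"
  using assms
proof (induction xs)
  case Nil
  show ?case
    by (rule der_mono[OF der_rule[where ps = "[]" and c = "FImp (FAnd (Var 0) FTop) FTop" and As = "[B]"]])
      (use Nil in \<open>auto simp: bounded_sound_rules_def entails_def\<close>)
next
  case (Cons x xs)
  show ?case
  proof (rule der_step[where m = 1])
    show "der \<Pi>' \<Gamma> (length xs + 1) {FImp (FAnd B (conjs (map f xs))) (conjs (map g xs))}"
      using Cons by (intro Cons.IH) auto
    show "der \<Pi>' (\<Gamma> \<union> {FImp (FAnd B (conjs (map f xs))) (conjs (map g xs))}) 1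
       {FImp (FAnd B (conjs (map f (x # xs)))) (conjs (map g (x # xs)))}"
      by (rule der_rule[where ps = "[FImp (FAnd (Var 0) (Var 1)) (Var 2), FImp (FAnd (Var 0) (Var 3)) (Var 4)]"
            and c = "FImp (FAnd (Var 0) (FAnd (Var 1) (Var 3))) (FAnd (Var 2) (Var 4))"
            and As = "[B, f x, g x, conjs (map f xs), conjs (map g xs)]"])
        (use Cons.prems in \<open>auto simp: bounded_sound_rules_def entails_def\<close>)
  qed auto
qed

lemma der_conjs_intro:
  assumes "good \<Pi>' (conjs xs)" "set xs \<subseteq> \<Gamma>"
  shows "der \<Pi>' \<Gamma> (length xs + 1) {conjs xs}"
  using assms
proof (induction xs)
  case Nil
  show ?case
    by (rule der_mono[OF der_rule[where ps = "[]" and c = "FTop" and As = "[]"]])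
      (auto simp: bounded_sound_rules_def entails_def)
next
  case (Cons x xs)
  show ?case
  proof (rule der_step[where m = 1])
    show "der \<Pi>' \<Gamma> (length xs + 1) {conjs xs}"
      using Cons by auto
    show "der \<Pi>' (\<Gamma> \<union> {conjs xs}) 1 {conjs (x # xs)}"
      by (rule der_rule[where ps = "[Var 0, Var 1]" and c = "FAnd (Var 0) (Var 1)"
            and As = "[x, conjs xs]"])
        (use Cons.prems in \<open>auto simp: bounded_sound_rules_def entails_def\<close>)
  qed auto
qed

lemma der_conjs_elim:
  assumes "good \<Pi>' (conjs xs)" "x \<in> set xs"
  shows "der \<Pi>' \<Gamma> (length xs) {FImp (conjs xs) x}"
  using assms
proof (induction xs)
  case Nil
  then show ?case by simp
next
  case (Cons y xs)
  show ?case
  proof (cases "x = y")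
    case True
    show ?thesis
      by (rule der_mono[OF der_rule[where ps = "[]" and c = "FImp (FAnd (Var 0) (Var 1)) (Var 0)"
            and As = "[y, conjs xs]" and \<Gamma> = \<Gamma>]])
        (use Cons.prems True in \<open>auto simp: bounded_sound_rules_def entails_def\<close>)
  next
    case False
    then have x: "x \<in> set xs" using Cons by simp
    have "good \<Pi>' (conjs xs)" using Cons.prems(1) by auto
    then have "good \<Pi>' x" using x
      by (induction xs) auto
    show ?thesis
    proof (rule der_step[where m = 1])
      show "der \<Pi>' \<Gamma> (length xs) {FImp (conjs xs) x}"
        using Cons x by auto
      show "der \<Pi>' (\<Gamma> \<union> {FImp (conjs xs) x}) 1 {FImp (conjs (y # xs)) x}"
        by (rule der_rule[where ps = "[FImp (Var 0) (Var 1)]" and c = "FImp (FAnd (Var 2) (Var 0)) (Var 1)"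
              and As = "[conjs xs, x, y]"])
          (use Cons.prems \<open>good \<Pi>' x\<close> in \<open>auto simp: bounded_sound_rules_def entails_def\<close>)
    qed auto
  qed
qed

lemma der_disjs_elim:
  assumes "good \<Pi>' B" "good \<Pi>' (disjs xs)" "good \<Pi>' A" "\<And>x. x \<in> set xs \<Longrightarrow> FImp (FAnd B x) A \<in> \<Gamma>"
  shows "der \<Pi>' \<Gamma> (length xs + 1) {FImp (FAnd B (disjs xs)) A}"
  using assms
proof (induction xs)
  case Nil
  show ?case
    by (rule der_mono[OF der_rule[where ps = "[]" and c = "FImp (FAnd (Var 0) FBot) (Var 1)" and As = "[B, A]"]])
      (use Nil in \<open>auto simp: bounded_sound_rules_def entails_def\<close>)
next
  case (Cons x xs)
  show ?case
  proof (rule der_step[where m = 1])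
    show "der \<Pi>' \<Gamma> (length xs + 1) {FImp (FAnd B (disjs xs)) A}"
      using Cons by (intro Cons.IH) auto
    show "der \<Pi>' (\<Gamma> \<union> {FImp (FAnd B (disjs xs)) A}) 1 {FImp (FAnd B (disjs (x # xs))) A}"
      by (rule der_rule[where ps = "[FImp (FAnd (Var 0) (Var 1)) (Var 3), FImp (FAnd (Var 0) (Var 2)) (Var 3)]"
            and c = "FImp (FAnd (Var 0) (FOr (Var 1) (Var 2))) (Var 3)"
            and As = "[B, x, disjs xs, A]"])
        (use Cons.prems in \<open>auto simp: bounded_sound_rules_def entails_def\<close>)
  qed auto
qed

lemma der_disjs_intro:
  assumes "good \<Pi>' (disjs xs)" "good \<Pi>' A" "x \<in> set xs" "FImp A x \<in> \<Gamma>"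
  shows "der \<Pi>' \<Gamma> (length xs) {FImp A (disjs xs)}"
  using assms
proof (induction xs)
  case Nil
  then show ?case by simp
next
  case (Cons y xs)
  show ?case
  proof (cases "x = y")
    case True
    show ?thesis
      by (rule der_mono[OF der_rule[where ps = "[FImp (Var 0) (Var 1)]" and c = "FImp (Var 0) (FOr (Var 1) (Var 2))"
            and As = "[A, y, disjs xs]" and \<Gamma> = \<Gamma>]])
        (use Cons.prems True in \<open>auto simp: bounded_sound_rules_def entails_def\<close>)
  next
    case False
    show ?thesis
    proof (rule der_step[where m = 1])
      show "der \<Pi>' \<Gamma> (length xs) {FImp A (disjs xs)}"
        using Cons False by auto
      show "der \<Pi>' (\<Gamma> \<union> {FImp A (disjs xs)}) 1 {FImp A (disjs (y # xs))}"
        by (rule der_rule[where ps = "[FImp (Var 0) (Var 1)]" and c = "FImp (Var 0) (FOr (Var 2) (Var 1))"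
              and As = "[A, disjs xs, y]"])
          (use Cons.prems in \<open>auto simp: bounded_sound_rules_def entails_def\<close>)
    qed auto
  qed
qed

end

section \<open>Encoding annotated clauses by local strategies\<close>

text \<open>\<open>None\<close> claims that the universal is unset, rather than claiming nothing:
  instantiation and resolution fill in values exactly where an annotation is undefined, so its
  domain has to be known. A star claims that some value has been set.\<close>

fun ann_form :: "form \<Rightarrow> form \<Rightarrow> aval option \<Rightarrow> form" where
  "ann_form S V None = FNot S"
| "ann_form S V (Some Star) = S"
| "ann_form S V (Some (Const True)) = FAnd S V"
| "ann_form S V (Some (Const False)) = FAnd S (FNot V)"

definition annots :: "aval option set" where
  "annots = {None, Some Star, Some (Const True), Some (Const False)}"

lemma in_annots [simp]: "a \<in> annots"
proof (cases a)
  case (Some x)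
  then show ?thesis by (cases x) (auto simp: annots_def)
qed (simp add: annots_def)

lemma card_annots [simp]: "finite annots" "card annots = 4"
  by (auto simp: annots_def)

lemma annot_cases:
  obtains "a = None" | "a = Some Star" | "a = Some (Const True)" | "a = Some (Const False)"
  using in_annots[of a] unfolding annots_def by blast

lemma subst_ann_form [simp]: "subst t (ann_form S V a) = ann_form (subst t S) (subst t V) a"
  by (cases a rule: annot_cases) auto

lemma fvars_ann_form_subset: "fvars (ann_form S V a) \<subseteq> fvars S \<union> fvars V"
  by (cases a rule: annot_cases) auto

lemma fsize_ann_form_le: "fsize (ann_form S V a) \<le> fsize S + fsize V + 2"
  by (cases a rule: annot_cases) auto

lemma eval_ann_form [simp]:
  "eval e (ann_form S V a) \<longleftrightarrow> (case a of None \<Rightarrow> \<not> eval e S | Some Star \<Rightarrow> eval e S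
     | Some (Const b) \<Rightarrow> eval e S \<and> eval e V = b)"
  by (cases a rule: annot_cases) auto

abbreviation fite :: "form \<Rightarrow> form \<Rightarrow> form \<Rightarrow> form" where
  "fite C A B \<equiv> FOr (FAnd C A) (FAnd (FNot C) B)"

abbreviation or_else :: "aval option \<Rightarrow> aval option \<Rightarrow> aval option" where
  "or_else a b \<equiv> (case a of None \<Rightarrow> b | Some _ \<Rightarrow> a)"

lemma completion_or_else: "completion \<tau> \<alpha> u = or_else (\<tau> u) (\<alpha> u)"
  by (simp add: completion_def map_add_def split: option.splits)

lemma const_form_simps [simp]: "fvars (const_form b) = {}" "fsize (const_form b) = 1"
  "subst t (const_form b) = const_form b" "eval e (const_form b) = b"
  by (auto simp: const_form_def)

definition enum :: "'a set \<Rightarrow> 'a list" where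
  "enum D = (SOME xs. set xs = D \<and> distinct xs)"

lemma enum:
  assumes "finite D"
  shows set_enum: "set (enum D) = D" and length_enum: "length (enum D) = card D"
proof -
  have "set (enum D) = D \<and> distinct (enum D)"
    unfolding enum_def by (rule someI_ex) (rule finite_distinct_list[OF assms])
  then show "set (enum D) = D" "length (enum D) = card D"
    using distinct_card by metis+
qed

definition cons_form :: "(var \<Rightarrow> var) \<Rightarrow> (var \<Rightarrow> var) \<Rightarrow> var \<Rightarrow> form" where
  "cons_form s v u = FImp (Var (s u)) (FIff (Var u) (Var (v u)))"

text \<open>A local strategy consists of, for each universal \<open>u\<close>, a variable \<open>s u\<close> telling whether \<open>u\<close> is set
  and a variable \<open>v u\<close> for its value. An annotated clause is represented by the implication from
  \<open>cons\<close> (the universal assignment follows the strategy) to \<open>clause_disj\<close> (a literal holds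
  whose annotation is the one chosen by the strategy).\<close>
locale irm_simulation = frege_simulation +
  fixes us :: "var list" and N :: nat
  assumes closed: "closed_pcnf \<Pi> \<phi>"
    and us_universal: "set us \<subseteq> universals \<Pi>"
    and us_sorted: "sorted_wrt (\<lambda>a b. lev \<Pi> b < lev \<Pi> a) us"
    and length_us: "length us \<le> N"
    and M_def: "M = 20 * (N + 1) ^ 2"
begin

definition cons :: "(var \<Rightarrow> var) \<Rightarrow> (var \<Rightarrow> var) \<Rightarrow> form" where
  "cons s v = conjs (map (cons_form s v) us)"

text \<open>Right of its literal an annotation is undefined for a syntactic reason, not because the
  strategy leaves those universals unset. The filter removes them, as \<open>ann_form\<close> would
  read them as a claim.\<close>

definition ann :: "(var \<Rightarrow> var) \<Rightarrow> (var \<Rightarrow> var) \<Rightarrow> literal \<Rightarrow> xassign \<Rightarrow> form" where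
  "ann s v l \<tau> = conjs (map (\<lambda>u. ann_form (Var (s u)) (Var (v u)) (\<tau> u))
     (filter (\<lambda>u. lev \<Pi> u < lev \<Pi> (lvar l)) us))"

definition alit_form :: "(var \<Rightarrow> var) \<Rightarrow> (var \<Rightarrow> var) \<Rightarrow> alit \<Rightarrow> form" where
  "alit_form s v d = FAnd (lit_form (fst d)) (ann s v (fst d) (snd d))"

definition clause_disj :: "(var \<Rightarrow> var) \<Rightarrow> (var \<Rightarrow> var) \<Rightarrow> aclause \<Rightarrow> form" where
  "clause_disj s v D = disjs (map (alit_form s v) (enum D))"

definition strategy :: "prefix \<Rightarrow> (var \<Rightarrow> var) \<Rightarrow> (var \<Rightarrow> var) \<Rightarrow> bool" where
  "strategy \<Pi>' s v \<longleftrightarrow> prefix_ext \<Pi> \<Pi>' \<and> (\<forall>u\<in>set us. s u \<in> left_of \<Pi>' u \<and> v u \<in> left_of \<Pi>' u)"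

definition wf_aclause :: "aclause \<Rightarrow> bool" where
  "wf_aclause D \<longleftrightarrow> finite D \<and> card D \<le> N \<and>
     (\<forall>(l, \<tau>)\<in>D. lvar l \<in> existentials \<Pi> \<and> dom \<tau> \<subseteq> set us \<inter> {u. lev \<Pi> u < lev \<Pi> (lvar l)})"

text \<open>The strategy is quantified existentially since every line of the refutation has its
  own.\<close>

definition represents :: "prefix \<Rightarrow> form set \<Rightarrow> aclause \<Rightarrow> bool" where
  "represents \<Pi>' \<Gamma> D \<longleftrightarrow> (\<exists>s v. strategy \<Pi>' s v \<and> FImp (cons s v) (clause_disj s v D) \<in> \<Gamma>)"

lemma universals_subset: "universals \<Pi> \<subseteq> prefix_vars \<Pi>" "existentials \<Pi> \<subseteq> prefix_vars \<Pi>"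
  by (force simp: universals_def existentials_def prefix_vars_def)+

lemma universal_not_existential: "u \<in> universals \<Pi> \<Longrightarrow> u \<notin> existentials \<Pi>"
  using closed unfolding closed_pcnf_def universals_def existentials_def
  by (force simp: distinct_map inj_on_def)

lemma strategy_ext: "strategy \<Pi>' s v \<Longrightarrow> prefix_ext \<Pi>' \<Pi>'' \<Longrightarrow> strategy \<Pi>'' s v"
  unfolding strategy_def
  using prefix_ext_left_of prefix_ext_trans prefix_ext_vars us_universal universals_subset
  by (meson subsetD)

section \<open>Sizes of the encoding\<close>

text \<open>The linear bound serves the formulas for one strategy or one literal, the quadratic one
  the disjunction of up to \<open>N\<close> literals of size at most
  \<open>5 * N + 4\<close>.\<close>

lemma N_le_M: "20 * N + 20 \<le> M" "5 * N * N + 10 * N + 20 \<le> M"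
  unfolding M_def by (auto simp: power2_eq_square algebra_simps)

lemma strategy_vars:
  assumes "strategy \<Pi>' s v" "u \<in> set us"
  shows "s u \<in> prefix_vars \<Pi>'" "v u \<in> prefix_vars \<Pi>'" "u \<in> prefix_vars \<Pi>'"
  using assms left_of_subset prefix_ext_vars us_universal universals_subset
  unfolding strategy_def by blast+

lemma good_Var: "x \<in> prefix_vars \<Pi>' \<Longrightarrow> good \<Pi>' (Var x)"
  using M_pos by (simp add: good_def)

lemmas good_strategy = strategy_vars[THEN good_Var]

lemma good_cons:
  assumes "strategy \<Pi>' s v"
  shows "good \<Pi>' (cons s v)"
  unfolding good_def
proof
  show "fvars (cons s v) \<subseteq> prefix_vars \<Pi>'"
    unfolding cons_def fvars_conjs using strategy_vars[OF assms] by (auto simp: cons_form_def)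
  have "fsize (cons s v) \<le> (5 + 1) * length us + 1"
    unfolding cons_def by (rule order_trans[OF fsize_conjs_le[where m = 5]]) (auto simp: cons_form_def)
  then show "fsize (cons s v) \<le> M" using length_us N_le_M(1) by simp
qed

lemma length_filter_us: "length (filter p us) \<le> N"
  using length_us length_filter_le order_trans by blast

lemma fsize_ann_le: "fsize (ann s v l \<tau>) \<le> 5 * N + 1"
proof -
  let ?xs = "filter (\<lambda>u. lev \<Pi> u < lev \<Pi> (lvar l)) us"
  have "fsize (ann s v l \<tau>) \<le> (4 + 1) * length ?xs + 1"
    unfolding ann_def
    by (rule order_trans[OF fsize_conjs_le[where m = 4]])
      (auto intro: order_trans[OF fsize_ann_form_le])
  also have "\<dots> \<le> 5 * N + 1" by (simp add: length_filter_us)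
  finally show ?thesis .
qed

lemma fvars_ann:
  assumes "strategy \<Pi>' s v"
  shows "fvars (ann s v l \<tau>) \<subseteq> prefix_vars \<Pi>'"
  unfolding ann_def fvars_conjs
  using strategy_vars[OF assms] fvars_ann_form_subset by fastforce

lemma good_ann:
  assumes "strategy \<Pi>' s v"
  shows "good \<Pi>' (ann s v l \<tau>)"
  using fvars_ann[OF assms] fsize_ann_le[of s v l \<tau>] N_le_M(1) unfolding good_def by simp

lemma fvars_lit_form [simp]: "fvars (lit_form l) = {lvar l}"
  by (cases l) auto

lemma fsize_lit_form_le: "fsize (lit_form l) \<le> 2"
  by (cases l) auto

lemma good_lit: "lvar l \<in> prefix_vars \<Pi>' \<Longrightarrow> good \<Pi>' (lit_form l)"
  using fsize_lit_form_le[of l] N_le_M by (simp add: good_def)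

lemma good_alit_form:
  assumes "strategy \<Pi>' s v" "lvar (fst d) \<in> prefix_vars \<Pi>'"
  shows "good \<Pi>' (alit_form s v d)"
  unfolding good_def alit_form_def
  using fvars_ann[OF assms(1)] assms(2) fsize_ann_le[of s v "fst d" "snd d"] N_le_M(1)
    fsize_lit_form_le[of "fst d"]
  by auto

lemma wf_aclause_lvar: "wf_aclause D \<Longrightarrow> (l, \<tau>) \<in> D \<Longrightarrow> lvar l \<in> existentials \<Pi>"
  unfolding wf_aclause_def by blast

lemma strategy_existentials: "strategy \<Pi>' s v \<Longrightarrow> x \<in> existentials \<Pi> \<Longrightarrow> x \<in> prefix_vars \<Pi>'"
  unfolding strategy_def prefix_ext_def using universals_subset by blast

lemma good_clause_disj:
  assumes "strategy \<Pi>' s v" "wf_aclause D"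
  shows "good \<Pi>' (clause_disj s v D)"
  unfolding good_def
proof
  have D: "finite D" "card D \<le> N" using assms(2) by (auto simp: wf_aclause_def)
  have "good \<Pi>' (alit_form s v d)" if "d \<in> D" for d
    using good_alit_form[OF assms(1), of d] that strategy_existentials[OF assms(1)] wf_aclause_lvar[OF assms(2)]
    by (metis prod.collapse)
  then show "fvars (clause_disj s v D) \<subseteq> prefix_vars \<Pi>'"
    unfolding clause_disj_def fvars_disjs using set_enum[OF D(1)] by (auto simp: good_def)
  have sz: "fsize (alit_form s v d) \<le> 5 * N + 4" for d
    unfolding alit_form_def using fsize_ann_le[of s v "fst d" "snd d"] fsize_lit_form_le[of "fst d"]
    by simp
  have "fsize (clause_disj s v D) \<le> (5 * N + 4 + 1) * length (enum D) + 1"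
    unfolding clause_disj_def
    by (rule order_trans[OF fsize_disjs_le[where m = "5 * N + 4"]]) (use sz in auto)
  also have "\<dots> \<le> (5 * N + 4 + 1) * N + 1"
    using D length_enum[OF D(1)] by (intro add_mono mult_mono) auto
  also have "\<dots> \<le> M" using N_le_M(2) by (simp add: algebra_simps)
  finally show "fsize (clause_disj s v D) \<le> M" .
qed

section \<open>Transport of a line to another strategy and clause\<close>

text \<open>Transport goes in opposite directions: whoever follows the new strategy follows the old
  one, while an annotation played by the old strategy yields one of the new clause. Under
  \<open>B\<close> a literal may also be impossible, which is how the pivot disappears in a
  resolution step.\<close>

lemma der_transfer:
  assumes str: "strategy \<Pi>' s v" "strategy \<Pi>' s' v'" and wf: "wf_aclause D" "wf_aclause D'"
    and B: "good \<Pi>' B"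
    and line: "FImp (cons s v) (clause_disj s v D) \<in> \<Gamma>"
    and c: "\<And>u. u \<in> set us \<Longrightarrow> FImp (FAnd B (cons_form s' v' u)) (cons_form s v u) \<in> \<Gamma>"
    and d: "\<And>l \<tau>. (l, \<tau>) \<in> D \<Longrightarrow> FImp (FAnd B (alit_form s v (l, \<tau>))) FBot \<in> \<Gamma> \<or>
      (\<exists>\<tau>'. (l, \<tau>') \<in> D' \<and> (\<forall>u\<in>set us. lev \<Pi> u < lev \<Pi> (lvar l) \<longrightarrow>
         FImp (FAnd B (ann_form (Var (s u)) (Var (v u)) (\<tau> u)))
           (ann_form (Var (s' u)) (Var (v' u)) (\<tau>' u)) \<in> \<Gamma>))"
  shows "der \<Pi>' \<Gamma> (5 * (N + 1) ^ 2) {FImp (FAnd B (cons s' v')) (clause_disj s' v' D')}"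
proof -
  let ?E = "clause_disj s' v' D'"
  have fin: "finite D" "card D \<le> N" "finite D'" "card D' \<le> N" using wf by (auto simp: wf_aclause_def)
  note goods = good_cons[OF str(1)] good_cons[OF str(2)] good_clause_disj[OF str(1) wf(1)]
    good_clause_disj[OF str(2) wf(2)] B
  have good_l: "good \<Pi>' (lit_form l)" "good \<Pi>' (alit_form s v (l, \<tau>))" if "(l, \<tau>) \<in> D" for l \<tau>
    using that wf_aclause_lvar[OF wf(1)] strategy_existentials[OF str(1)] good_lit good_alit_form[OF str(1)]
    by auto
  \<comment> \<open>The count: \<open>N + 1\<close> for the annotation, \<open>N + 1\<close> for
    injecting the new literal into the disjunction, and one inference to combine them.\<close>
  have "der \<Pi>' \<Gamma> (2 * N + 3) {FImp (FAnd B (alit_form s v x)) ?E}" if xD: "x \<in> D" for x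
  proof -
    obtain l \<tau> where x: "x = (l, \<tau>)" by (cases x)
    note gl = good_l[OF xD[unfolded x]]
    from d[OF xD[unfolded x]] show ?thesis
    proof (elim disjE exE conjE)
      assume "FImp (FAnd B (alit_form s v (l, \<tau>))) FBot \<in> \<Gamma>"
      then show ?thesis
        unfolding x
        by (intro der_mono[OF der_rule[where ps = "[FImp (FAnd (Var 0) (Var 1)) FBot]"
              and c = "FImp (FAnd (Var 0) (Var 1)) (Var 2)" and As = "[B, alit_form s v (l, \<tau>), ?E]"]])
          (use goods gl in \<open>auto simp: bounded_sound_rules_def entails_def\<close>)
    next
      fix \<tau>' assume \<tau>': "(l, \<tau>') \<in> D'" and imp: "\<forall>u\<in>set us. lev \<Pi> u < lev \<Pi> (lvar l) \<longrightarrow>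
         FImp (FAnd B (ann_form (Var (s u)) (Var (v u)) (\<tau> u)))
           (ann_form (Var (s' u)) (Var (v' u)) (\<tau>' u)) \<in> \<Gamma>"
      let ?a' = "alit_form s' v' (l, \<tau>')"
      have ga': "good \<Pi>' ?a'"
        using \<tau>' wf_aclause_lvar[OF wf(2)] strategy_existentials[OF str(1)] good_alit_form[OF str(2)] by auto
      have 1: "der \<Pi>' \<Gamma> (N + 1) {FImp (FAnd B (ann s v l \<tau>)) (ann s' v' l \<tau>')}"
        unfolding ann_def
        by (rule der_mono[OF der_conjs_mono[where \<Gamma> = \<Gamma>]])
          (use B good_ann[OF str(1)] good_ann[OF str(2)] imp in
            \<open>auto simp: ann_def length_filter_us\<close>)
      have 2: "der \<Pi>' \<Gamma> 1 {FImp ?a' ?a'}"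
        by (rule der_rule[where ps = "[]" and c = "FImp (Var 0) (Var 0)" and As = "[?a']"])
          (use ga' in \<open>auto simp: bounded_sound_rules_def entails_def\<close>)
      have 3: "der \<Pi>' (\<Gamma> \<union> {FImp ?a' ?a'}) N {FImp ?a' ?E}"
        unfolding clause_disj_def
        by (rule der_mono[OF der_disjs_intro[where x = ?a']])
          (use goods(4) ga' \<tau>' set_enum[OF fin(3)] length_enum[OF fin(3)] fin in \<open>auto simp: clause_disj_def\<close>)
      have 4: "der \<Pi>' \<Gamma> (1 + N) {FImp ?a' ?E}"
        by (rule der_step[OF 2 3]) simp
      have 5: "der \<Pi>' (\<Gamma> \<union> {FImp (FAnd B (ann s v l \<tau>)) (ann s' v' l \<tau>')} \<union> {FImp ?a' ?E}) 1
          {FImp (FAnd B (alit_form s v x)) ?E}"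
        unfolding x alit_form_def fst_conv snd_conv
        by (rule der_rule[where ps = "[FImp (FAnd (Var 0) (Var 1)) (Var 2), FImp (FAnd (Var 3) (Var 2)) (Var 4)]"
              and c = "FImp (FAnd (Var 0) (FAnd (Var 3) (Var 1))) (Var 4)"
              and As = "[B, ann s v l \<tau>, ann s' v' l \<tau>', lit_form l, ?E]"])
          (use goods gl good_ann[OF str(1)] good_ann[OF str(2)] in
            \<open>auto simp: bounded_sound_rules_def entails_def\<close>)
      show ?thesis
        by (rule der_step[OF 1 der_step[OF der_mono[OF 4] 5 order_refl]]) auto
    qed
  qed
  then have lits: "der \<Pi>' \<Gamma> (card D * (2 * N + 3)) (\<Union>x\<in>D. {FImp (FAnd B (alit_form s v x)) ?E})"
    by (rule der_UN[OF fin(1)])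
  have "der \<Pi>' (\<Gamma> \<union> (\<Union>x\<in>D. {FImp (FAnd B (alit_form s v x)) ?E})) (length (map (alit_form s v) (enum D)) + 1)
      {FImp (FAnd B (clause_disj s v D)) ?E}"
    unfolding clause_disj_def[of s v D]
    by (rule der_disjs_elim) (use goods set_enum[OF fin(1)] in \<open>auto simp: clause_disj_def\<close>)
  from der_step[OF lits this order_refl]
  have disj: "der \<Pi>' \<Gamma> (N * (2 * N + 3) + (N + 1)) {FImp (FAnd B (clause_disj s v D)) ?E}"
    by (rule der_mono) (use fin length_enum[OF fin(1)] in \<open>auto intro!: add_mono\<close>)
  have cons: "der \<Pi>' \<Gamma> (N + 1) {FImp (FAnd B (cons s' v')) (cons s v)}"
    unfolding cons_def
    by (rule der_mono[OF der_conjs_mono[where \<Gamma> = \<Gamma>]])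
      (use goods c length_us in \<open>auto simp: cons_def\<close>)
  have final: "der \<Pi>' (\<Gamma> \<union> {FImp (FAnd B (cons s' v')) (cons s v)} \<union> {FImp (FAnd B (clause_disj s v D)) ?E}) 1
      {FImp (FAnd B (cons s' v')) ?E}"
    by (rule der_rule[where ps = "[FImp (FAnd (Var 0) (Var 1)) (Var 2), FImp (Var 2) (Var 3),
          FImp (FAnd (Var 0) (Var 3)) (Var 4)]"
        and c = "FImp (FAnd (Var 0) (Var 1)) (Var 4)"
        and As = "[B, cons s' v', cons s v, clause_disj s v D, ?E]"])
      (use goods line in \<open>auto simp: bounded_sound_rules_def entails_def\<close>)
  show ?thesis
    by (rule der_step[OF cons der_step[OF der_mono[OF disj] final order_refl]])
      (auto simp: power2_eq_square algebra_simps)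
qed

section \<open>The axiom rule\<close>

text \<open>\<open>clause_form\<close> has no trailing \<open>FBot\<close>, so
  \<open>der_disjs_elim\<close> does not apply. Goodness and size are proved in the same induction
  because each use of the schema substitutes the formula of the remaining clause.\<close>

lemma der_clause_elim:
  assumes "good \<Pi>' B" "good \<Pi>' A" "\<And>l. l \<in> set C \<Longrightarrow> lvar l \<in> prefix_vars \<Pi>'" "3 * length C + 1 \<le> M"
    "\<And>l. l \<in> set C \<Longrightarrow> FImp (FAnd B (lit_form l)) A \<in> \<Gamma>"
  shows "der \<Pi>' \<Gamma> (length C + 1) {FImp (FAnd B (clause_form C)) A} \<and> good \<Pi>' (clause_form C)
    \<and> fsize (clause_form C) \<le> 3 * length C + 1"
  using assms(3-5)
proof (induction C rule: clause_form.induct)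
  case 1
  have "der \<Pi>' \<Gamma> 1 {FImp (FAnd B FBot) A}"
    by (rule der_rule[where ps = "[]" and c = "FImp (FAnd (Var 0) FBot) (Var 1)" and As = "[B, A]"])
      (use assms in \<open>auto simp: bounded_sound_rules_def entails_def\<close>)
  then show ?case by simp
next
  case (2 l)
  then show ?case using fsize_lit_form_le[of l] by (auto intro: der_refl simp: good_lit intro: order_trans)
next
  case (3 l l' ls)
  let ?C = "l' # ls"
  have IH: "der \<Pi>' \<Gamma> (length ?C + 1) {FImp (FAnd B (clause_form ?C)) A}" "good \<Pi>' (clause_form ?C)"
    "fsize (clause_form ?C) \<le> 3 * length ?C + 1"
    using 3 by auto
  have gl: "good \<Pi>' (lit_form l)" using 3 by (simp add: good_lit)
  have "der \<Pi>' (\<Gamma> \<union> {FImp (FAnd B (clause_form ?C)) A}) 1 {FImp (FAnd B (clause_form (l # l' # ls))) A}"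
    by (rule der_rule[where ps = "[FImp (FAnd (Var 0) (Var 1)) (Var 3), FImp (FAnd (Var 0) (Var 2)) (Var 3)]"
          and c = "FImp (FAnd (Var 0) (FOr (Var 1) (Var 2))) (Var 3)"
          and As = "[B, lit_form l, clause_form ?C, A]"])
      (use 3 gl IH assms in \<open>auto simp: bounded_sound_rules_def entails_def\<close>)
  from der_step[OF IH(1) this, of "length (l # ?C) + 1"]
  have "der \<Pi>' \<Gamma> (length (l # ?C) + 1) {FImp (FAnd B (clause_form (l # ?C))) A}" by simp
  moreover have "good \<Pi>' (clause_form (l # ?C))" "fsize (clause_form (l # ?C)) \<le> 3 * length (l # ?C) + 1"
    using IH 3 fsize_lit_form_le[of l] by (auto simp: good_def)
  ultimately show ?case by blast
qed

lemma card_us: "card (set us) \<le> N"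
  using length_us card_length order_trans by blast

text \<open>The strategy constantly plays the falsifying assignment. Whoever follows it makes the
  universal literals of \<open>C\<close> false, so an existential literal is true, and its
  annotation is what has been played. For this every universal of \<open>C\<close> has to be in
  \<open>us\<close>, including those that leave no trace in the annotated clause.\<close>

lemma der_axiom:
  assumes str: "strategy \<Pi>' s v" and wf: "wf_aclause (axiom_clause \<Pi> C)"
    and C: "clause_form C \<in> \<Gamma>" "C \<in> set \<phi>" "\<not> tautological C" "length C \<le> N"
      "lvar ` set C \<inter> universals \<Pi> \<subseteq> set us"
    and s: "\<And>u. u \<in> set us \<Longrightarrow> FIff (Var (s u)) (const_form (falsifying \<Pi> C u \<noteq> None)) \<in> \<Gamma>"
    and v: "\<And>u. u \<in> set us \<Longrightarrow>
      FIff (Var (v u)) (const_form (falsifying \<Pi> C u = Some (Const True))) \<in> \<Gamma>"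
  shows "der \<Pi>' \<Gamma> (10 * (N + 1) ^ 2)
    {FImp (cons s v) (clause_disj s v (axiom_clause \<Pi> C))}"
proof -
  let ?f = "falsifying \<Pi> C" and ?D = "axiom_clause \<Pi> C"
  let ?E = "clause_disj s v ?D"
  let ?A = "\<lambda>u. ann_form (Var (s u)) (Var (v u)) (?f u)"
  note goods = good_cons[OF str] good_clause_disj[OF str wf] good_strategy[OF str]
  have D: "finite ?D" "card ?D \<le> N" using wf by (auto simp: wf_aclause_def)
  have lvars: "lvar l \<in> prefix_vars \<Pi>'" if "l \<in> set C" for l
    using that C(2) closed str prefix_ext_vars unfolding closed_pcnf_def strategy_def by blast
  \<comment> \<open>The strategy is defined by constants, so its annotations hold outright, without
    the assumption that it is followed.\<close>
  have anns: "der \<Pi>' \<Gamma> N (?A ` set us)"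
  proof (rule der_image[where n = 1])
    fix u assume u: "u \<in> set us"
    show "der \<Pi>' \<Gamma> 1 {?A u}"
      by (rule der_rule[where ps = "[FIff (Var 0) (const_form (?f u \<noteq> None)),
            FIff (Var 1) (const_form (?f u = Some (Const True)))]"
            and c = "ann_form (Var 0) (Var 1) (?f u)" and As = "[Var (s u), Var (v u)]"];
          cases "?f u" rule: annot_cases)
        (use s[OF u] v[OF u] goods u in \<open>auto simp: bounded_sound_rules_def entails_def\<close>)
  qed (use card_us in auto)
  define \<Gamma>' where "\<Gamma>' = \<Gamma> \<union> ?A ` set us"
  have lits: "der \<Pi>' \<Gamma>' (2 * N + 4) {FImp (FAnd (cons s v) (lit_form l)) ?E}" if l: "l \<in> set C" for l
  proof (cases "lvar l \<in> existentials \<Pi>")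
    case True
    define \<tau> where "\<tau> = restrict_ann \<Pi> l ?f"
    let ?a = "alit_form s v (l, \<tau>)"
    have in_D: "(l, \<tau>) \<in> ?D" using l True by (auto simp: axiom_clause_def \<tau>_def)
    have ga: "good \<Pi>' ?a" "good \<Pi>' (lit_form l)" "good \<Pi>' (ann s v l \<tau>)"
      using good_alit_form[OF str] good_lit lvars[OF l] good_ann[OF str] by auto
    have 1: "der \<Pi>' \<Gamma>' (N + 1) {ann s v l \<tau>}"
      unfolding ann_def
      by (rule der_mono[OF der_conjs_intro[where \<Gamma> = \<Gamma>']])
        (use ga(3) in \<open>auto simp: ann_def length_filter_us \<Gamma>'_def \<tau>_def restrict_ann_def\<close>)
    have 2: "der \<Pi>' (\<Gamma>' \<union> {ann s v l \<tau>}) 1 {FImp (lit_form l) ?a}"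
      unfolding alit_form_def fst_conv snd_conv
      by (rule der_rule[where ps = "[Var 1]" and c = "FImp (Var 0) (FAnd (Var 0) (Var 1))"
            and As = "[lit_form l, ann s v l \<tau>]"])
        (use ga in \<open>auto simp: bounded_sound_rules_def entails_def\<close>)
    have 3: "der \<Pi>' (\<Gamma>' \<union> {FImp (lit_form l) ?a}) N {FImp (lit_form l) ?E}"
      unfolding clause_disj_def
      by (rule der_mono[OF der_disjs_intro[where x = ?a]])
        (use goods(2) ga in_D set_enum[OF D(1)] length_enum[OF D(1)] D in \<open>auto simp: clause_disj_def\<close>)
    have 4: "der \<Pi>' (\<Gamma>' \<union> {FImp (lit_form l) ?E}) 1 {FImp (FAnd (cons s v) (lit_form l)) ?E}"
      by (rule der_rule[where ps = "[FImp (Var 0) (Var 1)]" and c = "FImp (FAnd (Var 2) (Var 0)) (Var 1)"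
            and As = "[lit_form l, ?E, cons s v]"])
        (use ga goods in \<open>auto simp: bounded_sound_rules_def entails_def\<close>)
    show ?thesis
      by (rule der_step[OF der_step[OF der_step[OF 1 2 order_refl] 3 order_refl] 4]) simp
  next
    case False
    let ?u = "lvar l"
    have "?u \<in> prefix_vars \<Pi>"
      using l C(2) closed unfolding closed_pcnf_def by blast
    then have univ: "?u \<in> universals \<Pi>"
      using False unfolding prefix_vars_def universals_def existentials_def
      by (auto, metis quantifier.exhaust)
    then have u: "?u \<in> set us" using C(5) l by auto
    have 1: "der \<Pi>' \<Gamma>' N {FImp (cons s v) (cons_form s v ?u)}"
      unfolding cons_def by (rule der_mono[OF der_conjs_elim])
        (use u goods length_us in \<open>auto simp: cons_def\<close>)
    have 2: "der \<Pi>' (\<Gamma>' \<union> {FImp (cons s v) (cons_form s v ?u)}) 1 {FImp (FAnd (cons s v) (lit_form l)) ?E}"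
    proof (cases l)
      case (Pos x)
      then have f: "?f ?u = Some (Const False)" using univ l by (simp add: falsifying_def)
      show ?thesis
        unfolding cons_form_def
        by (rule der_rule[where ps = "[FImp (Var 0) (FImp (Var 1) (FIff (Var 2) (Var 3))), FIff (Var 1) FTop,
            FIff (Var 3) FBot]" and c = "FImp (FAnd (Var 0) (Var 2)) (Var 4)"
              and As = "[cons s v, Var (s ?u), Var ?u, Var (v ?u), ?E]"])
          (use s[OF u] v[OF u] f goods u Pos in
            \<open>auto simp: bounded_sound_rules_def entails_def \<Gamma>'_def const_form_def\<close>)
    next
      case (Neg x)
      \<comment> \<open>\<open>falsifying\<close> looks for the positive literal first; it is absent
        because \<open>C\<close> is not tautological.\<close>
      then have f: "?f ?u = Some (Const True)" using univ l C(3)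
        by (auto simp: falsifying_def tautological_def)
      show ?thesis
        unfolding cons_form_def
        by (rule der_rule[where ps = "[FImp (Var 0) (FImp (Var 1) (FIff (Var 2) (Var 3))), FIff (Var 1) FTop,
            FIff (Var 3) FTop]" and c = "FImp (FAnd (Var 0) (FNot (Var 2))) (Var 4)"
              and As = "[cons s v, Var (s ?u), Var ?u, Var (v ?u), ?E]"])
          (use s[OF u] v[OF u] f goods u Neg in
            \<open>auto simp: bounded_sound_rules_def entails_def \<Gamma>'_def const_form_def\<close>)
    qed
    show ?thesis
      by (rule der_step[OF 1 2]) simp
  qed
  let ?L = "(\<lambda>l. FImp (FAnd (cons s v) (lit_form l)) ?E) ` set C"
  have all_lits: "der \<Pi>' \<Gamma>' (N * (2 * N + 4)) ?L"
    by (rule der_image[where n = "2 * N + 4"])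
      (use lits C(4) card_length[of C] in \<open>auto intro!: mult_right_mono intro: order_trans simp del: mult_Suc_right\<close>)
  have "3 * length C + 1 \<le> M" using C(4) N_le_M(1) by simp
  then have elim: "der \<Pi>' (\<Gamma>' \<union> ?L) (length C + 1) {FImp (FAnd (cons s v) (clause_form C)) ?E} \<and>
      good \<Pi>' (clause_form C) \<and> fsize (clause_form C) \<le> 3 * length C + 1"
    by (intro der_clause_elim goods lvars) auto
  have final: "der \<Pi>' (\<Gamma>' \<union> {FImp (FAnd (cons s v) (clause_form C)) ?E}) 1 {FImp (cons s v) ?E}"
    by (rule der_rule[where ps = "[Var 1, FImp (FAnd (Var 0) (Var 1)) (Var 2)]" and c = "FImp (Var 0) (Var 2)"
          and As = "[cons s v, clause_form C, ?E]"])
      (use goods elim C(1) in \<open>auto simp: bounded_sound_rules_def entails_def \<Gamma>'_def\<close>)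
  have "der \<Pi>' \<Gamma>' (N * (2 * N + 4) + (N + 1) + 1) {FImp (cons s v) ?E}"
    by (rule der_step[OF der_step[OF all_lits conjunct1[OF elim] order_refl] final]) (use C(4) in simp)
  from der_step[OF anns this[unfolded \<Gamma>'_def] order_refl] show ?thesis
    by (rule der_mono) (auto simp: power2_eq_square algebra_simps)
qed

section \<open>Instantiation\<close>

text \<open>The new strategy keeps the moves of the old one and plays \<alpha> where that leaves a
  universal unset. Following it therefore includes following the old one, and a played annotation
  turns into its completion by \<alpha>.\<close>

lemma der_instantiate:
  assumes str: "strategy \<Pi>' s v" "strategy \<Pi>' s' v'" and wf: "wf_aclause D" "wf_aclause (inst \<Pi> \<alpha> D)"
    and line: "FImp (cons s v) (clause_disj s v D) \<in> \<Gamma>"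
    and s': "\<And>u. u \<in> set us \<Longrightarrow> FIff (Var (s' u)) (FOr (Var (s u)) (const_form (\<alpha> u \<noteq> None))) \<in> \<Gamma>"
    and v': "\<And>u. u \<in> set us \<Longrightarrow>
      FIff (Var (v' u)) (fite (Var (s u)) (Var (v u)) (const_form (\<alpha> u = Some (Const True)))) \<in> \<Gamma>"
  shows "der \<Pi>' \<Gamma> (10 * (N + 1) ^ 2) {FImp (cons s' v') (clause_disj s' v' (inst \<Pi> \<alpha> D))}"
proof -
  let ?D' = "inst \<Pi> \<alpha> D"
  let ?c = "\<lambda>u. FImp (FAnd FTop (cons_form s' v' u)) (cons_form s v u)"
  let ?a = "\<lambda>(u, a). FImp (FAnd FTop (ann_form (Var (s u)) (Var (v u)) a))
     (ann_form (Var (s' u)) (Var (v' u)) (or_else a (\<alpha> u)))"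
  note goods = good_cons[OF str(2)] good_clause_disj[OF str(2) wf(2)] good_strategy[OF str(1)] good_strategy[OF str(2)]
  have 1: "der \<Pi>' \<Gamma> N (?c ` set us)"
  proof (rule der_image[where n = 1])
    fix u assume u: "u \<in> set us"
    show "der \<Pi>' \<Gamma> 1 {?c u}"
      unfolding cons_form_def
      by (rule der_rule[where ps = "[FIff (Var 2) (FOr (Var 0) (const_form (\<alpha> u \<noteq> None))),
            FIff (Var 3) (fite (Var 0) (Var 1) (const_form (\<alpha> u = Some (Const True))))]"
            and c = "FImp (FAnd FTop (FImp (Var 2) (FIff (Var 4) (Var 3)))) (FImp (Var 0) (FIff (Var 4) (Var 1)))"
            and As = "[Var (s u), Var (v u), Var (s' u), Var (v' u), Var u]"])
        (use s'[OF u] v'[OF u] goods u in \<open>auto simp: bounded_sound_rules_def entails_def\<close>)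
  qed (use card_us in auto)
  \<comment> \<open>All four annotations are covered for each universal, so these facts serve every
    literal of the clause.\<close>
  have 2: "der \<Pi>' \<Gamma> (4 * N) (?a ` (set us \<times> annots))"
  proof (rule der_image[where n = 1])
    fix p assume "p \<in> set us \<times> annots"
    then obtain u a where p: "p = (u, a)" and u: "u \<in> set us" by auto
    show "der \<Pi>' \<Gamma> 1 {?a p}"
      unfolding p prod.case
      by (rule der_rule[where ps = "[FIff (Var 2) (FOr (Var 0) (const_form (\<alpha> u \<noteq> None))),
            FIff (Var 3) (fite (Var 0) (Var 1) (const_form (\<alpha> u = Some (Const True))))]"
            and c = "FImp (FAnd FTop (ann_form (Var 0) (Var 1) a)) (ann_form (Var 2) (Var 3) (or_else a (\<alpha> u)))"
            and As = "[Var (s u), Var (v u), Var (s' u), Var (v' u)]"];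
          cases a rule: annot_cases; cases "\<alpha> u" rule: annot_cases)
        (use s'[OF u] v'[OF u] goods u in \<open>auto simp: bounded_sound_rules_def entails_def\<close>)
  qed (use card_us in \<open>auto simp: card_cartesian_product\<close>)
  have 3: "der \<Pi>' (\<Gamma> \<union> (?c ` set us) \<union> (?a ` (set us \<times> annots))) (5 * (N + 1) ^ 2)
      {FImp (FAnd FTop (cons s' v')) (clause_disj s' v' ?D')}"
  proof (rule der_transfer[OF str wf])
    fix l \<tau> assume "(l, \<tau>) \<in> D"
    then show "FImp (FAnd FTop (alit_form s v (l, \<tau>))) FBot \<in> \<Gamma> \<union> (?c ` set us) \<union> (?a ` (set us \<times> annots)) \<or>
      (\<exists>\<tau>'. (l, \<tau>') \<in> ?D' \<and> (\<forall>u\<in>set us. lev \<Pi> u < lev \<Pi> (lvar l) \<longrightarrow>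
         FImp (FAnd FTop (ann_form (Var (s u)) (Var (v u)) (\<tau> u)))
           (ann_form (Var (s' u)) (Var (v' u)) (\<tau>' u)) \<in> \<Gamma> \<union> (?c ` set us) \<union> (?a ` (set us \<times> annots))))"
      by (intro disjI2 exI[of _ "restrict_ann \<Pi> l (completion \<tau> \<alpha>)"] conjI ballI impI)
        (force simp: inst_def, force simp: restrict_ann_def completion_or_else image_iff)
  qed (use line in auto)
  have 4: "der \<Pi>' (\<Gamma> \<union> {FImp (FAnd FTop (cons s' v')) (clause_disj s' v' ?D')}) 1
      {FImp (cons s' v') (clause_disj s' v' ?D')}"
    by (rule der_rule[where ps = "[FImp (FAnd FTop (Var 0)) (Var 1)]" and c = "FImp (Var 0) (Var 1)"
          and As = "[cons s' v', clause_disj s' v' ?D']"])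
      (use goods in \<open>auto simp: bounded_sound_rules_def entails_def\<close>)
  have 5: "der \<Pi>' \<Gamma> (N + (4 * N + 5 * (N + 1) ^ 2)) {FImp (FAnd FTop (cons s' v')) (clause_disj s' v' ?D')}"
    by (rule der_step[OF 1 der_step[OF der_mono[OF 2] 3 order_refl]]) auto
  show ?thesis
    by (rule der_step[OF 5 4]) (auto simp: power2_eq_square algebra_simps)
qed

section \<open>Merging\<close>

text \<open>The strategy stays the same and only the clause is weakened: where two annotations with
  equal domains differ, both say that the universal is set, which is all that a star says. With
  different domains this would fail at a universal that one of them leaves unset.\<close>

lemma der_merge:
  assumes str: "strategy \<Pi>' s v" and dom: "dom \<mu> = dom \<sigma>"
    and wf: "wf_aclause (C \<union> {(b, \<mu>), (b, \<sigma>)})" "wf_aclause (insert (b, merge_ann \<mu> \<sigma>) C)"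
    and line: "FImp (cons s v) (clause_disj s v (C \<union> {(b, \<mu>), (b, \<sigma>)})) \<in> \<Gamma>"
  shows "der \<Pi>' \<Gamma> (30 * (N + 1) ^ 2) {FImp (cons s v) (clause_disj s v (insert (b, merge_ann \<mu> \<sigma>) C))}"
proof -
  let ?D = "C \<union> {(b, \<mu>), (b, \<sigma>)}" and ?D' = "insert (b, merge_ann \<mu> \<sigma>) C"
  let ?c = "\<lambda>u. FImp (FAnd FTop (cons_form s v u)) (cons_form s v u)"
  let ?a = "\<lambda>(u, a, a'). FImp (FAnd FTop (ann_form (Var (s u)) (Var (v u)) a)) (ann_form (Var (s u)) (Var (v u)) a')"
  let ?R = "{(u, a, a'). u \<in> set us \<and> (a' = a \<or> a \<noteq> None \<and> a' = Some Star)}"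
  have R: "?R \<subseteq> set us \<times> annots \<times> annots" by auto
  then have fin: "finite ?R" by (rule finite_subset) simp
  have "card ?R \<le> card (set us \<times> annots \<times> annots)" by (rule card_mono[OF _ R]) simp
  also have "\<dots> \<le> 16 * N" using card_us by (simp add: card_cartesian_product)
  finally have cardR: "card ?R \<le> 16 * N" .
  note goods = good_cons[OF str] good_clause_disj[OF str wf(2)] good_strategy[OF str]
  have 1: "der \<Pi>' \<Gamma> N (?c ` set us)"
  proof (rule der_image[where n = 1])
    fix u assume u: "u \<in> set us"
    show "der \<Pi>' \<Gamma> 1 {?c u}"
      unfolding cons_form_def
      by (rule der_rule[where ps = "[]"
            and c = "FImp (FAnd FTop (FImp (Var 0) (FIff (Var 2) (Var 1)))) (FImp (Var 0) (FIff (Var 2) (Var 1)))"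
            and As = "[Var (s u), Var (v u), Var u]"])
        (use goods u in \<open>auto simp: bounded_sound_rules_def entails_def\<close>)
  qed (use card_us in auto)
  have 2: "der \<Pi>' \<Gamma> (16 * N) (?a ` ?R)"
  proof (rule der_image[where n = 1])
    fix p assume "p \<in> ?R"
    then obtain u a a' where p: "p = (u, a, a')" and u: "u \<in> set us" and a: "a' = a \<or> a \<noteq> None \<and> a' = Some Star"
      by auto
    show "der \<Pi>' \<Gamma> 1 {?a p}"
      unfolding p prod.case
      by (rule der_rule[where ps = "[]"
            and c = "FImp (FAnd FTop (ann_form (Var 0) (Var 1) a)) (ann_form (Var 0) (Var 1) a')"
            and As = "[Var (s u), Var (v u)]"];
          cases a rule: annot_cases; cases a' rule: annot_cases)
        (use a goods u in \<open>auto simp: bounded_sound_rules_def entails_def\<close>)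
  qed (use cardR fin in auto)
  have 3: "der \<Pi>' (\<Gamma> \<union> (?c ` set us) \<union> (?a ` ?R)) (5 * (N + 1) ^ 2)
      {FImp (FAnd FTop (cons s v)) (clause_disj s v ?D')}"
  proof (rule der_transfer[OF str str wf])
    fix l \<tau> assume lt: "(l, \<tau>) \<in> ?D"
    have "\<exists>\<tau>'. (l, \<tau>') \<in> ?D' \<and> (\<forall>u. \<tau>' u = \<tau> u \<or> \<tau> u \<noteq> None \<and> \<tau>' u = Some Star)"
    proof (cases "(l, \<tau>) \<in> C")
      case False
      then have "l = b" "\<tau> = \<mu> \<or> \<tau> = \<sigma>" using lt by auto
      moreover have "\<mu> u = \<sigma> u \<or> \<mu> u \<noteq> None \<and> \<sigma> u \<noteq> None" for u
        using dom by (metis domIff)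
      ultimately show ?thesis
        by (intro exI[of _ "merge_ann \<mu> \<sigma>"]) (auto simp: merge_ann_def)
    qed auto
    then obtain \<tau>' where \<tau>': "(l, \<tau>') \<in> ?D'" "\<And>u. \<tau>' u = \<tau> u \<or> \<tau> u \<noteq> None \<and> \<tau>' u = Some Star" by auto
    have "FImp (FAnd FTop (ann_form (Var (s u)) (Var (v u)) (\<tau> u)))
        (ann_form (Var (s u)) (Var (v u)) (\<tau>' u)) \<in> ?a ` ?R" if "u \<in> set us" for u
      by (rule image_eqI[where x = "(u, \<tau> u, \<tau>' u)"]) (use that \<tau>'(2)[of u] in auto)
    then show "FImp (FAnd FTop (alit_form s v (l, \<tau>))) FBot \<in> \<Gamma> \<union> (?c ` set us) \<union> (?a ` ?R) \<or>
      (\<exists>\<tau>'. (l, \<tau>') \<in> ?D' \<and> (\<forall>u\<in>set us. lev \<Pi> u < lev \<Pi> (lvar l) \<longrightarrow>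
         FImp (FAnd FTop (ann_form (Var (s u)) (Var (v u)) (\<tau> u)))
           (ann_form (Var (s u)) (Var (v u)) (\<tau>' u)) \<in> \<Gamma> \<union> (?c ` set us) \<union> (?a ` ?R)))"
      using \<tau>'(1) by blast
  qed (use line in auto)
  have 4: "der \<Pi>' (\<Gamma> \<union> {FImp (FAnd FTop (cons s v)) (clause_disj s v ?D')}) 1
      {FImp (cons s v) (clause_disj s v ?D')}"
    by (rule der_rule[where ps = "[FImp (FAnd FTop (Var 0)) (Var 1)]" and c = "FImp (Var 0) (Var 1)"
          and As = "[cons s v, clause_disj s v ?D']"])
      (use goods in \<open>auto simp: bounded_sound_rules_def entails_def\<close>)
  have 5: "der \<Pi>' \<Gamma> (N + (16 * N + 5 * (N + 1) ^ 2)) {FImp (FAnd FTop (cons s v)) (clause_disj s v ?D')}"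
    by (rule der_step[OF 1 der_step[OF der_mono[OF 2] 3 order_refl]]) auto
  show ?thesis
    by (rule der_step[OF 5 4]) (auto simp: power2_eq_square algebra_simps)
qed

end

section \<open>The resolution rule\<close>

text \<open>Left of the leftmost universal no commitment has been made, hence \<open>FBot\<close>
  for the empty list.\<close>

fun head_var :: "(var \<Rightarrow> var) \<Rightarrow> var list \<Rightarrow> form" where
  "head_var c [] = FBot"
| "head_var c (u # us) = Var (c u)"

text \<open>P and Q stand for a commitment to the first and to the second premise. As long as
  neither is made, both strategies match the pivot annotations: both set the universals of \<tau>,
  only the first those of \<xi>, only the second those of \<sigma>, and no others are set. So the
  union of their moves can be played.\<close>

abbreviation set_form :: "form \<Rightarrow> form \<Rightarrow> form \<Rightarrow> form \<Rightarrow> aval option \<Rightarrow> aval option \<Rightarrow> form" where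
  "set_form P Q S1 S2 \<xi> \<sigma> \<equiv> fite P (FOr S1 (const_form (\<sigma> \<noteq> None)))
     (fite Q (FOr S2 (const_form (\<xi> \<noteq> None))) (FOr S1 S2))"

text \<open>A star of \<sigma> or \<xi> that has to be played after a commitment gets the value
  false. Either value would do, as a star only claims that the universal is set.\<close>

abbreviation val_form :: "form \<Rightarrow> form \<Rightarrow> form \<Rightarrow> form \<Rightarrow> form \<Rightarrow> form \<Rightarrow> aval option \<Rightarrow> aval option \<Rightarrow> form" where
  "val_form P Q S1 V1 S2 V2 \<xi> \<sigma> \<equiv> fite P (fite S1 V1 (const_form (\<sigma> = Some (Const True))))
     (fite Q (fite S2 V2 (const_form (\<xi> = Some (Const True)))) (fite S1 V1 V2))"

text \<open>The metavariables 0 to 10 stand for \<open>c1 u\<close>, \<open>c2 u\<close>, \<open>s1 u\<close>, \<open>v1 u\<close>, \<open>s2 u\<close>, \<open>v2 u\<close>, \<open>s u\<close>, \<open>v u\<close>,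
  the case distinction \<open>B\<close>, the pivot and \<open>u\<close>.\<close>
definition resolution_premises ::
    "aval option \<Rightarrow> aval option \<Rightarrow> aval option \<Rightarrow> bool \<Rightarrow> form list" where
  "resolution_premises \<tau> \<xi> \<sigma> left =
    [FIff (Var 6) (set_form (Var 0) (Var 1) (Var 2) (Var 4) \<xi> \<sigma>),
     FIff (Var 7) (val_form (Var 0) (Var 1) (Var 2) (Var 3) (Var 4) (Var 5) \<xi> \<sigma>),
     FImp (FAnd (FNot (Var 0)) (FNot (Var 1)))
       (FAnd (if left then ann_form (Var 2) (Var 3) (or_else \<xi> \<tau>) else Var 9)
         (if left then ann_form (Var 4) (Var 5) (or_else \<sigma> \<tau>) else FNot (Var 9)))]"

section \<open>Soundness of the schemata for resolution\<close>

lemma bounded_sound_rulesI: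
  assumes "length ps \<le> 8" "\<And>A. A \<in> insert c (set ps) \<Longrightarrow> fsize A \<le> 100 \<and> (\<forall>x\<in>fvars A. x < 20)"
    "\<And>e. (\<forall>p\<in>set ps. eval e p) \<Longrightarrow> eval e c"
  shows "(ps, c) \<in> bounded_sound_rules"
  using assms by (auto simp: bounded_sound_rules_def entails_def)

lemma ann_form_Var_bounds:
  "fsize (ann_form (Var i) (Var j) a) \<le> 4" "x \<in> fvars (ann_form (Var i) (Var j) a) \<Longrightarrow> x = i \<or> x = j"
  by (cases a rule: annot_cases; auto)+

lemma resolution_premises_bounds:
  assumes "A \<in> set (resolution_premises \<tau> \<xi> \<sigma> left)"
  shows "fsize A \<le> 100 \<and> (\<forall>x\<in>fvars A. x < 20)"
  using assms ann_form_Var_bounds(1)[of 2 3 "or_else \<xi> \<tau>"] ann_form_Var_bounds(1)[of 4 5 "or_else \<sigma> \<tau>"]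
  unfolding resolution_premises_def by (cases left) (auto dest!: ann_form_Var_bounds(2))

lemma eval_resolution_premises:
  assumes "\<forall>p\<in>set (resolution_premises \<tau> \<xi> \<sigma> left). eval e p"
  shows "e 0 \<Longrightarrow> e 6 \<longleftrightarrow> e 2 \<or> \<sigma> \<noteq> None"
    "e 0 \<Longrightarrow> e 7 \<longleftrightarrow> (if e 2 then e 3 else \<sigma> = Some (Const True))"
    "\<not> e 0 \<Longrightarrow> e 1 \<Longrightarrow> e 6 \<longleftrightarrow> e 4 \<or> \<xi> \<noteq> None"
    "\<not> e 0 \<Longrightarrow> e 1 \<Longrightarrow> e 7 \<longleftrightarrow> (if e 4 then e 5 else \<xi> = Some (Const True))"
    "\<not> e 0 \<Longrightarrow> \<not> e 1 \<Longrightarrow> e 6 \<longleftrightarrow> e 2 \<or> e 4"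
    "\<not> e 0 \<Longrightarrow> \<not> e 1 \<Longrightarrow> e 7 \<longleftrightarrow> (if e 2 then e 3 else e 5)"
    "\<not> e 0 \<Longrightarrow> \<not> e 1 \<Longrightarrow> left \<and> eval e (ann_form (Var 2) (Var 3) (or_else \<xi> \<tau>)) \<and>
      eval e (ann_form (Var 4) (Var 5) (or_else \<sigma> \<tau>))"
  using assms unfolding resolution_premises_def by (simp_all split: if_splits)

text \<open>Metavariable 8 excludes a commitment to the second premise. After one to the first its
  moves are copied, and before any commitment its value takes precedence, so its moves survive in
  both cases.\<close>

lemma resolution_rule_cons1:
  assumes "\<tau> = None \<or> (\<xi> = None \<and> \<sigma> = None \<and> \<tau> \<noteq> Some Star)" "\<xi> = None \<or> \<sigma> = None"
    "\<not> left \<Longrightarrow> \<tau> = None \<and> \<xi> = None \<and> \<sigma> = None"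
  shows "(FImp (Var 8) (FNot (Var 1)) # resolution_premises \<tau> \<xi> \<sigma> left,
      FImp (FAnd (Var 8) (FImp (Var 6) (FIff (Var 10) (Var 7)))) (FImp (Var 2) (FIff (Var 10) (Var 3))))
      \<in> bounded_sound_rules"
proof (rule bounded_sound_rulesI)
  fix e assume *: "\<forall>p\<in>set (FImp (Var 8) (FNot (Var 1)) # resolution_premises \<tau> \<xi> \<sigma> left). eval e p"
  then have "\<forall>p\<in>set (resolution_premises \<tau> \<xi> \<sigma> left). eval e p" by simp
  note prem = eval_resolution_premises[OF this]
  show "eval e (FImp (FAnd (Var 8) (FImp (Var 6) (FIff (Var 10) (Var 7)))) (FImp (Var 2) (FIff (Var 10) (Var 3))))"
  proof (cases "e 8 = True")
    case True
    then have 1: "\<not> e 1" using * by simp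
    show ?thesis
    proof (cases "e 0")
      case True
      show ?thesis
        using prem(1,2)[OF True] by simp
    next
      case False
      have "\<tau> = None \<or> (\<exists>b. \<tau> = Some (Const b) \<and> \<xi> = None \<and> \<sigma> = None)"
        using assms(1) by (metis aval.exhaust not_None_eq)
      then show ?thesis
        using prem(5-7)[OF False 1] assms(2)
        by (elim disjE exE conjE; cases \<sigma> rule: annot_cases)
          (auto split: if_splits option.splits aval.splits)
    qed
  qed simp
next
  fix A assume "A \<in> insert (FImp (FAnd (Var 8) (FImp (Var 6) (FIff (Var 10) (Var 7)))) (FImp (Var 2) (FIff (Var 10) (Var 3)))) (set (FImp (Var 8) (FNot (Var 1)) # resolution_premises \<tau> \<xi> \<sigma> left))"
  then show "fsize A \<le> 100 \<and> (\<forall>x\<in>fvars A. x < 20)"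
    using resolution_premises_bounds[of A \<tau> \<xi> \<sigma> left] by auto
qed (simp add: resolution_premises_def)

text \<open>If both strategies set the universal before a commitment, the value of the first one is
  played. The second agrees with it, since both then play the value of \<tau>; a star in \<tau>
  would allow them to differ.\<close>

lemma resolution_rule_cons2:
  assumes "\<tau> = None \<or> (\<xi> = None \<and> \<sigma> = None \<and> \<tau> \<noteq> Some Star)" "\<xi> = None \<or> \<sigma> = None"
    "\<not> left \<Longrightarrow> \<tau> = None \<and> \<xi> = None \<and> \<sigma> = None"
  shows "(FImp (FNot (Var 8)) (FNot (Var 0)) # resolution_premises \<tau> \<xi> \<sigma> left,
      FImp (FAnd (FNot (Var 8)) (FImp (Var 6) (FIff (Var 10) (Var 7)))) (FImp (Var 4) (FIff (Var 10) (Var 5))))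
      \<in> bounded_sound_rules"
proof (rule bounded_sound_rulesI)
  fix e assume *: "\<forall>p\<in>set (FImp (FNot (Var 8)) (FNot (Var 0)) # resolution_premises \<tau> \<xi> \<sigma> left). eval e p"
  then have "\<forall>p\<in>set (resolution_premises \<tau> \<xi> \<sigma> left). eval e p" by simp
  note prem = eval_resolution_premises[OF this]
  show "eval e (FImp (FAnd (FNot (Var 8)) (FImp (Var 6) (FIff (Var 10) (Var 7)))) (FImp (Var 4) (FIff (Var 10) (Var 5))))"
  proof (cases "e 8 = False")
    case True
    then have 1: "\<not> e 0" using * by simp
    show ?thesis
    proof (cases "e 1")
      case True
      show ?thesis
        using prem(3,4)[OF 1 True] by simp
    next
      case False
      have "\<tau> = None \<or> (\<exists>b. \<tau> = Some (Const b) \<and> \<xi> = None \<and> \<sigma> = None)"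
        using assms(1) by (metis aval.exhaust not_None_eq)
      then show ?thesis
        using prem(5-7)[OF 1 False] assms(2)
        by (elim disjE exE conjE; cases \<sigma> rule: annot_cases; cases \<xi> rule: annot_cases)
          (auto split: if_splits option.splits aval.splits)
    qed
  qed simp
next
  fix A assume "A \<in> insert (FImp (FAnd (FNot (Var 8)) (FImp (Var 6) (FIff (Var 10) (Var 7)))) (FImp (Var 4) (FIff (Var 10) (Var 5)))) (set (FImp (FNot (Var 8)) (FNot (Var 0)) # resolution_premises \<tau> \<xi> \<sigma> left))"
  then show "fsize A \<le> 100 \<and> (\<forall>x\<in>fvars A. x < 20)"
    using resolution_premises_bounds[of A \<tau> \<xi> \<sigma> left] by auto
qed (simp add: resolution_premises_def)

text \<open>Before a commitment, a universal that the first strategy leaves unset is set by the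
  second only as \<sigma> prescribes, so an undefined annotation becomes its completion by \<sigma>.
  After the commitment to the first, \<sigma> is played there by definition.\<close>

lemma resolution_rule_ann1:
  assumes "\<tau> = None \<or> (\<xi> = None \<and> \<sigma> = None \<and> \<tau> \<noteq> Some Star)" "\<xi> = None \<or> \<sigma> = None"
    "\<not> left \<Longrightarrow> \<tau> = None \<and> \<xi> = None \<and> \<sigma> = None"
  shows "(FImp (Var 8) (FNot (Var 1)) # resolution_premises \<tau> \<xi> \<sigma> left,
      FImp (FAnd (Var 8) (ann_form (Var 2) (Var 3) a)) (ann_form (Var 6) (Var 7) (or_else a \<sigma>)))
      \<in> bounded_sound_rules"
proof (rule bounded_sound_rulesI)
  fix e assume *: "\<forall>p\<in>set (FImp (Var 8) (FNot (Var 1)) # resolution_premises \<tau> \<xi> \<sigma> left). eval e p"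
  then have "\<forall>p\<in>set (resolution_premises \<tau> \<xi> \<sigma> left). eval e p" by simp
  note prem = eval_resolution_premises[OF this]
  show "eval e (FImp (FAnd (Var 8) (ann_form (Var 2) (Var 3) a)) (ann_form (Var 6) (Var 7) (or_else a \<sigma>)))"
  proof (cases "e 8 = True")
    case True
    then have 1: "\<not> e 1" using * by simp
    show ?thesis
    proof (cases "e 0")
      case True
      show ?thesis
        using prem(1,2)[OF True] by (cases a rule: annot_cases; cases \<sigma> rule: annot_cases) simp_all
    next
      case False
      have "\<tau> = None \<or> (\<exists>b. \<tau> = Some (Const b) \<and> \<xi> = None \<and> \<sigma> = None)"
        using assms(1) by (metis aval.exhaust not_None_eq)
      then show ?thesis
        using prem(5-7)[OF False 1] assms(2)
        by (elim disjE exE conjE; cases a rule: annot_cases; cases \<sigma> rule: annot_cases)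
          (auto split: if_splits option.splits aval.splits)
    qed
  qed simp
next
  fix A assume "A \<in> insert (FImp (FAnd (Var 8) (ann_form (Var 2) (Var 3) a)) (ann_form (Var 6) (Var 7) (or_else a \<sigma>))) (set (FImp (Var 8) (FNot (Var 1)) # resolution_premises \<tau> \<xi> \<sigma> left))"
  then show "fsize A \<le> 100 \<and> (\<forall>x\<in>fvars A. x < 20)"
    using resolution_premises_bounds[of A \<tau> \<xi> \<sigma> left] ann_form_Var_bounds(1)[of 2 3 a]
      ann_form_Var_bounds(1)[of 6 7 "or_else a \<sigma>"]
    by (auto dest!: ann_form_Var_bounds(2))
qed (simp add: resolution_premises_def)

text \<open>The mirror image: what only the first strategy has set before a commitment appears as a
  completion by \<xi>, and where both have set a universal, \<tau> makes the values agree.\<close>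

lemma resolution_rule_ann2:
  assumes "\<tau> = None \<or> (\<xi> = None \<and> \<sigma> = None \<and> \<tau> \<noteq> Some Star)" "\<xi> = None \<or> \<sigma> = None"
    "\<not> left \<Longrightarrow> \<tau> = None \<and> \<xi> = None \<and> \<sigma> = None"
  shows "(FImp (FNot (Var 8)) (FNot (Var 0)) # resolution_premises \<tau> \<xi> \<sigma> left,
      FImp (FAnd (FNot (Var 8)) (ann_form (Var 4) (Var 5) a)) (ann_form (Var 6) (Var 7) (or_else a \<xi>)))
      \<in> bounded_sound_rules"
proof (rule bounded_sound_rulesI)
  fix e assume *: "\<forall>p\<in>set (FImp (FNot (Var 8)) (FNot (Var 0)) # resolution_premises \<tau> \<xi> \<sigma> left). eval e p"
  then have "\<forall>p\<in>set (resolution_premises \<tau> \<xi> \<sigma> left). eval e p" by simp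
  note prem = eval_resolution_premises[OF this]
  show "eval e (FImp (FAnd (FNot (Var 8)) (ann_form (Var 4) (Var 5) a)) (ann_form (Var 6) (Var 7) (or_else a \<xi>)))"
  proof (cases "e 8 = False")
    case True
    then have 1: "\<not> e 0" using * by simp
    show ?thesis
    proof (cases "e 1")
      case True
      show ?thesis
        using prem(3,4)[OF 1 True] by (cases a rule: annot_cases; cases \<xi> rule: annot_cases) simp_all
    next
      case False
      have "\<tau> = None \<or> (\<exists>b. \<tau> = Some (Const b) \<and> \<xi> = None \<and> \<sigma> = None)"
        using assms(1) by (metis aval.exhaust not_None_eq)
      then show ?thesis
        using prem(5-7)[OF 1 False] assms(2)
        by (elim disjE exE conjE; cases a rule: annot_cases; cases \<sigma> rule: annot_cases; cases \<xi> rule: annot_cases)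
          (auto split: if_splits option.splits aval.splits)
    qed
  qed simp
next
  fix A assume "A \<in> insert (FImp (FAnd (FNot (Var 8)) (ann_form (Var 4) (Var 5) a)) (ann_form (Var 6) (Var 7) (or_else a \<xi>))) (set (FImp (FNot (Var 8)) (FNot (Var 0)) # resolution_premises \<tau> \<xi> \<sigma> left))"
  then show "fsize A \<le> 100 \<and> (\<forall>x\<in>fvars A. x < 20)"
    using resolution_premises_bounds[of A \<tau> \<xi> \<sigma> left] ann_form_Var_bounds(1)[of 4 5 a]
      ann_form_Var_bounds(1)[of 6 7 "or_else a \<xi>"]
    by (auto dest!: ann_form_Var_bounds(2))
qed (simp add: resolution_premises_def)

context irm_simulation
begin

section \<open>Chains of commitments\<close>

text \<open>The common shape of the definitions of \<open>c1\<close> and \<open>c2\<close>: a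
  commitment persists to the right and arises only at a deviation, where \<open>a u\<close> fails.
  The further condition \<open>X\<close>, in which the two differ, is hidden because persistence and
  absence of commitments do not depend on it.\<close>

definition chain :: "prefix \<Rightarrow> form set \<Rightarrow> (var \<Rightarrow> var) \<Rightarrow> (var \<Rightarrow> form) \<Rightarrow> var list \<Rightarrow> bool" where
  "chain \<Pi>' \<Gamma> c a zs \<longleftrightarrow> (\<forall>ys u rest. zs = ys @ u # rest \<longrightarrow> good \<Pi>' (Var (c u)) \<and> good \<Pi>' (a u) \<and>
     (\<exists>X. good \<Pi>' X \<and> FIff (Var (c u)) (FOr (head_var c rest) (FAnd X (FNot (a u)))) \<in> \<Gamma>))"

lemma chain_Cons:
  assumes "chain \<Pi>' \<Gamma> c a (u # zs)"
  shows "chain \<Pi>' \<Gamma> c a zs" "good \<Pi>' (Var (c u))" "good \<Pi>' (a u)"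
    "\<exists>X. good \<Pi>' X \<and> FIff (Var (c u)) (FOr (head_var c zs) (FAnd X (FNot (a u)))) \<in> \<Gamma>"
  using assms unfolding chain_def by (metis append_Cons, metis append_Nil, metis append_Nil, metis append_Nil)

lemma chain_mono: "chain \<Pi>' \<Gamma> c a zs \<Longrightarrow> \<Gamma> \<subseteq> \<Gamma>' \<Longrightarrow> chain \<Pi>' \<Gamma>' c a zs"
  unfolding chain_def by blast

lemma good_head_var: "chain \<Pi>' \<Gamma> c a zs \<Longrightarrow> good \<Pi>' (head_var c zs)"
  by (cases zs) (auto dest: chain_Cons)

text \<open>Induction from the leftmost universal: without a deviation no commitment ever
  arises.\<close>

lemma der_chain_false:
  assumes "chain \<Pi>' \<Gamma> c a zs" "good \<Pi>' H" "\<And>u. u \<in> set zs \<Longrightarrow> FImp H (a u) \<in> \<Gamma>"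
  shows "der \<Pi>' \<Gamma> (length zs + 1) {FImp H (FNot (head_var c zs))}"
  using assms(1,3)
proof (induction zs)
  case Nil
  have "der \<Pi>' \<Gamma> 1 {FImp H (FNot FBot)}"
    by (rule der_rule[where ps = "[]" and c = "FImp (Var 0) (FNot FBot)" and As = "[H]"])
      (use assms(2) in \<open>auto simp: bounded_sound_rules_def entails_def\<close>)
  then show ?case by simp
next
  case (Cons u zs)
  note ch = chain_Cons[OF Cons.prems(1)]
  obtain X where X: "good \<Pi>' X" "FIff (Var (c u)) (FOr (head_var c zs) (FAnd X (FNot (a u)))) \<in> \<Gamma>"
    using ch(4) by blast
  have "der \<Pi>' \<Gamma> (length zs + 1) {FImp H (FNot (head_var c zs))}"
    using Cons ch(1) by auto
  moreover have "der \<Pi>' (\<Gamma> \<union> {FImp H (FNot (head_var c zs))}) 1 {FImp H (FNot (head_var c (u # zs)))}"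
    by (rule der_rule[where ps = "[FImp (Var 0) (FNot (Var 1)), FImp (Var 0) (Var 2),
          FIff (Var 3) (FOr (Var 1) (FAnd (Var 4) (FNot (Var 2))))]" and c = "FImp (Var 0) (FNot (Var 3))"
          and As = "[H, head_var c zs, a u, Var (c u), X]"])
      (use X ch good_head_var[OF ch(1)] assms(2) Cons.prems in \<open>auto simp: bounded_sound_rules_def entails_def\<close>)
  ultimately show ?case by (rule der_step) simp
qed

text \<open>Commitments persist to the right, so their absence at the rightmost universal excludes
  all earlier ones.\<close>

lemma der_chain_down:
  assumes "chain \<Pi>' \<Gamma> c a zs" "good \<Pi>' H" "FImp H (FNot (head_var c zs)) \<in> \<Gamma>"
  shows "der \<Pi>' \<Gamma> (length zs) ((\<lambda>u. FImp H (FNot (Var (c u)))) ` set zs)"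
  using assms(1,3)
proof (induction zs arbitrary: \<Gamma>)
  case Nil
  show ?case by (simp add: der_refl)
next
  case (Cons u zs)
  note ch = chain_Cons[OF Cons.prems(1)]
  obtain X where X: "good \<Pi>' X" "FIff (Var (c u)) (FOr (head_var c zs) (FAnd X (FNot (a u)))) \<in> \<Gamma>"
    using ch(4) by blast
  have 1: "der \<Pi>' \<Gamma> 1 {FImp H (FNot (head_var c zs))}"
    by (rule der_rule[where ps = "[FImp (Var 0) (FNot (Var 3)),
          FIff (Var 3) (FOr (Var 1) (FAnd (Var 4) (FNot (Var 2))))]" and c = "FImp (Var 0) (FNot (Var 1))"
          and As = "[H, head_var c zs, a u, Var (c u), X]"])
      (use X ch good_head_var[OF ch(1)] assms(2) Cons.prems in \<open>auto simp: bounded_sound_rules_def entails_def\<close>)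
  have "der \<Pi>' (\<Gamma> \<union> {FImp H (FNot (head_var c zs))}) (length zs) ((\<lambda>u. FImp H (FNot (Var (c u)))) ` set zs)"
    by (rule Cons.IH) (use chain_mono[OF ch(1)] in auto)
  from der_step[OF 1 this order_refl]
  have "der \<Pi>' \<Gamma> (1 + length zs) ((\<lambda>u. FImp H (FNot (Var (c u)))) ` set zs)" .
  moreover have "der \<Pi>' \<Gamma> 0 {FImp H (FNot (Var (c u)))}"
    using Cons.prems by (intro der_refl) auto
  ultimately show ?case using der_Un by fastforce
qed

end

text \<open>\<open>strategy\<close> is also applied to \<open>c1\<close> and \<open>c2\<close>,
  which are no strategy, because it expresses that both lie left of their universal. Their
  definitions are not assumed here but in \<open>defined\<close>, as they are stated with constants
  of this locale.\<close>

locale irm_resolution = irm_simulation +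
  fixes \<Pi>' :: prefix and \<Gamma> :: "form set" and x :: var and \<tau> \<xi> \<sigma> :: xassign and C1 C2 :: aclause
    and s1 v1 s2 v2 c1 c2 s v :: "var \<Rightarrow> var"
  assumes str1: "strategy \<Pi>' s1 v1" and str2: "strategy \<Pi>' s2 v2" and str: "strategy \<Pi>' s v"
    and strc: "strategy \<Pi>' c1 c2"
    and wf1: "wf_aclause (insert (Pos x, \<tau> ++ \<xi>) C1)" and wf2: "wf_aclause (insert (Neg x, \<tau> ++ \<sigma>) C2)"
    and wf: "wf_aclause (inst \<Pi> \<sigma> C1 \<union> inst \<Pi> \<xi> C2)"
    and doms: "dom \<tau> \<inter> dom \<xi> = {}" "dom \<tau> \<inter> dom \<sigma> = {}" "dom \<xi> \<inter> dom \<sigma> = {}"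
    and ran: "ran \<tau> \<subseteq> range Const"
    and line1: "FImp (cons s1 v1) (clause_disj s1 v1 (insert (Pos x, \<tau> ++ \<xi>) C1)) \<in> \<Gamma>"
    and line2: "FImp (cons s2 v2) (clause_disj s2 v2 (insert (Neg x, \<tau> ++ \<sigma>) C2)) \<in> \<Gamma>"
begin

text \<open>The strategy for the resolvent follows both given strategies as long as they produce the
  annotations of the pivot literals. It commits to the first (\<open>c1\<close>) or second (\<open>c2\<close>) one as soon as
  that one deviates from its annotation and, if neither deviates, according to the value of the
  pivot \<open>x\<close>. As \<open>us\<close> is sorted from right to left, the variables for the preceding universal
  are at the head of the remaining list.\<close>

definition a1 :: "var \<Rightarrow> form" where
  "a1 u = (if lev \<Pi> u < lev \<Pi> x then ann_form (Var (s1 u)) (Var (v1 u)) (or_else (\<xi> u) (\<tau> u)) else Var x)"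

text \<open>Right of the pivot, its value takes the place of the annotation. One of \<open>x\<close>
  and its negation fails, so a commitment is made at the first such universal at the latest.\<close>

definition a2 :: "var \<Rightarrow> form" where
  "a2 u = (if lev \<Pi> u < lev \<Pi> x then ann_form (Var (s2 u)) (Var (v2 u)) (or_else (\<sigma> u) (\<tau> u)) else FNot (Var x))"

definition def1 :: "var \<Rightarrow> var list \<Rightarrow> form" where
  "def1 u rest = FOr (head_var c1 rest) (FAnd (FNot (head_var c2 rest)) (FNot (a1 u)))"

text \<open>The asymmetry resolves ties: \<open>def1\<close> consults \<open>c2\<close> at the
  preceding universal, but \<open>def2\<close> consults \<open>c1\<close> at \<open>u\<close>
  itself. If both strategies deviate at once, the first premise wins, and the commitments exclude
  each other.\<close>

definition def2 :: "var \<Rightarrow> var list \<Rightarrow> form" where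
  "def2 u rest = FOr (head_var c2 rest) (FAnd (FNot (Var (c1 u))) (FNot (a2 u)))"

definition defs :: "var \<Rightarrow> form" where
  "defs u = set_form (Var (c1 u)) (Var (c2 u)) (Var (s1 u)) (Var (s2 u)) (\<xi> u) (\<sigma> u)"

definition defv :: "var \<Rightarrow> form" where
  "defv u = val_form (Var (c1 u)) (Var (c2 u)) (Var (s1 u)) (Var (v1 u)) (Var (s2 u)) (Var (v2 u)) (\<xi> u) (\<sigma> u)"

definition defined :: bool where
  "defined \<longleftrightarrow> (\<forall>zs u rest. us = zs @ u # rest \<longrightarrow> FIff (Var (c1 u)) (def1 u rest) \<in> \<Gamma> \<and>
       FIff (Var (c2 u)) (def2 u rest) \<in> \<Gamma>) \<and>
     (\<forall>u\<in>set us. FIff (Var (s u)) (defs u) \<in> \<Gamma> \<and> FIff (Var (v u)) (defv u) \<in> \<Gamma>)"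

text \<open>The final decision for the first premise. If \<open>us\<close> contains no universal
  right of the pivot, the chains may end without a commitment, and the value of the pivot
  decides.\<close>

definition B :: form where
  "B = FOr (head_var c1 us) (FAnd (FNot (head_var c2 us)) (FNot (Var x)))"

lemma definedD:
  assumes defined
  shows "us = zs @ u # rest \<Longrightarrow> FIff (Var (c1 u)) (def1 u rest) \<in> \<Gamma>"
    "us = zs @ u # rest \<Longrightarrow> FIff (Var (c2 u)) (def2 u rest) \<in> \<Gamma>"
    "u \<in> set us \<Longrightarrow> FIff (Var (s u)) (defs u) \<in> \<Gamma>"
    "u \<in> set us \<Longrightarrow> FIff (Var (v u)) (defv u) \<in> \<Gamma>"
  using assms unfolding defined_def by blast+

lemma x_existential: "x \<in> existentials \<Pi>"
  using wf_aclause_lvar[OF wf1, of "Pos x" "\<tau> ++ \<xi>"] by simp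

lemma x_vars: "x \<in> prefix_vars \<Pi>'"
  using strategy_existentials[OF str x_existential] .

text \<open>These are the side conditions of the resolution schemata. The last one holds because
  \<tau>, \<xi> and \<sigma> are parts of the pivot annotations, which live left of the
  pivot.\<close>

lemma assign_cases:
  assumes "u \<in> set us"
  shows "\<tau> u = None \<or> (\<xi> u = None \<and> \<sigma> u = None \<and> \<tau> u \<noteq> Some Star)" "\<xi> u = None \<or> \<sigma> u = None"
    "\<not> lev \<Pi> u < lev \<Pi> x \<Longrightarrow> \<tau> u = None \<and> \<xi> u = None \<and> \<sigma> u = None"
proof -
  have "\<tau> u \<noteq> Some Star" using ran by (force simp: ran_def)
  then show "\<tau> u = None \<or> (\<xi> u = None \<and> \<sigma> u = None \<and> \<tau> u \<noteq> Some Star)" "\<xi> u = None \<or> \<sigma> u = None"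
    using doms by (auto simp: domIff disjoint_iff)
  assume "\<not> lev \<Pi> u < lev \<Pi> x"
  moreover have "dom (\<tau> ++ \<xi>) \<subseteq> {u. lev \<Pi> u < lev \<Pi> x}" "dom (\<tau> ++ \<sigma>) \<subseteq> {u. lev \<Pi> u < lev \<Pi> x}"
    using wf1 wf2 unfolding wf_aclause_def by auto
  ultimately show "\<tau> u = None \<and> \<xi> u = None \<and> \<sigma> u = None"
    by (auto simp: domIff subset_iff)
qed

lemma good_ann_form: "strategy \<Pi>' f g \<Longrightarrow> u \<in> set us \<Longrightarrow> good \<Pi>' (ann_form (Var (f u)) (Var (g u)) a)"
  using strategy_vars[of \<Pi>' f g u] fvars_ann_form_subset[of "Var (f u)" "Var (g u)" a]
    fsize_ann_form_le[of "Var (f u)" "Var (g u)" a] N_le_M(1)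
  unfolding good_def by auto

lemma good_a: "u \<in> set us \<Longrightarrow> good \<Pi>' (a1 u)" "u \<in> set us \<Longrightarrow> good \<Pi>' (a2 u)"
  using good_ann_form[OF str1] good_ann_form[OF str2] good_Var[OF x_vars] x_vars N_le_M(1)
  by (auto simp: a1_def a2_def good_def)

lemma good_heads: "set zs \<subseteq> set us \<Longrightarrow> good \<Pi>' (head_var c1 zs)" "set zs \<subseteq> set us \<Longrightarrow> good \<Pi>' (head_var c2 zs)"
  using good_strategy[OF strc] by (cases zs; auto)+

lemma good_B: "good \<Pi>' B" "good \<Pi>' (FNot B)"
proof -
  have "fsize (head_var c zs) = 1" for c zs by (cases zs) auto
  then show "good \<Pi>' B" "good \<Pi>' (FNot B)"
    using good_heads[of us] x_vars N_le_M(1) unfolding good_def B_def by auto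
qed

lemma chains:
  assumes defined
  shows "chain \<Pi>' \<Gamma> c1 a1 us" "chain \<Pi>' \<Gamma> c2 a2 us"
proof -
  have nots: "good \<Pi>' (FNot (head_var c2 rest))" "good \<Pi>' (FNot (Var (c1 u)))"
    if "us = ys @ u # rest" for ys u rest
  proof -
    have "fsize (head_var c2 rest) = 1" by (cases rest) auto
    then show "good \<Pi>' (FNot (head_var c2 rest))" "good \<Pi>' (FNot (Var (c1 u)))"
      using good_heads(2)[of rest] good_strategy(1)[OF strc, of u] that N_le_M(1) by (auto simp: good_def)
  qed
  show "chain \<Pi>' \<Gamma> c1 a1 us"
    unfolding chain_def
  proof (intro allI impI)
    fix ys u rest assume us: "us = ys @ u # rest"
    then have "u \<in> set us" "FIff (Var (c1 u)) (def1 u rest) \<in> \<Gamma>"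
      using definedD(1)[OF assms us] by auto
    then show "good \<Pi>' (Var (c1 u)) \<and> good \<Pi>' (a1 u) \<and>
     (\<exists>X. good \<Pi>' X \<and> FIff (Var (c1 u)) (FOr (head_var c1 rest) (FAnd X (FNot (a1 u)))) \<in> \<Gamma>)"
      using good_strategy[OF strc] good_a nots[OF us] unfolding def1_def by blast
  qed
  show "chain \<Pi>' \<Gamma> c2 a2 us"
    unfolding chain_def
  proof (intro allI impI)
    fix ys u rest assume us: "us = ys @ u # rest"
    then have "u \<in> set us" "FIff (Var (c2 u)) (def2 u rest) \<in> \<Gamma>"
      using definedD(2)[OF assms us] by auto
    then show "good \<Pi>' (Var (c2 u)) \<and> good \<Pi>' (a2 u) \<and>
     (\<exists>X. good \<Pi>' X \<and> FIff (Var (c2 u)) (FOr (head_var c2 rest) (FAnd X (FNot (a2 u)))) \<in> \<Gamma>)"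
      using good_strategy[OF strc] good_a nots[OF us] unfolding def2_def by blast
  qed
qed

section \<open>The two cases of a resolution step\<close>

definition excl :: "var list \<Rightarrow> form" where
  "excl zs = FNot (FAnd (head_var c1 zs) (head_var c2 zs))"

lemma der_excl:
  assumes defined "us = ys @ zs"
  shows "der \<Pi>' \<Gamma> (length zs + 1) {excl zs}"
  using assms(2)
proof (induction zs arbitrary: ys)
  case Nil
  have "der \<Pi>' \<Gamma> 1 {FNot (FAnd FBot FBot)}"
    by (rule der_rule[where ps = "[]" and c = "FNot (FAnd FBot FBot)" and As = "[]"])
      (auto simp: bounded_sound_rules_def entails_def)
  then show ?case by (simp add: excl_def)
next
  case (Cons u zs)
  have u: "u \<in> set us" and defs: "FIff (Var (c1 u)) (def1 u zs) \<in> \<Gamma>" "FIff (Var (c2 u)) (def2 u zs) \<in> \<Gamma>"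
    and zs: "set zs \<subseteq> set us"
    using definedD(1,2)[OF assms(1) Cons.prems] Cons.prems by auto
  have "der \<Pi>' \<Gamma> (length zs + 1) {excl zs}"
    by (rule Cons.IH[of "ys @ [u]"]) (use Cons.prems in simp)
  moreover have "der \<Pi>' (\<Gamma> \<union> {excl zs}) 1 {excl (u # zs)}"
    by (rule der_rule[where ps = "[FNot (FAnd (Var 0) (Var 1)),
          FIff (Var 2) (FOr (Var 0) (FAnd (FNot (Var 1)) (FNot (Var 4)))),
          FIff (Var 3) (FOr (Var 1) (FAnd (FNot (Var 2)) (FNot (Var 5))))]"
          and c = "FNot (FAnd (Var 2) (Var 3))"
          and As = "[head_var c1 zs, head_var c2 zs, Var (c1 u), Var (c2 u), a1 u, a2 u]"])
      (use defs good_heads[OF zs] good_strategy[OF strc u] good_a[OF u] in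
        \<open>auto simp: bounded_sound_rules_def entails_def excl_def def1_def def2_def\<close>)
  ultimately show ?case by (rule der_step) simp
qed

text \<open>\<open>B\<close> rules out a commitment to the second premise at the rightmost
  universal, by exclusion if there is one to the first. Persistence extends this to all
  others.\<close>

lemma der_not_c2:
  assumes defined
  shows "der \<Pi>' \<Gamma> (2 * N + 2) ((\<lambda>u. FImp B (FNot (Var (c2 u)))) ` set us)"
proof -
  note h = good_heads[OF subset_refl]
  have 1: "der \<Pi>' (\<Gamma> \<union> {excl us}) 1 {FImp B (FNot (head_var c2 us))}"
    by (rule der_rule[where ps = "[FNot (FAnd (Var 0) (Var 1))]"
          and c = "FImp (FOr (Var 0) (FAnd (FNot (Var 1)) (FNot (Var 2)))) (FNot (Var 1))"
          and As = "[head_var c1 us, head_var c2 us, Var x]"])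
      (use h good_Var[OF x_vars] in \<open>auto simp: bounded_sound_rules_def entails_def excl_def B_def\<close>)
  have 2: "der \<Pi>' (\<Gamma> \<union> {FImp B (FNot (head_var c2 us))}) (length us) ((\<lambda>u. FImp B (FNot (Var (c2 u)))) ` set us)"
    by (rule der_chain_down) (use chain_mono[OF chains(2)[OF assms]] good_B in auto)
  show ?thesis
    by (rule der_step[OF der_step[OF der_excl[OF assms, of "[]"] 1 order_refl] 2]) (use length_us in auto)
qed

lemma der_not_c1:
  assumes defined
  shows "der \<Pi>' \<Gamma> (N + 1) ((\<lambda>u. FImp (FNot B) (FNot (Var (c1 u)))) ` set us)"
proof -
  note h = good_heads[OF subset_refl]
  have 1: "der \<Pi>' \<Gamma> 1 {FImp (FNot B) (FNot (head_var c1 us))}"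
    by (rule der_rule[where ps = "[]"
          and c = "FImp (FNot (FOr (Var 0) (FAnd (FNot (Var 1)) (FNot (Var 2))))) (FNot (Var 0))"
          and As = "[head_var c1 us, head_var c2 us, Var x]"])
      (use h good_Var[OF x_vars] in \<open>auto simp: bounded_sound_rules_def entails_def B_def\<close>)
  have 2: "der \<Pi>' (\<Gamma> \<union> {FImp (FNot B) (FNot (head_var c1 us))}) (length us)
      ((\<lambda>u. FImp (FNot B) (FNot (Var (c1 u)))) ` set us)"
    by (rule der_chain_down) (use chain_mono[OF chains(1)[OF assms]] good_B in auto)
  show ?thesis
    by (rule der_step[OF 1 2]) (use length_us in auto)
qed

lemma der_pivot_ann:
  assumes str': "strategy \<Pi>' f g" and l: "lvar l = x" and u: "u \<in> set us"
    and a: "a u = (if lev \<Pi> u < lev \<Pi> x then ann_form (Var (f u)) (Var (g u)) (\<alpha> u) else lit_form l)"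
  shows "der \<Pi>' \<Gamma> (N + 1) {FImp (alit_form f g (l, \<alpha>)) (a u)}"
proof -
  have gl: "good \<Pi>' (lit_form l)" "good \<Pi>' (ann f g l \<alpha>)" "good \<Pi>' (a u)"
    using good_lit[of l] x_vars l good_ann[OF str'] good_ann_form[OF str' u] a by auto
  show ?thesis
  proof (cases "lev \<Pi> u < lev \<Pi> x")
    case True
    have 1: "der \<Pi>' \<Gamma> N {FImp (ann f g l \<alpha>) (a u)}"
      unfolding ann_def
      by (rule der_mono[OF der_conjs_elim[where x = "a u"]])
        (use gl u True l a in \<open>auto simp: ann_def length_filter_us\<close>)
    have 2: "der \<Pi>' (\<Gamma> \<union> {FImp (ann f g l \<alpha>) (a u)}) 1 {FImp (alit_form f g (l, \<alpha>)) (a u)}"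
      unfolding alit_form_def fst_conv snd_conv
      by (rule der_rule[where ps = "[FImp (Var 0) (Var 1)]" and c = "FImp (FAnd (Var 2) (Var 0)) (Var 1)"
            and As = "[ann f g l \<alpha>, a u, lit_form l]"])
        (use gl in \<open>auto simp: bounded_sound_rules_def entails_def\<close>)
    show ?thesis by (rule der_step[OF 1 2]) simp
  next
    case False
    have "der \<Pi>' \<Gamma> 1 {FImp (alit_form f g (l, \<alpha>)) (a u)}"
      unfolding alit_form_def fst_conv snd_conv
      by (rule der_rule[where ps = "[]" and c = "FImp (FAnd (Var 0) (Var 1)) (Var 0)"
            and As = "[lit_form l, ann f g l \<alpha>]"])
        (use gl False a in \<open>auto simp: bounded_sound_rules_def entails_def\<close>)
    then show ?thesis by (rule der_mono) auto
  qed
qed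

lemma der_pivot_chain:
  assumes str': "strategy \<Pi>' f g" and l: "lvar l = x" and ch: "chain \<Pi>' \<Gamma> c a us"
    and a: "\<And>u. a u = (if lev \<Pi> u < lev \<Pi> x then ann_form (Var (f u)) (Var (g u)) (\<alpha> u) else lit_form l)"
  shows "der \<Pi>' \<Gamma> (N * (N + 1) + (N + 1)) {FImp (alit_form f g (l, \<alpha>)) (FNot (head_var c us))}"
proof -
  let ?S = "(\<lambda>u. FImp (alit_form f g (l, \<alpha>)) (a u)) ` set us"
  have 1: "der \<Pi>' \<Gamma> (N * (N + 1)) ?S"
  proof (rule der_image[where n = "N + 1"])
    show "der \<Pi>' \<Gamma> (N + 1) {FImp (alit_form f g (l, \<alpha>)) (a u)}" if "u \<in> set us" for u
      by (rule der_pivot_ann[where a = a and f = f and g = g and l = l and \<alpha> = \<alpha>, OF str' l that a])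
  qed (use card_us in \<open>auto intro!: mult_right_mono simp del: mult_Suc_right\<close>)
  have 2: "der \<Pi>' (\<Gamma> \<union> ?S) (length us + 1) {FImp (alit_form f g (l, \<alpha>)) (FNot (head_var c us))}"
    by (rule der_chain_false) (use chain_mono[OF ch] good_alit_form[OF str'] l x_vars in auto)
  show ?thesis by (rule der_step[OF 1 2]) (use length_us in auto)
qed

text \<open>If the annotated pivot literal is true, the first strategy never deviates, not even
  right of the pivot, where the literal itself counts as the annotation. So there is no commitment
  to the first premise, and \<open>B\<close> makes \<open>x\<close> false, against the
  literal.\<close>

lemma der_pivot1:
  assumes defined
  shows "der \<Pi>' \<Gamma> (N * (N + 1) + N + 2) {FImp (FAnd B (alit_form s1 v1 (Pos x, \<tau> ++ \<xi>))) FBot}"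
proof -
  let ?H = "alit_form s1 v1 (Pos x, \<tau> ++ \<xi>)"
  have 1: "der \<Pi>' \<Gamma> (N * (N + 1) + (N + 1)) {FImp ?H (FNot (head_var c1 us))}"
    by (rule der_pivot_chain[OF str1 _ chains(1)[OF assms]])
      (auto simp: a1_def map_add_def split: option.splits)
  have 2: "der \<Pi>' (\<Gamma> \<union> {FImp ?H (FNot (head_var c1 us))}) 1 {FImp (FAnd B ?H) FBot}"
    unfolding alit_form_def fst_conv snd_conv
    by (rule der_rule[where ps = "[FImp (FAnd (Var 2) (Var 3)) (FNot (Var 0))]"
          and c = "FImp (FAnd (FOr (Var 0) (FAnd (FNot (Var 1)) (FNot (Var 2)))) (FAnd (Var 2) (Var 3))) FBot"
          and As = "[head_var c1 us, head_var c2 us, Var x, ann s1 v1 (Pos x) (\<tau> ++ \<xi>)]"])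
      (use good_heads[OF subset_refl] good_Var[OF x_vars] good_ann[OF str1] in
        \<open>auto simp: bounded_sound_rules_def entails_def B_def\<close>)
  show ?thesis by (rule der_step[OF 1 2]) simp
qed

lemma der_pivot2:
  assumes defined
  shows "der \<Pi>' \<Gamma> (N * (N + 1) + N + 2) {FImp (FAnd (FNot B) (alit_form s2 v2 (Neg x, \<tau> ++ \<sigma>))) FBot}"
proof -
  let ?H = "alit_form s2 v2 (Neg x, \<tau> ++ \<sigma>)"
  have 1: "der \<Pi>' \<Gamma> (N * (N + 1) + (N + 1)) {FImp ?H (FNot (head_var c2 us))}"
    by (rule der_pivot_chain[OF str2 _ chains(2)[OF assms]])
      (auto simp: a2_def map_add_def split: option.splits)
  have 2: "der \<Pi>' (\<Gamma> \<union> {FImp ?H (FNot (head_var c2 us))}) 1 {FImp (FAnd (FNot B) ?H) FBot}"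
    unfolding alit_form_def fst_conv snd_conv
    by (rule der_rule[where ps = "[FImp (FAnd (FNot (Var 2)) (Var 3)) (FNot (Var 1))]"
          and c = "FImp (FAnd (FNot (FOr (Var 0) (FAnd (FNot (Var 1)) (FNot (Var 2))))) (FAnd (FNot (Var 2)) (Var 3))) FBot"
          and As = "[head_var c1 us, head_var c2 us, Var x, ann s2 v2 (Neg x) (\<tau> ++ \<sigma>)]"])
      (use good_heads[OF subset_refl] good_Var[OF x_vars] good_ann[OF str2] in
        \<open>auto simp: bounded_sound_rules_def entails_def B_def\<close>)
  show ?thesis by (rule der_step[OF 1 2]) simp
qed

definition neither :: "var \<Rightarrow> form" where
  "neither u = FImp (FAnd (FNot (Var (c1 u))) (FNot (Var (c2 u)))) (FAnd (a1 u) (a2 u))"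

text \<open>No commitment at \<open>u\<close> means none before either, so an annotation failing at
  \<open>u\<close> would have caused one.\<close>

lemma der_neither:
  assumes defined
  shows "der \<Pi>' \<Gamma> N (neither ` set us)"
proof (rule der_image[where n = 1])
  fix u assume u: "u \<in> set us"
  then obtain ys zs where us: "us = ys @ u # zs" by (meson split_list)
  have defs: "FIff (Var (c1 u)) (def1 u zs) \<in> \<Gamma>" "FIff (Var (c2 u)) (def2 u zs) \<in> \<Gamma>"
    and zs: "set zs \<subseteq> set us"
    using definedD(1,2)[OF assms us] us by auto
  show "der \<Pi>' \<Gamma> 1 {neither u}"
    by (rule der_rule[where ps = "[FIff (Var 2) (FOr (Var 0) (FAnd (FNot (Var 1)) (FNot (Var 4)))),
          FIff (Var 3) (FOr (Var 1) (FAnd (FNot (Var 2)) (FNot (Var 5))))]"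
          and c = "FImp (FAnd (FNot (Var 2)) (FNot (Var 3))) (FAnd (Var 4) (Var 5))"
          and As = "[head_var c1 zs, head_var c2 zs, Var (c1 u), Var (c2 u), a1 u, a2 u]"])
      (use defs good_heads[OF zs] good_strategy[OF strc u] good_a[OF u] in
        \<open>auto simp: bounded_sound_rules_def entails_def neither_def def1_def def2_def\<close>)
qed (use card_us in auto)

definition facts :: "form set" where
  "facts = \<Gamma> \<union> neither ` set us \<union> (\<lambda>u. FImp B (FNot (Var (c2 u)))) ` set us
     \<union> (\<lambda>u. FImp (FNot B) (FNot (Var (c1 u)))) ` set us
     \<union> {FImp (FAnd B (alit_form s1 v1 (Pos x, \<tau> ++ \<xi>))) FBot,
        FImp (FAnd (FNot B) (alit_form s2 v2 (Neg x, \<tau> ++ \<sigma>))) FBot}"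

lemma der_facts:
  assumes defined
  shows "der \<Pi>' \<Gamma> (10 * (N + 1) ^ 2) facts"
proof -
  have "facts = \<Gamma> \<union> (neither ` set us \<union> ((\<lambda>u. FImp B (FNot (Var (c2 u)))) ` set us
     \<union> ((\<lambda>u. FImp (FNot B) (FNot (Var (c1 u)))) ` set us
     \<union> ({FImp (FAnd B (alit_form s1 v1 (Pos x, \<tau> ++ \<xi>))) FBot} \<union>
        {FImp (FAnd (FNot B) (alit_form s2 v2 (Neg x, \<tau> ++ \<sigma>))) FBot}))))"
    unfolding facts_def by blast
  moreover have "der \<Pi>' \<Gamma> (0 + (N + ((2 * N + 2) + ((N + 1) + ((N * (N + 1) + N + 2) + (N * (N + 1) + N + 2))))))
      (\<Gamma> \<union> (neither ` set us \<union> ((\<lambda>u. FImp B (FNot (Var (c2 u)))) ` set us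
     \<union> ((\<lambda>u. FImp (FNot B) (FNot (Var (c1 u)))) ` set us
     \<union> ({FImp (FAnd B (alit_form s1 v1 (Pos x, \<tau> ++ \<xi>))) FBot} \<union>
        {FImp (FAnd (FNot B) (alit_form s2 v2 (Neg x, \<tau> ++ \<sigma>))) FBot})))))"
    by (rule der_Un[OF der_refl[OF subset_refl] der_Un[OF der_neither[OF assms] der_Un[OF der_not_c2[OF assms]
      der_Un[OF der_not_c1[OF assms] der_Un[OF der_pivot1[OF assms] der_pivot2[OF assms]]]]]])
  ultimately have "der \<Pi>' \<Gamma> (0 + (N + ((2 * N + 2) + ((N + 1) + ((N * (N + 1) + N + 2) + (N * (N + 1) + N + 2)))))) facts"
    by (simp only:)
  then show ?thesis
    by (rule der_mono) (auto simp: power2_eq_square algebra_simps)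
qed

lemma side_rule:
  assumes defined "u \<in> set us" "(h # resolution_premises (\<tau> u) (\<xi> u) (\<sigma> u) (lev \<Pi> u < lev \<Pi> x), c) \<in> bounded_sound_rules"
    "subst (list_subst [Var (c1 u), Var (c2 u), Var (s1 u), Var (v1 u), Var (s2 u), Var (v2 u),
       Var (s u), Var (v u), B, Var x, Var u]) h \<in> facts"
  shows "der \<Pi>' facts 1 {subst (list_subst [Var (c1 u), Var (c2 u), Var (s1 u), Var (v1 u), Var (s2 u), Var (v2 u),
       Var (s u), Var (v u), B, Var x, Var u]) c}"
proof (rule der_rule[OF assms(3)])
  have "neither u \<in> facts" using assms(2) by (auto simp: facts_def)
  moreover have "FIff (Var (s u)) (defs u) \<in> facts" "FIff (Var (v u)) (defv u) \<in> facts"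
    using definedD(3,4)[OF assms(1,2)] by (auto simp: facts_def)
  ultimately show "subst (list_subst [Var (c1 u), Var (c2 u), Var (s1 u), Var (v1 u), Var (s2 u), Var (v2 u),
       Var (s u), Var (v u), B, Var x, Var u]) `
      set (h # resolution_premises (\<tau> u) (\<xi> u) (\<sigma> u) (lev \<Pi> u < lev \<Pi> x)) \<subseteq> facts"
    using assms(4) by (auto simp: resolution_premises_def neither_def a1_def a2_def defs_def defv_def)
qed (use good_strategy[OF str1 assms(2)] good_strategy[OF str2 assms(2)] good_strategy[OF str assms(2)]
      good_strategy[OF strc assms(2)] good_B good_Var[OF x_vars] in auto)

lemmas rules_sound = resolution_rule_cons1[OF assign_cases] resolution_rule_cons2[OF assign_cases]
  resolution_rule_ann1[OF assign_cases] resolution_rule_ann2[OF assign_cases]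

lemma der_sides:
  assumes defined
  shows "der \<Pi>' facts N ((\<lambda>u. FImp (FAnd B (cons_form s v u)) (cons_form s1 v1 u)) ` set us)" (is ?A)
    "der \<Pi>' facts N ((\<lambda>u. FImp (FAnd (FNot B) (cons_form s v u)) (cons_form s2 v2 u)) ` set us)" (is ?B)
    "der \<Pi>' facts (4 * N) ((\<lambda>(u, a). FImp (FAnd B (ann_form (Var (s1 u)) (Var (v1 u)) a))
       (ann_form (Var (s u)) (Var (v u)) (or_else a (\<sigma> u)))) ` (set us \<times> annots))" (is ?C)
    "der \<Pi>' facts (4 * N) ((\<lambda>(u, a). FImp (FAnd (FNot B) (ann_form (Var (s2 u)) (Var (v2 u)) a))
       (ann_form (Var (s u)) (Var (v u)) (or_else a (\<xi> u)))) ` (set us \<times> annots))" (is ?D)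
proof -
  have h: "FImp B (FNot (Var (c2 u))) \<in> facts" "FImp (FNot B) (FNot (Var (c1 u))) \<in> facts" if "u \<in> set us" for u
    using that by (auto simp: facts_def)
  have c: "card (set us) * 1 \<le> N" "card (set us \<times> annots) * 1 \<le> 4 * N"
    using card_us by (auto simp: card_cartesian_product)
  show ?A
    by (rule der_image[OF _ c(1)])
      (use side_rule[OF assms _ rules_sound(1)] h in \<open>auto simp: cons_form_def\<close>)
  show ?B
    by (rule der_image[OF _ c(1)])
      (use side_rule[OF assms _ rules_sound(2)] h in \<open>auto simp: cons_form_def\<close>)
  show ?C
    by (rule der_image[OF _ c(2)])
      (use side_rule[OF assms _ rules_sound(3)] h in auto)
  show ?D
    by (rule der_image[OF _ c(2)])
      (use side_rule[OF assms _ rules_sound(4)] h in auto)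
qed

text \<open>Under \<open>B\<close> the line of the first premise is transported, with \<sigma>
  completing its annotations, and its pivot literal is impossible. Under the negation of
  \<open>B\<close> the same happens to the second premise with \<xi>.\<close>

lemma der_resolve:
  assumes defined
  shows "der \<Pi>' \<Gamma> (40 * (N + 1) ^ 2)
    {FImp (cons s v) (clause_disj s v (inst \<Pi> \<sigma> C1 \<union> inst \<Pi> \<xi> C2))}"
proof -
  let ?D' = "inst \<Pi> \<sigma> C1 \<union> inst \<Pi> \<xi> C2"
  let ?E = "clause_disj s v ?D'"
  let ?A = "(\<lambda>u. FImp (FAnd B (cons_form s v u)) (cons_form s1 v1 u)) ` set us"
  let ?B = "(\<lambda>u. FImp (FAnd (FNot B) (cons_form s v u)) (cons_form s2 v2 u)) ` set us"
  let ?C = "(\<lambda>(u, a). FImp (FAnd B (ann_form (Var (s1 u)) (Var (v1 u)) a))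
       (ann_form (Var (s u)) (Var (v u)) (or_else a (\<sigma> u)))) ` (set us \<times> annots)"
  let ?D = "(\<lambda>(u, a). FImp (FAnd (FNot B) (ann_form (Var (s2 u)) (Var (v2 u)) a))
       (ann_form (Var (s u)) (Var (v u)) (or_else a (\<xi> u)))) ` (set us \<times> annots)"
  have 1: "der \<Pi>' (facts \<union> (?A \<union> ?C)) (5 * (N + 1) ^ 2) {FImp (FAnd B (cons s v)) ?E}"
  proof (rule der_transfer[OF str1 str wf1 wf good_B(1)])
    fix l \<rho> assume l: "(l, \<rho>) \<in> insert (Pos x, \<tau> ++ \<xi>) C1"
    show "FImp (FAnd B (alit_form s1 v1 (l, \<rho>))) FBot \<in> facts \<union> (?A \<union> ?C) \<or>
      (\<exists>\<rho>'. (l, \<rho>') \<in> ?D' \<and> (\<forall>u\<in>set us. lev \<Pi> u < lev \<Pi> (lvar l) \<longrightarrow>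
         FImp (FAnd B (ann_form (Var (s1 u)) (Var (v1 u)) (\<rho> u)))
           (ann_form (Var (s u)) (Var (v u)) (\<rho>' u)) \<in> facts \<union> (?A \<union> ?C)))"
    proof (cases "(l, \<rho>) \<in> C1")
      case True
      then show ?thesis
        by (intro disjI2 exI[of _ "restrict_ann \<Pi> l (completion \<rho> \<sigma>)"] conjI ballI impI)
          (force simp: inst_def, force simp: restrict_ann_def completion_or_else image_iff)
    qed (use l in \<open>auto simp: facts_def\<close>)
  qed (use line1 in \<open>auto simp: facts_def\<close>)
  have 2: "der \<Pi>' (facts \<union> (?B \<union> ?D)) (5 * (N + 1) ^ 2) {FImp (FAnd (FNot B) (cons s v)) ?E}"
  proof (rule der_transfer[OF str2 str wf2 wf good_B(2)])
    fix l \<rho> assume l: "(l, \<rho>) \<in> insert (Neg x, \<tau> ++ \<sigma>) C2"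
    show "FImp (FAnd (FNot B) (alit_form s2 v2 (l, \<rho>))) FBot \<in> facts \<union> (?B \<union> ?D) \<or>
      (\<exists>\<rho>'. (l, \<rho>') \<in> ?D' \<and> (\<forall>u\<in>set us. lev \<Pi> u < lev \<Pi> (lvar l) \<longrightarrow>
         FImp (FAnd (FNot B) (ann_form (Var (s2 u)) (Var (v2 u)) (\<rho> u)))
           (ann_form (Var (s u)) (Var (v u)) (\<rho>' u)) \<in> facts \<union> (?B \<union> ?D)))"
    proof (cases "(l, \<rho>) \<in> C2")
      case True
      then show ?thesis
        by (intro disjI2 exI[of _ "restrict_ann \<Pi> l (completion \<rho> \<xi>)"] conjI ballI impI)
          (force simp: inst_def, force simp: restrict_ann_def completion_or_else image_iff)
    qed (use l in \<open>auto simp: facts_def\<close>)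
  qed (use line2 in \<open>auto simp: facts_def\<close>)
  have 3: "der \<Pi>' (facts \<union> ({FImp (FAnd B (cons s v)) ?E} \<union> {FImp (FAnd (FNot B) (cons s v)) ?E})) 1
      {FImp (cons s v) ?E}"
    by (rule der_rule[where ps = "[FImp (FAnd (Var 0) (Var 1)) (Var 2), FImp (FAnd (FNot (Var 0)) (Var 1)) (Var 2)]"
          and c = "FImp (Var 1) (Var 2)" and As = "[B, cons s v, ?E]"])
      (use good_B good_cons[OF str] good_clause_disj[OF str wf] in
        \<open>auto simp: bounded_sound_rules_def entails_def\<close>)
  note sides = der_sides[OF assms]
  have 4: "der \<Pi>' facts ((N + 4 * N + 5 * (N + 1) ^ 2) + (N + 4 * N + 5 * (N + 1) ^ 2))
      ({FImp (FAnd B (cons s v)) ?E} \<union> {FImp (FAnd (FNot B) (cons s v)) ?E})"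
    by (rule der_Un[OF der_step[OF der_Un[OF sides(1,3)] 1 order_refl] der_step[OF der_Un[OF sides(2,4)] 2 order_refl]])
  have 5: "der \<Pi>' facts (20 * (N + 1) ^ 2 + 1) {FImp (cons s v) ?E}"
    by (rule der_step[OF 4 3]) (auto simp: power2_eq_square algebra_simps)
  have "\<Gamma> \<union> facts = facts" by (auto simp: facts_def)
  with 5 show ?thesis
    by (intro der_step[OF der_facts[OF assms]]) (auto simp: power2_eq_square algebra_simps)
qed

end

section \<open>Simulating derivations\<close>

context irm_simulation
begin

section \<open>Introducing the extension variables\<close>

lemma us_in_prefix: "prefix_ext \<Pi> \<Pi>' \<Longrightarrow> u \<in> set us \<Longrightarrow> u \<in> prefix_vars \<Pi>'"
  using us_universal universals_subset prefix_ext_vars by blast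

lemma left_of_us_mono:
  assumes "prefix_ext \<Pi> \<Pi>'" "u \<in> set us" "w \<in> set us" "lev \<Pi> w < lev \<Pi> u"
  shows "left_of \<Pi>' w \<subseteq> left_of \<Pi>' u" "w \<in> left_of \<Pi>' u"
proof -
  have "lev \<Pi>' w < lev \<Pi>' u"
    using assms us_universal universals_subset unfolding prefix_ext_def by blast
  then show "left_of \<Pi>' w \<subseteq> left_of \<Pi>' u" "w \<in> left_of \<Pi>' u"
    using us_in_prefix[OF assms(1,3)] by (auto simp: left_of_def)
qed

lemma distinct_us: "distinct us"
  using us_sorted by (induction us) auto

text \<open>The definitions use only variables that exist beforehand, so the new variables do not
  depend on each other, and later insertions keep earlier ones left of their universals.\<close>

lemma extend_family:
  assumes "efrege_derivation \<F> \<Pi> \<phi> \<Pi>' Ls" "prefix_ext \<Pi> \<Pi>'" "set zs \<subseteq> set us" "distinct zs"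
    "\<And>u. u \<in> set zs \<Longrightarrow> fvars (f u) \<subseteq> left_of \<Pi>' u \<and> fsize (f u) \<le> m"
  shows "\<exists>\<Pi>'' Ls' s. efrege_derivation \<F> \<Pi> \<phi> \<Pi>'' (Ls @ Ls') \<and> prefix_ext \<Pi>' \<Pi>'' \<and>
    (\<forall>u\<in>set zs. s u \<in> left_of \<Pi>'' u \<and> FIff (Var (s u)) (f u) \<in> set Ls') \<and>
    efrege_size Ls' \<le> length zs * (m + 2)"
  using assms(3-5)
proof (induction zs)
  case Nil
  show ?case
    by (intro exI[of _ \<Pi>'] exI[of _ "[]"]) (use assms in auto)
next
  case (Cons u zs)
  then obtain \<Pi>1 L1 s where 1: "efrege_derivation \<F> \<Pi> \<phi> \<Pi>1 (Ls @ L1)" "prefix_ext \<Pi>' \<Pi>1"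
    "\<forall>u\<in>set zs. s u \<in> left_of \<Pi>1 u \<and> FIff (Var (s u)) (f u) \<in> set L1"
    "efrege_size L1 \<le> length zs * (m + 2)" by auto
  have u: "u \<in> prefix_vars \<Pi>'" "\<And>w. w \<in> set zs \<Longrightarrow> w \<in> prefix_vars \<Pi>'"
    using us_in_prefix[OF assms(2)] Cons.prems by auto
  have "fvars (f u) \<subseteq> left_of \<Pi>1 u"
    using Cons.prems(3)[of u] prefix_ext_left_of[OF 1(2) u(1)] by auto
  moreover have "u \<in> prefix_vars \<Pi>1" using u prefix_ext_vars[OF 1(2)] by auto
  ultimately obtain \<Pi>2 x where 2: "efrege_derivation \<F> \<Pi> \<phi> \<Pi>2 ((Ls @ L1) @ [FIff (Var x) (f u)])"
    "prefix_ext \<Pi>1 \<Pi>2" "x \<in> left_of \<Pi>2 u"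
    using extension_left_of[OF 1(1)] by metis
  have "(s(u := x)) w \<in> left_of \<Pi>2 w \<and> FIff (Var ((s(u := x)) w)) (f w) \<in> set (L1 @ [FIff (Var x) (f u)])"
    if "w \<in> set (u # zs)" for w
  proof (cases "w = u")
    case False
    then have "w \<in> set zs" using that by simp
    moreover have "left_of \<Pi>1 w \<subseteq> left_of \<Pi>2 w"
      using prefix_ext_left_of[OF 2(2)] u(2)[OF calculation] prefix_ext_vars[OF 1(2)] by blast
    ultimately show ?thesis using 1(3) False by auto
  qed (use 2 in simp)
  moreover have "fsize (f u) \<le> m" using Cons.prems(3)[of u] by simp
  ultimately show ?case
    by (intro exI[of _ \<Pi>2] exI[of _ "L1 @ [FIff (Var x) (f u)]"] exI[of _ "s(u := x)"])
      (use 1 2 prefix_ext_trans[OF 1(2) 2(2)] in auto)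
qed

lemma extend_strategy:
  assumes "efrege_derivation \<F> \<Pi> \<phi> \<Pi>' Ls" "prefix_ext \<Pi> \<Pi>'"
    "\<And>u. u \<in> set us \<Longrightarrow> fvars (f u) \<subseteq> left_of \<Pi>' u \<and> fsize (f u) \<le> m"
    "\<And>u. u \<in> set us \<Longrightarrow> fvars (g u) \<subseteq> left_of \<Pi>' u \<and> fsize (g u) \<le> m"
  obtains \<Pi>'' Ls' s v where "efrege_derivation \<F> \<Pi> \<phi> \<Pi>'' (Ls @ Ls')" "prefix_ext \<Pi>' \<Pi>''" "strategy \<Pi>'' s v"
    "\<And>u. u \<in> set us \<Longrightarrow> FIff (Var (s u)) (f u) \<in> set Ls'"
    "\<And>u. u \<in> set us \<Longrightarrow> FIff (Var (v u)) (g u) \<in> set Ls'"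
    "efrege_size Ls' \<le> 2 * N * (m + 2)"
proof -
  obtain \<Pi>1 L1 s where 1: "efrege_derivation \<F> \<Pi> \<phi> \<Pi>1 (Ls @ L1)" "prefix_ext \<Pi>' \<Pi>1"
    "\<forall>u\<in>set us. s u \<in> left_of \<Pi>1 u \<and> FIff (Var (s u)) (f u) \<in> set L1"
    "efrege_size L1 \<le> length us * (m + 2)"
    using extend_family[OF assms(1,2) order_refl distinct_us assms(3)] by auto
  have ext1: "prefix_ext \<Pi> \<Pi>1" by (rule prefix_ext_trans[OF assms(2) 1(2)])
  have "fvars (g u) \<subseteq> left_of \<Pi>1 u \<and> fsize (g u) \<le> m" if "u \<in> set us" for u
    using assms(4)[OF that] prefix_ext_left_of[OF 1(2) us_in_prefix[OF assms(2) that]] by auto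
  then obtain \<Pi>2 L2 v where 2: "efrege_derivation \<F> \<Pi> \<phi> \<Pi>2 ((Ls @ L1) @ L2)" "prefix_ext \<Pi>1 \<Pi>2"
    "\<forall>u\<in>set us. v u \<in> left_of \<Pi>2 u \<and> FIff (Var (v u)) (g u) \<in> set L2"
    "efrege_size L2 \<le> length us * (m + 2)"
    using extend_family[OF 1(1) ext1 order_refl distinct_us, of g m] by auto
  have "s u \<in> left_of \<Pi>2 u" if "u \<in> set us" for u
    using 1(3) that prefix_ext_left_of[OF 2(2) us_in_prefix[OF ext1 that]] by auto
  then have "strategy \<Pi>2 s v"
    using 2(3) prefix_ext_trans[OF ext1 2(2)] by (auto simp: strategy_def)
  moreover have "efrege_size (L1 @ L2) \<le> 2 * N * (m + 2)"
  proof -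
    have "length us * (m + 2) \<le> N * (m + 2)" using length_us by (intro mult_right_mono) auto
    then show ?thesis using 1(4) 2(4) by simp
  qed
  ultimately show thesis
    using that[of \<Pi>2 "L1 @ L2" s v] 1 2 prefix_ext_trans[OF 1(2) 2(2)] by auto
qed

lemma head_var_fun_upd: "u \<notin> set zs \<Longrightarrow> head_var (c(u := x)) zs = head_var c zs"
  by (cases zs) auto

text \<open>The definition at \<open>u\<close> mentions the variables of the preceding universal,
  which are chosen only during the construction; hence \<open>f\<close> and \<open>g\<close> take
  them as arguments. The induction introduces those for the tail, that is, for the universals
  further left, first, so that they are left of \<open>u\<close> as well.\<close>

lemma extend_chain:
  assumes "efrege_derivation \<F> \<Pi> \<phi> \<Pi>' Ls" "prefix_ext \<Pi> \<Pi>'" "set zs \<subseteq> set us"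
    "sorted_wrt (\<lambda>a b. lev \<Pi> b < lev \<Pi> a) zs"
    and f: "\<And>u A C. u \<in> set zs \<Longrightarrow> fvars (f u A C) \<subseteq> fvars A \<union> fvars C \<union> left_of \<Pi>' u"
      "\<And>u A C. u \<in> set zs \<Longrightarrow> fsize A = 1 \<Longrightarrow> fsize C = 1 \<Longrightarrow> fsize (f u A C) \<le> m"
    and g: "\<And>u A C. u \<in> set zs \<Longrightarrow> fvars (g u A C) \<subseteq> fvars A \<union> fvars C \<union> left_of \<Pi>' u"
      "\<And>u A C. u \<in> set zs \<Longrightarrow> fsize A = 1 \<Longrightarrow> fsize C = 1 \<Longrightarrow> fsize (g u A C) \<le> m"
  shows "\<exists>\<Pi>'' Ls' c d. efrege_derivation \<F> \<Pi> \<phi> \<Pi>'' (Ls @ Ls') \<and> prefix_ext \<Pi>' \<Pi>'' \<and>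
    (\<forall>u\<in>set zs. c u \<in> left_of \<Pi>'' u \<and> d u \<in> left_of \<Pi>'' u) \<and>
    (\<forall>ys u rest. zs = ys @ u # rest \<longrightarrow>
      FIff (Var (c u)) (f u (head_var c rest) (head_var d rest)) \<in> set Ls' \<and>
      FIff (Var (d u)) (g u (Var (c u)) (head_var d rest)) \<in> set Ls') \<and>
    efrege_size Ls' \<le> length zs * (2 * (m + 2))"
  using assms(3-)
proof (induction zs)
  case Nil
  show ?case
    by (intro exI[of _ \<Pi>'] exI[of _ "[]"]) (use assms in auto)
next
  case (Cons u zs)
  have "\<exists>\<Pi>'' Ls' c d. efrege_derivation \<F> \<Pi> \<phi> \<Pi>'' (Ls @ Ls') \<and> prefix_ext \<Pi>' \<Pi>'' \<and>
    (\<forall>u\<in>set zs. c u \<in> left_of \<Pi>'' u \<and> d u \<in> left_of \<Pi>'' u) \<and>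
    (\<forall>ys u rest. zs = ys @ u # rest \<longrightarrow>
      FIff (Var (c u)) (f u (head_var c rest) (head_var d rest)) \<in> set Ls' \<and>
      FIff (Var (d u)) (g u (Var (c u)) (head_var d rest)) \<in> set Ls') \<and>
    efrege_size Ls' \<le> length zs * (2 * (m + 2))"
    by (rule Cons.IH) (use Cons.prems in auto)
  then obtain \<Pi>1 L1 c d where 1: "efrege_derivation \<F> \<Pi> \<phi> \<Pi>1 (Ls @ L1)" "prefix_ext \<Pi>' \<Pi>1"
    "\<forall>u\<in>set zs. c u \<in> left_of \<Pi>1 u \<and> d u \<in> left_of \<Pi>1 u"
    "\<And>ys u rest. zs = ys @ u # rest \<Longrightarrow>
      FIff (Var (c u)) (f u (head_var c rest) (head_var d rest)) \<in> set L1 \<and>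
      FIff (Var (d u)) (g u (Var (c u)) (head_var d rest)) \<in> set L1"
    "efrege_size L1 \<le> length zs * (2 * (m + 2))" by blast
  have uz: "u \<notin> set zs" using Cons.prems(2) by auto
  have ext1: "prefix_ext \<Pi> \<Pi>1" by (rule prefix_ext_trans[OF assms(2) 1(2)])
  have u: "u \<in> prefix_vars \<Pi>'" "u \<in> prefix_vars \<Pi>1" "\<And>w. w \<in> set zs \<Longrightarrow> w \<in> prefix_vars \<Pi>1"
    using us_in_prefix[OF assms(2)] us_in_prefix[OF ext1] Cons.prems by auto
  have heads: "fvars (head_var c zs) \<subseteq> left_of \<Pi>1 u" "fvars (head_var d zs) \<subseteq> left_of \<Pi>1 u"
  proof -
    have "left_of \<Pi>1 w \<subseteq> left_of \<Pi>1 u" if "w \<in> set zs" for w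
      by (rule left_of_us_mono[OF ext1]) (use that Cons.prems in auto)
    then show "fvars (head_var c zs) \<subseteq> left_of \<Pi>1 u" "fvars (head_var d zs) \<subseteq> left_of \<Pi>1 u"
      using 1(3) by (cases zs; auto)+
  qed
  have sizes: "fsize (head_var e zs) = 1" for e by (cases zs) auto
  have left1: "left_of \<Pi>' u \<subseteq> left_of \<Pi>1 u" by (rule prefix_ext_left_of[OF 1(2) u(1)])
  let ?f = "f u (head_var c zs) (head_var d zs)"
  have "fvars ?f \<subseteq> left_of \<Pi>1 u"
    using Cons.prems(3)[of u "head_var c zs" "head_var d zs"] heads left1 by auto
  then obtain \<Pi>2 x where 2: "efrege_derivation \<F> \<Pi> \<phi> \<Pi>2 ((Ls @ L1) @ [FIff (Var x) ?f])"
    "prefix_ext \<Pi>1 \<Pi>2" "x \<in> left_of \<Pi>2 u"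
    using extension_left_of[OF 1(1) u(2)] by metis
  have u2: "u \<in> prefix_vars \<Pi>2" using u prefix_ext_vars[OF 2(2)] by auto
  have left2: "left_of \<Pi>1 u \<subseteq> left_of \<Pi>2 u" by (rule prefix_ext_left_of[OF 2(2) u(2)])
  let ?g = "g u (Var x) (head_var d zs)"
  have "fvars ?g \<subseteq> left_of \<Pi>2 u"
    using Cons.prems(5)[of u "Var x" "head_var d zs", unfolded fvars.simps] heads(2) left1 left2 2(3)
    by (simp, blast)
  then obtain \<Pi>3 y where 3: "efrege_derivation \<F> \<Pi> \<phi> \<Pi>3 (((Ls @ L1) @ [FIff (Var x) ?f]) @ [FIff (Var y) ?g])"
    "prefix_ext \<Pi>2 \<Pi>3" "y \<in> left_of \<Pi>3 u"
    using extension_left_of[OF 2(1) u2] by metis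
  let ?L = "L1 @ [FIff (Var x) ?f, FIff (Var y) ?g]" and ?c = "c(u := x)" and ?d = "d(u := y)"
  have ext13: "prefix_ext \<Pi>1 \<Pi>3" by (rule prefix_ext_trans[OF 2(2) 3(2)])
  have left: "?c w \<in> left_of \<Pi>3 w \<and> ?d w \<in> left_of \<Pi>3 w" if "w \<in> set (u # zs)" for w
  proof (cases "w = u")
    case True
    then show ?thesis using 2(3) 3(3) prefix_ext_left_of[OF 3(2) u2] by auto
  next
    case False
    then have "w \<in> set zs" using that by simp
    then show ?thesis using 1(3) False prefix_ext_left_of[OF ext13 u(3)] by auto
  qed
  have defs: "FIff (Var (?c w)) (f w (head_var ?c rest) (head_var ?d rest)) \<in> set ?L \<and>
      FIff (Var (?d w)) (g w (Var (?c w)) (head_var ?d rest)) \<in> set ?L"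
    if split: "u # zs = ys @ w # rest" for ys w rest
  proof (cases ys)
    case Nil
    then have "w = u" "rest = zs" using split by auto
    then show ?thesis using head_var_fun_upd[OF uz] by simp
  next
    case (Cons y' ys')
    then have zs: "zs = ys' @ w # rest" using split by simp
    then have "w \<noteq> u" "u \<notin> set rest" using uz by auto
    then show ?thesis using 1(4)[OF zs] head_var_fun_upd by simp
  qed
  have "fsize ?f \<le> m" "fsize ?g \<le> m"
    using Cons.prems(4)[of u] Cons.prems(6)[of u] sizes by auto
  then have "efrege_size ?L \<le> length (u # zs) * (2 * (m + 2))" using 1(5) by (simp add: algebra_simps)
  moreover have "efrege_derivation \<F> \<Pi> \<phi> \<Pi>3 (Ls @ ?L)"
    using 3(1) by simp
  moreover have "\<forall>w\<in>set (u # zs). ?c w \<in> left_of \<Pi>3 w \<and> ?d w \<in> left_of \<Pi>3 w"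
    using left by blast
  ultimately show ?case
    using prefix_ext_trans[OF 1(2) ext13] defs[THEN conjunct1] defs[THEN conjunct2]
    by (intro exI[of _ \<Pi>3] exI[of _ ?L] exI[of _ ?c] exI[of _ ?d] conjI allI impI)
qed

section \<open>Simulating single inferences\<close>

text \<open>Resolution is the most expensive rule. Its extension axioms take at most 24 symbols per
  universal for the chains and 76 for the strategy, which together give the 100.\<close>

definition cost :: nat where
  "cost = 40 * (N + 1) ^ 2 * (k * M) + 100 * (N + 1)"

lemma represents_mono:
  "represents \<Pi>' \<Gamma> D \<Longrightarrow> prefix_ext \<Pi>' \<Pi>'' \<Longrightarrow> \<Gamma> \<subseteq> \<Gamma>' \<Longrightarrow> represents \<Pi>'' \<Gamma>' D"
  unfolding represents_def using strategy_ext by blast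

definition simulates :: "prefix \<Rightarrow> form list \<Rightarrow> aclause \<Rightarrow> bool" where
  "simulates \<Pi>' Ls D \<longleftrightarrow> (\<exists>\<Pi>'' Ls'. efrege_derivation \<F> \<Pi> \<phi> \<Pi>'' (Ls @ Ls') \<and> prefix_ext \<Pi>' \<Pi>'' \<and>
     represents \<Pi>'' (set (Ls @ Ls')) D \<and> efrege_size Ls' \<le> cost)"

lemma simulatesI:
  assumes "efrege_derivation \<F> \<Pi> \<phi> \<Pi>'' (Ls @ L1)" "prefix_ext \<Pi>' \<Pi>''" "strategy \<Pi>'' s v"
    "der \<Pi>'' (set (Ls @ L1)) (40 * (N + 1) ^ 2) {FImp (cons s v) (clause_disj s v D)}"
    "efrege_size L1 \<le> 100 * (N + 1)"
  shows "simulates \<Pi>' Ls D"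
proof -
  obtain L2 where L2: "efrege_derivation \<F> \<Pi> \<phi> \<Pi>'' ((Ls @ L1) @ L2)"
    "{FImp (cons s v) (clause_disj s v D)} \<subseteq> set ((Ls @ L1) @ L2)"
    "efrege_size L2 \<le> 40 * (N + 1) ^ 2 * (k * M)"
    using assms(1,4) unfolding der_def by blast
  have "represents \<Pi>'' (set (Ls @ L1 @ L2)) D"
    unfolding represents_def using L2(2) assms(3) by auto
  moreover have "efrege_size (L1 @ L2) \<le> cost"
    using L2(3) assms(5) by (simp add: cost_def)
  ultimately show ?thesis
    unfolding simulates_def using L2(1) assms(2)
    by (intro exI[of _ \<Pi>''] exI[of _ "L1 @ L2"]) simp
qed

lemma simulates_axiom:
  assumes der: "efrege_derivation \<F> \<Pi> \<phi> \<Pi>' Ls" and ext: "prefix_ext \<Pi> \<Pi>'"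
    and C: "C \<in> set \<phi>" "\<not> tautological C" "length C \<le> N" "lvar ` set C \<inter> universals \<Pi> \<subseteq> set us"
    and wf: "wf_aclause (axiom_clause \<Pi> C)"
  shows "simulates \<Pi>' Ls (axiom_clause \<Pi> C)"
proof -
  have "efrege_derivation \<F> \<Pi> \<phi> \<Pi>' (Ls @ [clause_form C])"
    by (rule efrege_derivation.clause[OF der C(1)])
  then obtain \<Pi>'' L1 s v where 1: "efrege_derivation \<F> \<Pi> \<phi> \<Pi>'' ((Ls @ [clause_form C]) @ L1)" "prefix_ext \<Pi>' \<Pi>''"
    "strategy \<Pi>'' s v"
    "\<And>u. u \<in> set us \<Longrightarrow> FIff (Var (s u)) (const_form (falsifying \<Pi> C u \<noteq> None)) \<in> set L1"
    "\<And>u. u \<in> set us \<Longrightarrow> FIff (Var (v u)) (const_form (falsifying \<Pi> C u = Some (Const True))) \<in> set L1"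
    "efrege_size L1 \<le> 2 * N * (1 + 2)"
    by (rule extend_strategy[OF _ ext, of _ "\<lambda>u. const_form (falsifying \<Pi> C u \<noteq> None)" 1
          "\<lambda>u. const_form (falsifying \<Pi> C u = Some (Const True))"]) auto
  have "fsize (clause_form C) \<le> 3 * length C + 1"
    by (induction C rule: clause_form.induct) (auto intro: order_trans[OF add_mono[OF fsize_lit_form_le]]
        order_trans[OF fsize_lit_form_le])
  then have "efrege_size (clause_form C # L1) \<le> 100 * (N + 1)" using 1(6) C(3) by simp
  moreover have "der \<Pi>'' (set (Ls @ clause_form C # L1)) (40 * (N + 1) ^ 2)
      {FImp (cons s v) (clause_disj s v (axiom_clause \<Pi> C))}"
  proof (rule der_mono[OF der_axiom[OF 1(3) wf _ C]])
    show "clause_form C \<in> set (Ls @ clause_form C # L1)" by simp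
  next
    fix u assume "u \<in> set us"
    then show "FIff (Var (s u)) (const_form (falsifying \<Pi> C u \<noteq> None)) \<in> set (Ls @ clause_form C # L1)"
      "FIff (Var (v u)) (const_form (falsifying \<Pi> C u = Some (Const True))) \<in> set (Ls @ clause_form C # L1)"
      using 1(4,5) by (simp_all only: set_append list.set Un_iff insert_iff simp_thms)
  qed simp_all
  ultimately show ?thesis
    by (intro simulatesI[OF _ 1(2,3)]) (use 1(1) in auto)
qed

lemma simulates_instantiate:
  assumes der: "efrege_derivation \<F> \<Pi> \<phi> \<Pi>' Ls" and ext: "prefix_ext \<Pi> \<Pi>'"
    and rep: "represents \<Pi>' (set Ls) D" and wf: "wf_aclause D" "wf_aclause (inst \<Pi> \<alpha> D)"
  shows "simulates \<Pi>' Ls (inst \<Pi> \<alpha> D)"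
proof -
  obtain s v where s: "strategy \<Pi>' s v" "FImp (cons s v) (clause_disj s v D) \<in> set Ls"
    using rep unfolding represents_def by blast
  have sl: "s u \<in> left_of \<Pi>' u" "v u \<in> left_of \<Pi>' u" if "u \<in> set us" for u
    using s(1) that by (auto simp: strategy_def)
  obtain \<Pi>'' L1 s' v' where 1: "efrege_derivation \<F> \<Pi> \<phi> \<Pi>'' (Ls @ L1)" "prefix_ext \<Pi>' \<Pi>''"
    "strategy \<Pi>'' s' v'"
    "\<And>u. u \<in> set us \<Longrightarrow> FIff (Var (s' u)) (FOr (Var (s u)) (const_form (\<alpha> u \<noteq> None))) \<in> set L1"
    "\<And>u. u \<in> set us \<Longrightarrow>
      FIff (Var (v' u)) (fite (Var (s u)) (Var (v u)) (const_form (\<alpha> u = Some (Const True)))) \<in> set L1"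
    "efrege_size L1 \<le> 2 * N * (10 + 2)"
    by (rule extend_strategy[OF der ext, of "\<lambda>u. FOr (Var (s u)) (const_form (\<alpha> u \<noteq> None))" 10
          "\<lambda>u. fite (Var (s u)) (Var (v u)) (const_form (\<alpha> u = Some (Const True)))"]) (use sl in auto)
  have "der \<Pi>'' (set (Ls @ L1)) (40 * (N + 1) ^ 2) {FImp (cons s' v') (clause_disj s' v' (inst \<Pi> \<alpha> D))}"
  proof (rule der_mono[OF der_instantiate[OF strategy_ext[OF s(1) 1(2)] 1(3) wf]])
    show "FImp (cons s v) (clause_disj s v D) \<in> set (Ls @ L1)" using s(2) by simp
  next
    fix u assume "u \<in> set us"
    then show "FIff (Var (s' u)) (FOr (Var (s u)) (const_form (\<alpha> u \<noteq> None))) \<in> set (Ls @ L1)"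
      "FIff (Var (v' u)) (fite (Var (s u)) (Var (v u)) (const_form (\<alpha> u = Some (Const True)))) \<in> set (Ls @ L1)"
      using 1(4,5) by (simp_all only: set_append Un_iff simp_thms)
  qed simp_all
  then show ?thesis
    by (intro simulatesI[OF 1(1-3)]) (use 1(6) in auto)
qed

lemma simulates_merge:
  assumes der: "efrege_derivation \<F> \<Pi> \<phi> \<Pi>' Ls"
    and rep: "represents \<Pi>' (set Ls) (C \<union> {(b, \<mu>), (b, \<sigma>)})" and dom: "dom \<mu> = dom \<sigma>"
    and wf: "wf_aclause (C \<union> {(b, \<mu>), (b, \<sigma>)})" "wf_aclause (insert (b, merge_ann \<mu> \<sigma>) C)"
  shows "simulates \<Pi>' Ls (insert (b, merge_ann \<mu> \<sigma>) C)"
proof -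
  obtain s v where s: "strategy \<Pi>' s v" "FImp (cons s v) (clause_disj s v (C \<union> {(b, \<mu>), (b, \<sigma>)})) \<in> set Ls"
    using rep unfolding represents_def by blast
  have "der \<Pi>' (set (Ls @ [])) (40 * (N + 1) ^ 2) {FImp (cons s v) (clause_disj s v (insert (b, merge_ann \<mu> \<sigma>) C))}"
    by (rule der_mono[OF der_merge[OF s(1) dom wf s(2)]]) auto
  then show ?thesis
    by (intro simulatesI[where ?L1.0 = "[]", OF _ prefix_ext_refl s(1)]) (use der in auto)
qed

lemma simulates_resolve:
  assumes der: "efrege_derivation \<F> \<Pi> \<phi> \<Pi>' Ls" and ext: "prefix_ext \<Pi> \<Pi>'"
    and rep: "represents \<Pi>' (set Ls) (insert (Pos x, \<tau> ++ \<xi>) C1)"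
      "represents \<Pi>' (set Ls) (insert (Neg x, \<tau> ++ \<sigma>) C2)"
    and wf: "wf_aclause (insert (Pos x, \<tau> ++ \<xi>) C1)" "wf_aclause (insert (Neg x, \<tau> ++ \<sigma>) C2)"
      "wf_aclause (inst \<Pi> \<sigma> C1 \<union> inst \<Pi> \<xi> C2)"
    and doms: "dom \<tau> \<inter> dom \<xi> = {}" "dom \<tau> \<inter> dom \<sigma> = {}" "dom \<xi> \<inter> dom \<sigma> = {}" "ran \<tau> \<subseteq> range Const"
  shows "simulates \<Pi>' Ls (inst \<Pi> \<sigma> C1 \<union> inst \<Pi> \<xi> C2)"
proof -
  obtain s1 v1 where s1: "strategy \<Pi>' s1 v1"
    "FImp (cons s1 v1) (clause_disj s1 v1 (insert (Pos x, \<tau> ++ \<xi>) C1)) \<in> set Ls"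
    using rep(1) unfolding represents_def by blast
  obtain s2 v2 where s2: "strategy \<Pi>' s2 v2"
    "FImp (cons s2 v2) (clause_disj s2 v2 (insert (Neg x, \<tau> ++ \<sigma>) C2)) \<in> set Ls"
    using rep(2) unfolding represents_def by blast
  \<comment> \<open>Copies of the constants of \<open>irm_resolution\<close>, which can be
    interpreted only after \<open>c1\<close>, \<open>c2\<close>, \<open>s\<close> and
    \<open>v\<close> have been introduced.\<close>
  define a1 where "a1 u = (if lev \<Pi> u < lev \<Pi> x then ann_form (Var (s1 u)) (Var (v1 u)) (or_else (\<xi> u) (\<tau> u)) else Var x)" for u
  define a2 where "a2 u = (if lev \<Pi> u < lev \<Pi> x then ann_form (Var (s2 u)) (Var (v2 u)) (or_else (\<sigma> u) (\<tau> u)) else FNot (Var x))" for u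
  have x: "x \<in> existentials \<Pi>" using wf_aclause_lvar[OF wf(1), of "Pos x" "\<tau> ++ \<xi>"] by simp
  have sl: "s1 u \<in> left_of \<Pi>' u" "v1 u \<in> left_of \<Pi>' u" "s2 u \<in> left_of \<Pi>' u" "v2 u \<in> left_of \<Pi>' u"
    if "u \<in> set us" for u
    using s1(1) s2(1) that by (auto simp: strategy_def)
  \<comment> \<open>The chains mention the pivot only at universals that are not left of it. As the
    pivot is existential, these are strictly right of it, so the new variables may depend on
    it.\<close>
  have xl: "x \<in> left_of \<Pi>' u" if u: "u \<in> set us" "\<not> lev \<Pi> u < lev \<Pi> x" for u
  proof -
    have uv: "u \<in> prefix_vars \<Pi>" "x \<in> prefix_vars \<Pi>" "u \<noteq> x"
      using u x us_universal universals_subset universal_not_existential by blast+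
    then have "lev \<Pi> x < lev \<Pi> u"
      using u(2) lev_inj by (metis linorder_neqE_nat)
    then show ?thesis
      using uv ext unfolding left_of_def prefix_ext_def by blast
  qed
  have fa: "fvars (a1 u) \<subseteq> left_of \<Pi>' u" "fvars (a2 u) \<subseteq> left_of \<Pi>' u" "fsize (a1 u) \<le> 4" "fsize (a2 u) \<le> 4"
    if "u \<in> set us" for u
    using sl[OF that] xl[OF that] ann_form_Var_bounds(1) unfolding a1_def a2_def
    by (auto dest!: ann_form_Var_bounds(2))
  obtain \<Pi>1 L1 c1 c2 where 1: "efrege_derivation \<F> \<Pi> \<phi> \<Pi>1 (Ls @ L1)" "prefix_ext \<Pi>' \<Pi>1"
    "\<forall>u\<in>set us. c1 u \<in> left_of \<Pi>1 u \<and> c2 u \<in> left_of \<Pi>1 u"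
    "\<forall>ys u rest. us = ys @ u # rest \<longrightarrow>
      FIff (Var (c1 u)) (FOr (head_var c1 rest) (FAnd (FNot (head_var c2 rest)) (FNot (a1 u)))) \<in> set L1 \<and>
      FIff (Var (c2 u)) (FOr (head_var c2 rest) (FAnd (FNot (Var (c1 u))) (FNot (a2 u)))) \<in> set L1"
    "efrege_size L1 \<le> length us * (2 * (10 + 2))"
    \<comment> \<open>An annotation on variables has size at most 4, which gives 10 for a definition
      in the chains.\<close>
    using extend_chain[OF der ext order_refl us_sorted, where m = 10
        and f = "\<lambda>u A C. FOr A (FAnd (FNot C) (FNot (a1 u)))" and g = "\<lambda>u A C. FOr C (FAnd (FNot A) (FNot (a2 u)))"] fa
    by fastforce
  have ext1: "prefix_ext \<Pi> \<Pi>1" by (rule prefix_ext_trans[OF ext 1(2)])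
  have sl1: "s1 u \<in> left_of \<Pi>1 u" "v1 u \<in> left_of \<Pi>1 u" "s2 u \<in> left_of \<Pi>1 u" "v2 u \<in> left_of \<Pi>1 u"
    if "u \<in> set us" for u
    using sl[OF that] prefix_ext_left_of[OF 1(2) us_in_prefix[OF ext that]] by auto
  obtain \<Pi>2 L2 s v where 2: "efrege_derivation \<F> \<Pi> \<phi> \<Pi>2 ((Ls @ L1) @ L2)" "prefix_ext \<Pi>1 \<Pi>2" "strategy \<Pi>2 s v"
    "\<And>u. u \<in> set us \<Longrightarrow> FIff (Var (s u))
      (set_form (Var (c1 u)) (Var (c2 u)) (Var (s1 u)) (Var (s2 u)) (\<xi> u) (\<sigma> u)) \<in> set L2"
    "\<And>u. u \<in> set us \<Longrightarrow> FIff (Var (v u))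
      (val_form (Var (c1 u)) (Var (c2 u)) (Var (s1 u)) (Var (v1 u)) (Var (s2 u)) (Var (v2 u)) (\<xi> u) (\<sigma> u)) \<in> set L2"
    "efrege_size L2 \<le> 2 * N * (36 + 2)"
    \<comment> \<open>On variables, \<open>val_form\<close> has size 36 and \<open>set_form\<close>
      is smaller.\<close>
    by (rule extend_strategy[OF 1(1) ext1,
          of "\<lambda>u. set_form (Var (c1 u)) (Var (c2 u)) (Var (s1 u)) (Var (s2 u)) (\<xi> u) (\<sigma> u)" 36
            "\<lambda>u. val_form (Var (c1 u)) (Var (c2 u)) (Var (s1 u)) (Var (v1 u)) (Var (s2 u)) (Var (v2 u)) (\<xi> u) (\<sigma> u)"])
      (use sl1 1(3) in auto)
  have ext2: "prefix_ext \<Pi>' \<Pi>2" by (rule prefix_ext_trans[OF 1(2) 2(2)])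
  interpret R: irm_resolution \<F> k \<Pi> \<phi> M us N \<Pi>2 "set ((Ls @ L1) @ L2)" x \<tau> \<xi> \<sigma> C1 C2 s1 v1 s2 v2 c1 c2 s v
  proof
    show "strategy \<Pi>2 s1 v1" "strategy \<Pi>2 s2 v2" using strategy_ext s1 s2 ext2 by blast+
    have "strategy \<Pi>1 c1 c2" using 1(3) ext1 by (simp add: strategy_def)
    then show "strategy \<Pi>2 c1 c2" using strategy_ext 2(2) by blast
  qed (use 2(3) wf doms s1(2) s2(2) in auto)
  have "R.a1 = a1" "R.a2 = a2" by (auto simp: fun_eq_iff R.a1_def R.a2_def a1_def a2_def)
  then have "R.defined"
    using 1(4) 2(4,5) unfolding R.defined_def R.def1_def R.def2_def R.defs_def R.defv_def by auto
  then have "der \<Pi>2 (set (Ls @ L1 @ L2)) (40 * (N + 1) ^ 2)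
      {FImp (cons s v) (clause_disj s v (inst \<Pi> \<sigma> C1 \<union> inst \<Pi> \<xi> C2))}"
    using R.der_resolve by simp
  then show ?thesis
    by (intro simulatesI[OF _ ext2 2(3)]) (use 2(1,6) 1(5) length_us in auto)
qed

fun wf_line :: "irm_line \<Rightarrow> bool" where
  "wf_line (Axiom_Line C D) \<longleftrightarrow> wf_aclause D \<and> length C \<le> N \<and> lvar ` set C \<inter> universals \<Pi> \<subseteq> set us"
| "wf_line (Rule_Line D) \<longleftrightarrow> wf_aclause D"

lemma wf_line_concl: "wf_line L \<Longrightarrow> wf_aclause (concl L)"
  by (cases L) auto

lemma simulates_rule:
  assumes "irm_rule \<Pi> Ds D" "efrege_derivation \<F> \<Pi> \<phi> \<Pi>' Ls" "prefix_ext \<Pi> \<Pi>'"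
    "\<And>C. C \<in> Ds \<Longrightarrow> represents \<Pi>' (set Ls) C \<and> wf_aclause C" "wf_aclause D"
  shows "simulates \<Pi>' Ls D"
  using assms(1)
proof cases
  case (instantiate C \<tau>)
  then show ?thesis using simulates_instantiate[OF assms(2,3)] assms(4,5) by blast
next
  case (resolve x \<tau> \<xi> C\<^sub>1 \<sigma> C\<^sub>2)
  then show ?thesis using simulates_resolve[OF assms(2,3)] assms(4,5) by blast
next
  case (merge C b \<mu> \<sigma>)
  then show ?thesis using simulates_merge[OF assms(2)] assms(4,5) by blast
qed

lemma simulate_derivation:
  assumes "irm_derivation \<Pi> \<phi> \<pi>" "\<And>L. L \<in> set \<pi> \<Longrightarrow> wf_line L"
  shows "\<exists>\<Pi>' Ls. efrege_derivation \<F> \<Pi> \<phi> \<Pi>' Ls \<and> prefix_ext \<Pi> \<Pi>' \<and>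
    (\<forall>L\<in>set \<pi>. represents \<Pi>' (set Ls) (concl L)) \<and> efrege_size Ls \<le> length \<pi> * cost"
proof -
  have step: "\<exists>\<Pi>' Ls. efrege_derivation \<F> \<Pi> \<phi> \<Pi>' Ls \<and> prefix_ext \<Pi> \<Pi>' \<and>
      (\<forall>L\<in>set (\<pi> @ [L']). represents \<Pi>' (set Ls) (concl L)) \<and> efrege_size Ls \<le> length (\<pi> @ [L']) * cost"
    if "efrege_derivation \<F> \<Pi> \<phi> \<Pi>' Ls" "prefix_ext \<Pi> \<Pi>'" "\<forall>L\<in>set \<pi>. represents \<Pi>' (set Ls) (concl L)"
      "efrege_size Ls \<le> length \<pi> * cost" "simulates \<Pi>' Ls (concl L')" for \<pi> L' \<Pi>' Ls
  proof -
    from that(5) obtain \<Pi>'' Ls' where *: "efrege_derivation \<F> \<Pi> \<phi> \<Pi>'' (Ls @ Ls')" "prefix_ext \<Pi>' \<Pi>''"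
      "represents \<Pi>'' (set (Ls @ Ls')) (concl L')" "efrege_size Ls' \<le> cost"
      unfolding simulates_def by blast
    have "represents \<Pi>'' (set (Ls @ Ls')) (concl L)" if "L \<in> set \<pi>" for L
      by (rule represents_mono[OF _ *(2)]) (use that \<open>\<forall>L\<in>set \<pi>. _\<close> in auto)
    then show ?thesis
      by (intro exI[of _ \<Pi>''] exI[of _ "Ls @ Ls'"]) (use * that prefix_ext_trans in auto)
  qed
  from assms show ?thesis
  proof (induction rule: irm_derivation.induct)
    case empty
    show ?case
      by (intro exI[of _ \<Pi>] exI[of _ "[]"]) (auto intro: efrege_derivation.empty)
  next
    case (axiom \<pi> C)
    then obtain \<Pi>' Ls where *: "efrege_derivation \<F> \<Pi> \<phi> \<Pi>' Ls" "prefix_ext \<Pi> \<Pi>'"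
      "\<forall>L\<in>set \<pi>. represents \<Pi>' (set Ls) (concl L)" "efrege_size Ls \<le> length \<pi> * cost" by auto
    from axiom.prems[of "Axiom_Line C (axiom_clause \<Pi> C)"] have "simulates \<Pi>' Ls (axiom_clause \<Pi> C)"
      using simulates_axiom[OF *(1,2) axiom.hyps(2,3)] by simp
    then show ?case by (intro step[OF *]) simp
  next
    case (rule \<pi> D)
    then obtain \<Pi>' Ls where *: "efrege_derivation \<F> \<Pi> \<phi> \<Pi>' Ls" "prefix_ext \<Pi> \<Pi>'"
      "\<forall>L\<in>set \<pi>. represents \<Pi>' (set Ls) (concl L)" "efrege_size Ls \<le> length \<pi> * cost" by auto
    have "wf_aclause D" "\<And>L. L \<in> set \<pi> \<Longrightarrow> wf_aclause (concl L)"
      using rule.prems[of "Rule_Line D"] rule.prems wf_line_concl by auto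
    then have "simulates \<Pi>' Ls D"
      using simulates_rule[OF rule.hyps(2) *(1,2)] *(3) by auto
    then show ?case by (intro step[OF *]) simp
  qed
qed

section \<open>Universal reduction for the empty clause\<close>

text \<open>The head of the list is the rightmost universal, and the formulas of all others lie left
  of it, so it can be reduced. Of the two substituted consistency formulas one holds whatever
  \<open>s u\<close> and \<open>v u\<close> are, hence the two reduced lines together eliminate this
  conjunct.\<close>

lemma reduce_strategy:
  assumes "efrege_derivation \<F> \<Pi> \<phi> \<Pi>' Ls" "strategy \<Pi>' s v"
    "FImp (conjs (map (cons_form s v) zs)) FBot \<in> set Ls" "good \<Pi>' (conjs (map (cons_form s v) zs))"
    "set zs \<subseteq> set us" "sorted_wrt (\<lambda>a b. lev \<Pi> b < lev \<Pi> a) zs"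
  shows "\<exists>Ls'. efrege_derivation \<F> \<Pi> \<phi> \<Pi>' (Ls @ Ls') \<and> FBot \<in> set (Ls @ Ls') \<and>
    efrege_size Ls' \<le> (length zs + 1) * (2 * (M + 2) + k * M)"
  using assms
proof (induction zs arbitrary: Ls)
  case Nil
  have "der \<Pi>' (set Ls) 1 {FBot}"
    by (rule der_rule[where ps = "[FImp FTop FBot]" and c = FBot and As = "[]"])
      (use Nil in \<open>auto simp: bounded_sound_rules_def entails_def\<close>)
  then show ?case
    using Nil(1) unfolding der_def by force
next
  case (Cons u zs)
  let ?R = "conjs (map (cons_form s v) zs)"
  let ?A = "FImp (conjs (map (cons_form s v) (u # zs))) FBot"
  let ?A' = "\<lambda>b. FImp (FAnd (FImp (Var (s u)) (FIff (const_form b) (Var (v u)))) ?R) FBot"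
  have ext: "prefix_ext \<Pi> \<Pi>'" using Cons.prems(2) by (simp add: strategy_def)
  have u: "u \<in> set us" "s u \<in> left_of \<Pi>' u" "v u \<in> left_of \<Pi>' u"
    using Cons.prems(2,5) by (auto simp: strategy_def)
  have R: "fvars ?R \<subseteq> left_of \<Pi>' u"
  proof -
    have "fvars (cons_form s v w) \<subseteq> left_of \<Pi>' u" if w: "w \<in> set zs" for w
    proof -
      have "w \<in> set us" "lev \<Pi> w < lev \<Pi> u" using w Cons.prems by auto
      then have "left_of \<Pi>' w \<subseteq> left_of \<Pi>' u" "w \<in> left_of \<Pi>' u"
        using left_of_us_mono[OF ext u(1)] by auto
      moreover have "s w \<in> left_of \<Pi>' w" "v w \<in> left_of \<Pi>' w"
        using Cons.prems(2) \<open>w \<in> set us\<close> by (auto simp: strategy_def)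
      ultimately show ?thesis by (auto simp: cons_form_def)
    qed
    then show ?thesis by (auto simp: fvars_conjs)
  qed
  \<comment> \<open>Consequently the substitution changes only the conjunct that belongs to
    \<open>u\<close>.\<close>
  have "u \<notin> left_of \<Pi>' u" by (simp add: left_of_def)
  then have A': "subst (Var(u := const_form b)) ?A = ?A' b" for b
    using u R by (auto simp: cons_form_def intro!: subst_id)
  have univ: "u \<in> universals \<Pi>'" using u(1) us_universal ext by (auto simp: prefix_ext_def)
  have lev: "\<not> lev \<Pi>' u < lev \<Pi>' w" if "w \<in> fvars ?A" for w
    using that u R by (auto simp: cons_form_def left_of_def)
  have uA: "u \<in> fvars ?A" by (simp add: cons_form_def)
  have "efrege_derivation \<F> \<Pi> \<phi> \<Pi>' (Ls @ [?A' False])"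
    using efrege_derivation.reduction[OF Cons.prems(1,3) univ uA lev, of False] by (simp only: A')
  moreover have "?A \<in> set (Ls @ [?A' False])" using Cons.prems(3) by simp
  ultimately have 1: "efrege_derivation \<F> \<Pi> \<phi> \<Pi>' (Ls @ [?A' False, ?A' True])"
    using efrege_derivation.reduction[OF _ _ univ uA lev, of \<F> \<Pi> \<phi> "Ls @ [?A' False]" True]
    by (simp only: A' append_assoc append.simps)
  have goodR: "good \<Pi>' ?R" using Cons.prems(4) by auto
  have sizes: "fsize (?A' b) \<le> M + 2" for b
    using Cons.prems(4) by (simp add: good_def cons_form_def[of s v u])
  have "der \<Pi>' (set (Ls @ [?A' False, ?A' True])) 1 {FImp ?R FBot}"
    by (rule der_rule[where ps = "[FImp (FAnd (FImp (Var 0) (FIff FBot (Var 1))) (Var 2)) FBot,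
          FImp (FAnd (FImp (Var 0) (FIff FTop (Var 1))) (Var 2)) FBot]" and c = "FImp (Var 2) FBot"
          and As = "[Var (s u), Var (v u), ?R]"])
      (use goodR good_strategy[OF Cons.prems(2) u(1)] in
        \<open>auto simp: bounded_sound_rules_def entails_def const_form_def\<close>)
  then obtain L2 where L2: "efrege_derivation \<F> \<Pi> \<phi> \<Pi>' ((Ls @ [?A' False, ?A' True]) @ L2)"
    "FImp ?R FBot \<in> set ((Ls @ [?A' False, ?A' True]) @ L2)" "efrege_size L2 \<le> k * M"
    using 1 unfolding der_def by force
  obtain L3 where L3: "efrege_derivation \<F> \<Pi> \<phi> \<Pi>' (((Ls @ [?A' False, ?A' True]) @ L2) @ L3)"
    "FBot \<in> set (((Ls @ [?A' False, ?A' True]) @ L2) @ L3)"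
    "efrege_size L3 \<le> (length zs + 1) * (2 * (M + 2) + k * M)"
    using Cons.IH[OF L2(1) Cons.prems(2) L2(2) goodR] Cons.prems(5,6) by auto
  have "efrege_size ([?A' False, ?A' True] @ L2 @ L3) \<le> (length (u # zs) + 1) * (2 * (M + 2) + k * M)"
    using L2(3) L3(3) sizes[of False] sizes[of True] unfolding efrege_size_append by (simp add: algebra_simps)
  moreover have "(((Ls @ [?A' False, ?A' True]) @ L2) @ L3) = Ls @ [?A' False, ?A' True] @ L2 @ L3"
    by (simp only: append_assoc)
  ultimately show ?case
    using L3(1,2) by metis
qed

lemma simulate_refutation:
  assumes "irm_refutation \<Pi> \<phi> \<pi>" "\<And>L. L \<in> set \<pi> \<Longrightarrow> wf_line L"
  shows "\<exists>\<rho>. efrege_refutation \<F> \<Pi> \<phi> \<rho> \<and>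
    efrege_size \<rho> \<le> length \<pi> * cost + (N + 1) * (2 * (M + 2) + k * M)"
proof -
  obtain \<Pi>' Ls where Ls: "efrege_derivation \<F> \<Pi> \<phi> \<Pi>' Ls" "prefix_ext \<Pi> \<Pi>'"
    "\<forall>L\<in>set \<pi>. represents \<Pi>' (set Ls) (concl L)" "efrege_size Ls \<le> length \<pi> * cost"
    using simulate_derivation[of \<pi>] assms unfolding irm_refutation_def by blast
  have "represents \<Pi>' (set Ls) {}"
    using Ls(3) assms(1) unfolding irm_refutation_def by (auto simp: image_iff)
  then obtain s v where s: "strategy \<Pi>' s v" "FImp (cons s v) (clause_disj s v {}) \<in> set Ls"
    unfolding represents_def by blast
  have "enum ({} :: aclause) = []" using length_enum[of "{} :: aclause"] by simp
  then have "FImp (conjs (map (cons_form s v) us)) FBot \<in> set Ls"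
    using s(2) by (simp add: cons_def clause_disj_def)
  then obtain L2 where L2: "efrege_derivation \<F> \<Pi> \<phi> \<Pi>' (Ls @ L2)" "FBot \<in> set (Ls @ L2)"
    "efrege_size L2 \<le> (length us + 1) * (2 * (M + 2) + k * M)"
    using reduce_strategy[OF Ls(1) s(1) _ _ order_refl us_sorted] good_cons[OF s(1)] by (auto simp: cons_def)
  have "efrege_size L2 \<le> (N + 1) * (2 * (M + 2) + k * M)"
    by (rule order_trans[OF L2(3) mult_right_mono]) (use length_us in auto)
  then have "efrege_size (Ls @ L2) \<le> length \<pi> * cost + (N + 1) * (2 * (M + 2) + k * M)"
    using Ls(4) by (simp only: efrege_size_append add_mono)
  then show ?thesis
    using L2(1,2) unfolding efrege_refutation_def by blast
qed

end

section \<open>Annotated clauses of IRM-calc\<close>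

text \<open>The part of \<open>wf_aclause\<close> that is an invariant of the rules. The bounds by
  \<open>N\<close> come from the sizes of the individual lines instead.\<close>

definition annotated_clause :: "prefix \<Rightarrow> aclause \<Rightarrow> bool" where
  "annotated_clause \<Pi> D \<longleftrightarrow> finite D \<and> (\<forall>(l, \<tau>)\<in>D. lvar l \<in> existentials \<Pi> \<and>
     dom \<tau> \<subseteq> universals \<Pi> \<inter> {u. lev \<Pi> u < lev \<Pi> (lvar l)})"

lemma annotated_clause_Un [simp]:
  "annotated_clause \<Pi> (C \<union> D) \<longleftrightarrow> annotated_clause \<Pi> C \<and> annotated_clause \<Pi> D"
  unfolding annotated_clause_def by blast

lemma annotated_clause_insert [simp]:
  "annotated_clause \<Pi> (insert (l, \<tau>) D) \<longleftrightarrow> lvar l \<in> existentials \<Pi> \<and>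
     dom \<tau> \<subseteq> universals \<Pi> \<inter> {u. lev \<Pi> u < lev \<Pi> (lvar l)} \<and> annotated_clause \<Pi> D"
  unfolding annotated_clause_def by auto

lemma finite_universals: "finite (universals \<Pi>)"
proof (rule finite_subset)
  show "universals \<Pi> \<subseteq> snd ` set \<Pi>" by (force simp: universals_def)
qed simp

lemma annotated_clause_axiom: "annotated_clause \<Pi> (axiom_clause \<Pi> C)"
proof -
  have "axiom_clause \<Pi> C \<subseteq> (\<lambda>l. (l, restrict_ann \<Pi> l (falsifying \<Pi> C))) ` set C"
    by (auto simp: axiom_clause_def)
  then have "finite (axiom_clause \<Pi> C)" by (rule finite_subset) simp
  then show ?thesis
    by (auto simp: annotated_clause_def axiom_clause_def restrict_ann_def falsifying_def restrict_map_def
        split: if_splits)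
qed

lemma annotated_clause_inst:
  assumes "annotated_clause \<Pi> D" "dom \<alpha> \<subseteq> universals \<Pi>"
  shows "annotated_clause \<Pi> (inst \<Pi> \<alpha> D)"
proof -
  have "inst \<Pi> \<alpha> D = (\<lambda>(l, \<tau>). (l, restrict_ann \<Pi> l (completion \<tau> \<alpha>))) ` D"
    by (auto simp: inst_def)
  then have "finite (inst \<Pi> \<alpha> D)" using assms(1) by (simp add: annotated_clause_def)
  moreover have "lvar l \<in> existentials \<Pi> \<and> dom \<rho> \<subseteq> universals \<Pi> \<inter> {u. lev \<Pi> u < lev \<Pi> (lvar l)}"
    if l: "(l, \<rho>) \<in> inst \<Pi> \<alpha> D" for l \<rho>
  proof -
    obtain \<tau> where \<tau>: "(l, \<tau>) \<in> D" "\<rho> = restrict_ann \<Pi> l (completion \<tau> \<alpha>)"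
      using l by (auto simp: inst_def)
    then have "lvar l \<in> existentials \<Pi>" "dom \<tau> \<subseteq> universals \<Pi>"
      using assms(1) unfolding annotated_clause_def by blast+
    then show ?thesis using assms(2) \<tau>(2) by (auto simp: restrict_ann_def completion_def)
  qed
  ultimately show ?thesis unfolding annotated_clause_def by blast
qed

lemma annotated_clause_rule:
  assumes "irm_rule \<Pi> Ds D" "\<And>C. C \<in> Ds \<Longrightarrow> annotated_clause \<Pi> C"
  shows "annotated_clause \<Pi> D"
  using assms(1)
proof cases
  case (instantiate C \<tau>)
  then show ?thesis using annotated_clause_inst assms(2) by blast
next
  case (resolve x \<tau> \<xi> C\<^sub>1 \<sigma> C\<^sub>2)
  then show ?thesis
    using assms(2)[OF resolve(2)] assms(2)[OF resolve(3)] by (auto intro!: annotated_clause_inst)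
next
  case (merge C b \<mu> \<sigma>)
  have "dom (merge_ann \<mu> \<sigma>) \<subseteq> dom \<mu> \<union> dom \<sigma>"
    by (auto simp: merge_ann_def split: if_splits)
  then show ?thesis
    using assms(2)[OF merge(2)] merge(1) by (simp, blast)
qed

lemma annotated_clause_derivation:
  assumes "irm_derivation \<Pi> \<phi> \<pi>" "L \<in> set \<pi>"
  shows "annotated_clause \<Pi> (concl L)"
  using assms
proof (induction arbitrary: L rule: irm_derivation.induct)
  case (rule \<pi> D)
  have "annotated_clause \<Pi> D"
    by (rule annotated_clause_rule[OF rule.hyps(2)]) (use rule.IH in auto)
  then show ?case using rule by auto
qed (auto simp: annotated_clause_axiom)

section \<open>Size of a refutation and the variables occurring in it\<close>

lemma card_le_aclause_size: "card D \<le> aclause_size D"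
proof -
  have "card D = (\<Sum>d\<in>D. 1)" by simp
  also have "\<dots> \<le> aclause_size D" unfolding aclause_size_def by (rule sum_mono) auto
  finally show ?thesis .
qed

lemma irm_line_size_le: "L \<in> set \<pi> \<Longrightarrow> irm_line_size L \<le> irm_size \<pi>"
  unfolding irm_size_def by (rule member_le_sum_list) auto

lemma length_le_irm_size: "length \<pi> \<le> irm_size \<pi>"
proof (induction \<pi>)
  case (Cons L \<pi>)
  have "1 \<le> irm_line_size L" by (cases L) auto
  then show ?case using Cons by (simp add: irm_size_def)
qed simp

text \<open>An axiom line contributes the variables of the recorded clause too: its universals need
  not occur in any annotation, but the strategy has to falsify them.\<close>

fun line_vars :: "irm_line \<Rightarrow> var set" where
  "line_vars (Axiom_Line C D) = lvar ` set C \<union> (\<Union>(l, \<tau>)\<in>D. dom \<tau>)"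
| "line_vars (Rule_Line D) = (\<Union>(l, \<tau>)\<in>D. dom \<tau>)"

lemma card_annotation_vars_le:
  assumes "finite D"
  shows "card (\<Union>(l, \<tau>)\<in>D. dom \<tau>) \<le> aclause_size D"
proof -
  have "card (\<Union>d\<in>D. dom (snd d)) \<le> (\<Sum>d\<in>D. card (dom (snd d)))"
    by (rule card_UN_le[OF assms])
  also have "\<dots> \<le> aclause_size D" unfolding aclause_size_def by (rule sum_mono) auto
  finally show ?thesis by (simp add: case_prod_beta)
qed

lemma card_line_vars_le:
  assumes "finite (concl L)"
  shows "card (line_vars L) \<le> irm_line_size L"
proof (cases L)
  case (Axiom_Line C D)
  have "card (lvar ` set C) \<le> length C"
    using card_image_le[of "set C" lvar] card_length[of C] by simp
  then show ?thesis
    using card_annotation_vars_le[of D] assms Axiom_Line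
      card_Un_le[of "lvar ` set C" "\<Union>(l, \<tau>)\<in>D. dom \<tau>"] by simp
next
  case (Rule_Line D)
  then show ?thesis using card_annotation_vars_le[of D] assms by simp
qed

lemma card_lines_vars_le:
  assumes "\<And>L. L \<in> set \<pi> \<Longrightarrow> finite (concl L)"
  shows "card (\<Union>L\<in>set \<pi>. line_vars L) \<le> irm_size \<pi>"
  using assms
proof (induction \<pi>)
  case (Cons L \<pi>)
  have "card (\<Union>L\<in>set (L # \<pi>). line_vars L) \<le> card (line_vars L) + card (\<Union>L\<in>set \<pi>. line_vars L)"
    using card_Un_le by simp
  then show ?case
    using Cons card_line_vars_le[of L] by (fastforce simp: irm_size_def)
qed simp

lemma list_by_descending_level:
  assumes "U \<subseteq> prefix_vars \<Pi>" "finite U"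
  obtains us where "set us = U" "sorted_wrt (\<lambda>a b. lev \<Pi> b < lev \<Pi> a) us" "length us = card U"
proof -
  obtain xs where xs: "set xs = U" "distinct xs" using finite_distinct_list[OF assms(2)] by blast
  let ?ys = "sort_key (lev \<Pi>) xs"
  have "inj_on (lev \<Pi>) U" using assms(1) lev_inj by (meson inj_onI subsetD)
  then have "distinct (map (lev \<Pi>) ?ys)" using xs by (simp add: distinct_map)
  then have "sorted_wrt (<) (map (lev \<Pi>) ?ys)" by (simp add: strict_sorted_iff)
  then have "sorted_wrt (\<lambda>a b. lev \<Pi> b < lev \<Pi> a) (rev ?ys)"
    by (simp add: sorted_wrt_map sorted_wrt_rev)
  moreover have "set (rev ?ys) = U" "length (rev ?ys) = card U" using xs by (auto simp: distinct_card)
  ultimately show thesis using that by blast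
qed

section \<open>The polynomial bound\<close>

theorem theorem5p9:
  fixes \<F> :: "frege_rule set"
  assumes "frege_system \<F>"
  shows "\<exists>P :: nat poly. \<forall>\<Pi> \<phi> \<pi>.
    closed_pcnf \<Pi> \<phi> \<longrightarrow> irm_refutation \<Pi> \<phi> \<pi> \<longrightarrow>
    (\<exists>\<rho>. efrege_refutation \<F> \<Pi> \<phi> \<rho> \<and> efrege_size \<rho> \<le> poly P (irm_size \<pi>))"
proof -
  obtain k where k: "simulation_bound \<F> k" using simulation_bound_exists[OF assms] by blast
  show ?thesis
  \<comment> \<open>With \<open>n = N + 1\<close>, there are at most \<open>n\<close> lines, each
    simulated by quadratically many inferences that cost \<open>k * M\<close> with \<open>M\<close>
    quadratic; hence the degree 5.\<close>
  proof (intro exI[of _ "smult (1000 * k + 1000) ([:1, 1:] ^ 5)"] allI impI)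
    fix \<Pi> \<phi> \<pi>
    assume closed: "closed_pcnf \<Pi> \<phi>" and ref: "irm_refutation \<Pi> \<phi> \<pi>"
    then have der: "irm_derivation \<Pi> \<phi> \<pi>" by (simp add: irm_refutation_def)
    define N where "N = irm_size \<pi>"
    define M where "M = 20 * (N + 1) ^ 2"
    define U where "U = universals \<Pi> \<inter> (\<Union>L\<in>set \<pi>. line_vars L)"
    have ann: "annotated_clause \<Pi> (concl L)" if "L \<in> set \<pi>" for L
      by (rule annotated_clause_derivation[OF der that])
    have fin: "finite (concl L)" if "L \<in> set \<pi>" for L
      using ann[OF that] by (simp add: annotated_clause_def)
    \<comment> \<open>Annotations are partial maps and may a priori have infinite domains, for which
      cardinalities would be meaningless; here they consist of universals of the prefix.\<close>
    have "finite (line_vars L)" if "L \<in> set \<pi>" for L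
    proof -
      have "finite (dom \<tau>)" if "(l, \<tau>) \<in> concl L" for l \<tau>
      proof (rule finite_subset[OF _ finite_universals])
        show "dom \<tau> \<subseteq> universals \<Pi>"
          using ann[OF \<open>L \<in> set \<pi>\<close>] that unfolding annotated_clause_def by blast
      qed
      then show ?thesis using fin[OF that] by (cases L) auto
    qed
    then have "card U \<le> card (\<Union>L\<in>set \<pi>. line_vars L)"
      unfolding U_def by (intro card_mono) auto
    also have "\<dots> \<le> N" unfolding N_def by (rule card_lines_vars_le) (rule fin)
    finally have card_U: "card U \<le> N" .
    have "U \<subseteq> prefix_vars \<Pi>"
      by (force simp: U_def universals_def prefix_vars_def)
    moreover have "finite U" using finite_universals by (simp add: U_def)
    ultimately obtain us where us: "set us = U" "sorted_wrt (\<lambda>a b. lev \<Pi> b < lev \<Pi> a) us" "length us = card U"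
      by (rule list_by_descending_level)
    interpret irm_simulation \<F> k \<Pi> \<phi> M us N
      by unfold_locales (use k closed us card_U in \<open>auto simp: M_def U_def\<close>)
    have "wf_line L" if L: "L \<in> set \<pi>" for L
    proof -
      have "card (concl L) \<le> irm_line_size L"
        using card_le_aclause_size[of "concl L"] by (cases L) auto
      then have "card (concl L) \<le> N" using irm_line_size_le[OF L] by (simp add: N_def)
      moreover have "dom \<tau> \<subseteq> set us" if "(l, \<tau>) \<in> concl L" for l \<tau>
      proof -
        have "dom \<tau> \<subseteq> line_vars L" using that by (cases L) auto
        moreover have "dom \<tau> \<subseteq> universals \<Pi>"
          using ann[OF L] that unfolding annotated_clause_def by blast
        ultimately show ?thesis using L us(1) by (auto simp: U_def)
      qed
      ultimately have wf: "wf_aclause (concl L)"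
        using ann[OF L] fin[OF L] unfolding wf_aclause_def annotated_clause_def by blast
      show ?thesis
      proof (cases L)
        case (Axiom_Line C D)
        then have "length C \<le> N" using irm_line_size_le[OF L] by (simp add: N_def)
        moreover have "lvar ` set C \<inter> universals \<Pi> \<subseteq> set us"
          using L Axiom_Line us(1) by (force simp: U_def)
        ultimately show ?thesis using wf Axiom_Line by simp
      qed (use wf in simp)
    qed
    then obtain \<rho> where \<rho>: "efrege_refutation \<F> \<Pi> \<phi> \<rho>"
      "efrege_size \<rho> \<le> length \<pi> * cost + (N + 1) * (2 * (M + 2) + k * M)"
      using simulate_refutation[OF ref] by blast
    define n where "n = N + 1"
    have "length \<pi> \<le> n" using length_le_irm_size[of \<pi>] by (simp add: n_def N_def)
    then have "length \<pi> * cost \<le> n * cost" by (rule mult_right_mono) simp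
    then have "efrege_size \<rho> \<le> n * cost + n * (2 * (M + 2) + k * M)"
      using \<rho>(2) unfolding n_def by linarith
    \<comment> \<open>The factor 800 is the product of 40, from the inferences per line, and 20,
      from \<open>M\<close>.\<close>
    also have "\<dots> = 800 * k * n ^ 5 + 100 * n ^ 2 + (40 * n ^ 3 + 4 * n + 20 * k * n ^ 3)"
    proof -
      have "n ^ 5 = n * n * n * n * n" by (simp add: numeral_eq_Suc)
      then show ?thesis
        unfolding cost_def unfolding M_def n_def[symmetric]
        by (simp add: algebra_simps power2_eq_square power3_eq_cube)
    qed
    also have "\<dots> \<le> (1000 * k + 1000) * n ^ 5"
    proof -
      have "n ^ 2 \<le> n ^ 5" "n ^ 3 \<le> n ^ 5" "n ^ 1 \<le> n ^ 5"
        by (rule power_increasing; simp add: n_def)+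
      then have "100 * n ^ 2 \<le> 100 * n ^ 5" "40 * n ^ 3 \<le> 40 * n ^ 5" "4 * n \<le> 4 * n ^ 5"
        "20 * k * n ^ 3 \<le> 20 * k * n ^ 5" by simp_all
      moreover have "(1000 * k + 1000) * n ^ 5 = 800 * k * n ^ 5 + 200 * k * n ^ 5 + 1000 * n ^ 5"
        by (simp add: algebra_simps)
      moreover have "20 * k * n ^ 5 \<le> 200 * k * n ^ 5" by simp
      ultimately show ?thesis by linarith
    qed
    also have "\<dots> = poly (smult (1000 * k + 1000) ([:1, 1:] ^ 5)) (irm_size \<pi>)"
      by (simp add: n_def N_def poly_power add.commute)
    finally show "\<exists>\<rho>. efrege_refutation \<F> \<Pi> \<phi> \<rho> \<and>
        efrege_size \<rho> \<le> poly (smult (1000 * k + 1000) ([:1, 1:] ^ 5)) (irm_size \<pi>)"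
      using \<rho>(1) by blast
  qed
qed

end
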